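(* Let $K\subseteq\mathbb{R}^2$ be a closed convex set with non-empty interior whose interior contains no point of $\mathbb{Z}^2$. Let $w:=w(K)$ be its lattice width and $A:=A(K)\in(0,\infty]$ its area. Then \begin{align*} A&\le\infty &&\text{for } 0<w\le 1,\\ A&\le \frac{w^2}{2(w-1)} &&\text{for } 1<w\le 2,\\ A&\le \frac{3w^2}{3w+1-\sqrt{1+6w-3w^2}} &&\text{for } 2<w\le 1+\tfrac{2}{\sqrt3},\\ A&\ge \tfrac38 w^2 &&\text{for } 0<w\le 1+\tfrac{2}{\sqrt3}. \end{align*} Furthermore: (I) Equality in the first bound (i.e. $A=\infty$ with $0<w\le1$) holds if and only if $K$ is unbounded and contained in a split. (II) For $1<w\le2$, equality $A=\frac{w^2}{2(w-1)}$ holds if and only if, up to a unimodular transformation, $K=\operatorname{conv}(I_1\cup I_2)$, where $I_1$ is a translate of the segment $\operatorname{conv}\{(0,0),(w,0)\}$, $I_2$ is a translate of the segment $\operatorname{conv}\{(0,0),(0,\frac{w}{w-1})\}$, and $I_1\cap I_2\neq\emptyset$. (III) For $2<w\le 1+\frac{2}{\sqrt3}$, equality $A=\frac{3w^2}{3w+1-\sqrt{1+6w-3w^2}}$ holds if and only if $K$ is a triangle with vertices $q_0,q_1,q_2$ such that for every $i\in\{0,1,2\}$ (indices modulo $3$) the point $p_i:=\lambda q_{i+1}+(1-\lambda)q_{i+2}$ belongs to $\mathbb{Z}^2$, where $\lambda:=\frac{3w+1-\sqrt{1+6w-3w^2}}{6w}$. (IV) If $0<w\le2$, then equality $A=\frac38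 w^2$ holds if and only if, up to a unimodular transformation, $K$ is a translate of $\frac{w}{2}\operatorname{conv}\{(1,0),(0,1),(-1,-1)\}$.
   Context: For $u\in\mathbb{R}^2$ the width function is $w(K,u):=\sup\{u^\top x:x\in K\}-\inf\{u^\top x:x\in K\}$ (possibly $+\infty$), and the lattice width is $w(K):=\min\{w(K,u):u\in\mathbb{Z}^2\setminus\{o\}\}$. A unimodular transformation is an affine bijection of $\mathbb{R}^2$ mapping $\mathbb{Z}^2$ onto $\mathbb{Z}^2$. A strip is $\operatorname{conv}(l^1\cup l^2)$ for distinct parallel lines $l^1,l^2$; a split is a strip whose interior contains no integer points and such that $l^1\cap\mathbb{Z}^2$ and $l^2\cap\mathbb{Z}^2$ are affine images of $\mathbb{Z}$ (equivalently, a set $\{x: b\le a_1x_1+a_2x_2\le b+1\}$ with $a_1,a_2$ coprime integers and $b\in\mathbb{Z}$). *)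

theory Defs
  imports "HOL-Analysis.Analysis"
begin

definition Z2 :: "(real \<times> real) set" where
  "Z2 = (\<int> \<times> \<int>)"

definition width_fun :: "(real \<times> real) set \<Rightarrow> real \<times> real \<Rightarrow> ereal" where
  "width_fun K u = (SUP x\<in>K. ereal (u \<bullet> x)) - (INF x\<in>K. ereal (u \<bullet> x))"

definition lattice_width :: "(real \<times> real) set \<Rightarrow> ereal" where
  "lattice_width K = (INF u\<in>Z2 - {0}. width_fun K u)"

definition area :: "(real \<times> real) set \<Rightarrow> ennreal" where
  "area K = emeasure lborel K"

definition unimodular :: "(real \<times> real \<Rightarrow> real \<times> real) \<Rightarrow> bool" where
  "unimodular T \<longleftrightarrow> (\<exists>L b. linear L \<and> T = (\<lambda>x. L x + b)) \<and> bij T \<and> T ` Z2 = Z2"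

definition is_split :: "(real \<times> real) set \<Rightarrow> bool" where
  "is_split S \<longleftrightarrow> (\<exists>a1 a2 b :: int. coprime a1 a2 \<and>
      S = {x. of_int b \<le> of_int a1 * fst x + of_int a2 * snd x
              \<and> of_int a1 * fst x + of_int a2 * snd x \<le> of_int b + 1})"

end

theory Submission
  imports Defs
begin

text \<open>
  Everything is elementary once a lattice direction realising the lattice width w is made the
  first coordinate direction by a unimodular map.

  The bound 3/8 w^2 holds for every convex body. Take a longest vertical chord, of length F; its
  endpoints carry parallel supporting lines, and after an integer shear and a reflection their
  slope lies in [0, 1/2]. The chord and the width w in the first direction give an area of at least
  F w / 2, which settles F >= 3/4 w. Otherwise the points realising the widths in the directions y
  and y - x force F >= w / 2 and an area of at least 2 F (w - F), which again is at least 3/8 w^2.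

  For 1 < w <= 2 the interval of first coordinates has one or two interior integers. Each of these
  vertical lines meets the body in a segment between consecutive lattice points, and supporting
  lines through these lattice points enclose the body in an explicit polygon.

  For w > 2 consider the unit parallelogram spanned by the lattice points around the sections at
  two consecutive integers. If the interior of the body met all four sides, the width would be
  at most 2; if it met only the two vertical ones, another direction would have width less than w.
  Hence exactly three sides are met. Minimality of w then allows a choice of supporting
  lines at three of the vertices that form a triangle with these vertices on its edges, and its area and three of its
  lattice widths are rational functions of the positions of the three points on the edges.

  In all equality cases the body is contained in, or contains, a convex polygon of the same area.
\<close>

subsection \<open>Affine maps and areas\<close>

definition aff :: "real \<Rightarrow> real \<Rightarrow> real \<Rightarrow> real \<Rightarrow> real \<Rightarrow> real \<Rightarrow> real \<times> real \<Rightarrow> real \<times> real" where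
  "aff a b c d e f p = (a * fst p + b * snd p + e, c * fst p + d * snd p + f)"

lemma aff_fst_snd [simp]:
  "fst (aff a b c d e f p) = a * fst p + b * snd p + e"
  "snd (aff a b c d e f p) = c * fst p + d * snd p + f"
  by (simp_all add: aff_def)

lemma aff_Pair: "aff a b c d e f (x, y) = (a * x + b * y + e, c * x + d * y + f)"
  by (simp add: aff_def)

lemma aff_comp:
  "aff a b c d e f \<circ> aff a' b' c' d' e' f' =
   aff (a*a'+b*c') (a*b'+b*d') (c*a'+d*c') (c*b'+d*d') (a*e'+b*f'+e) (c*e'+d*f'+f)"
  by (auto simp: aff_def fun_eq_iff algebra_simps)

lemma aff_id: "aff 1 0 0 1 0 0 = id"
  by (auto simp: aff_def fun_eq_iff)

lemma aff_linear_plus: "aff a b c d e f = (\<lambda>x. aff a b c d 0 0 x + (e, f))"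
  by (auto simp: aff_def fun_eq_iff)

lemma linear_aff: "linear (aff a b c d 0 0)"
  by (rule linearI) (auto simp: aff_def algebra_simps)

lemma aff_inverse:
  assumes "a*d - b*c \<noteq> 0"
  obtains a' b' c' d' e' f' where
    "aff a b c d e f \<circ> aff a' b' c' d' e' f' = id" "aff a' b' c' d' e' f' \<circ> aff a b c d e f = id"
proof -
  define D where "D = a*d - b*c"
  have D: "D \<noteq> 0" "a*d = D + b*c" using assms by (auto simp: D_def)
  have *: "(a*d)/D - (b*c)/D = 1"
    using D by (simp add: divide_simps)
  have c: "a*(d/D) + b*(-c/D) = 1" "c*(-b/D) + d*(a/D) = 1" 
    "(d/D)*a + (-b/D)*c = 1" "(-c/D)*b+(a/D)*d = 1"
    using * by (simp_all add: algebra_simps)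
  have e: "a*((b*f-d*e)/D) + b*((c*e-a*f)/D) = -e" "c*((b*f-d*e)/D) + d*((c*e-a*f)/D) = -f"
    using D(1) by (simp_all add: field_simps) (simp_all add: D_def algebra_simps)
  show ?thesis
  proof (rule that[of "d/D" "-b/D" "-c/D" "a/D" "(b*f-d*e)/D" "(c*e-a*f)/D"])
    show "aff a b c d e f \<circ> aff (d/D) (-b/D) (-c/D) (a/D) ((b*f-d*e)/D) ((c*e-a*f)/D) = id"
      unfolding aff_comp c e aff_id[symmetric] by (simp add: algebra_simps)
    show "aff (d/D) (-b/D) (-c/D) (a/D) ((b*f-d*e)/D) ((c*e-a*f)/D) \<circ> aff a b c d e f = id"
      unfolding aff_comp c aff_id[symmetric]
      by (simp add: algebra_simps add_divide_distrib diff_divide_distrib)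
  qed
qed

lemma bij_aff: "a*d - b*c \<noteq> 0 \<Longrightarrow> bij (aff a b c d e f)"
  by (metis aff_inverse o_bij)

lemma continuous_on_aff: "continuous_on S (aff a b c d e f)"
  unfolding aff_def by (intro continuous_intros)

lemma compact_aff: "compact K \<Longrightarrow> compact (aff a b c d e f ` K)"
  by (rule compact_continuous_image[OF continuous_on_aff])

lemma convex_aff: "convex K \<Longrightarrow> convex (aff a b c d e f ` K)"
  by (subst aff_linear_plus, subst image_image[symmetric, where f="\<lambda>x. x + (e, f)"])
    (simp add: add.commute[of _ "(e, f)"] convex_translation convex_linear_image linear_aff)

lemma convex_hull_aff: "aff a b c d e f ` (convex hull S) = convex hull (aff a b c d e f ` S)"
proof -
  have "aff a b c d e f ` X = (\<lambda>x. (e, f) + x) ` (aff a b c d 0 0 ` X)" for X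
    by (subst aff_linear_plus) (simp add: image_image add.commute)
  then show ?thesis
    by (simp add: convex_hull_linear_image[OF linear_aff] convex_hull_translation)
qed

lemma image_eq_vimage_if_inverse:
  assumes "f \<circ> g = id" "g \<circ> f = id"
  shows "f ` U = g -` U"
proof -
  have "\<And>x. f (g x) = x" "\<And>x. g (f x) = x" using assms by (metis comp_apply id_apply)+
  then show ?thesis by (auto simp: image_def) metis
qed

lemma interior_aff:
  assumes "a*d - b*c \<noteq> 0"
  shows "interior (aff a b c d e f ` K) = aff a b c d e f ` interior K"
proof -
  obtain a' b' c' d' e' f' where i:
    "aff a b c d e f \<circ> aff a' b' c' d' e' f' = id" "aff a' b' c' d' e' f' \<circ> aff a b c d e f = id"
    using aff_inverse[OF assms] .
  let ?T = "aff a b c d e f" and ?S = "aff a' b' c' d' e' f'"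
  have op: "open (?T ` U)" if "open U" for U
  proof -
    have "?T ` U = ?S -` U" using i by (intro image_eq_vimage_if_inverse)
    then show ?thesis using that continuous_on_aff[of UNIV a' b' c' d' e' f'] by (simp add: open_vimage)
  qed
  have op2: "open (?S ` U)" if "open U" for U
  proof -
    have "?S ` U = ?T -` U" using i by (intro image_eq_vimage_if_inverse)
    then show ?thesis using that continuous_on_aff[of UNIV a b c d e f] by (simp add: open_vimage)
  qed
  show ?thesis
  proof
    show "?T ` interior K \<subseteq> interior (?T ` K)"
      by (intro interior_maximal op image_mono interior_subset open_interior)
    have "?S ` interior (?T ` K) \<subseteq> interior K"
    proof (intro interior_maximal op2 open_interior)
      have "?S ` interior (?T ` K) \<subseteq> ?S ` (?T ` K)" by (intro image_mono interior_subset)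
      also have "\<dots> = K" using i(2) by (simp add: image_comp)
      finally show "?S ` interior (?T ` K) \<subseteq> K" .
    qed
    then have "?T ` ?S ` interior (?T ` K) \<subseteq> ?T ` interior K" by blast
    then show "interior (?T ` K) \<subseteq> ?T ` interior K" using i(1) by (simp add: image_comp)
  qed
qed

definition scales :: "(real \<times> real \<Rightarrow> real \<times> real) \<Rightarrow> real \<Rightarrow> bool" where
  "scales T r \<longleftrightarrow> T \<in> borel_measurable borel \<and>
     (\<forall>f\<in>borel_measurable borel. (\<integral>\<^sup>+x. f x \<partial>lborel) = ennreal r * (\<integral>\<^sup>+x. f (T x) \<partial>lborel))"

lemma borel_measurable_aff: "aff a b c d e f \<in> borel_measurable borel"
  by (rule borel_measurable_continuous_onI[OF continuous_on_aff])

lemma scales_comp: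
  assumes "scales S r" "scales T s" "r \<ge> 0" "s \<ge> 0"
  shows "scales (S \<circ> T) (r * s)"
  unfolding scales_def
proof safe
  show "S \<circ> T \<in> borel_measurable borel"
    using assms by (auto simp: scales_def intro: measurable_comp)
  fix f :: "real \<times> real \<Rightarrow> ennreal" assume f: "f \<in> borel_measurable borel"
  have "(\<integral>\<^sup>+x. f x \<partial>lborel) = ennreal r * (\<integral>\<^sup>+x. f (S x) \<partial>lborel)"
    using assms f by (auto simp: scales_def)
  also have "(\<integral>\<^sup>+x. f (S x) \<partial>lborel) = ennreal s * (\<integral>\<^sup>+x. f (S (T x)) \<partial>lborel)"
    using assms f by (auto simp: scales_def intro: measurable_compose)
  finally show "(\<integral>\<^sup>+x. f x \<partial>lborel) = ennreal (r * s) * (\<integral>\<^sup>+x. f ((S \<circ> T) x) \<partial>lborel)"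
    using assms by (simp add: ennreal_mult mult.assoc)
qed

lemma nn_integral_lborel_pair:
  fixes f :: "real \<times> real \<Rightarrow> ennreal"
  assumes "f \<in> borel_measurable borel"
  shows "(\<integral>\<^sup>+x. f x \<partial>lborel) = (\<integral>\<^sup>+x. \<integral>\<^sup>+y. f (x, y) \<partial>lborel \<partial>lborel)"
    "(\<integral>\<^sup>+x. f x \<partial>lborel) = (\<integral>\<^sup>+y. \<integral>\<^sup>+x. f (x, y) \<partial>lborel \<partial>lborel)"
proof -
  have f: "f \<in> borel_measurable (lborel \<Otimes>\<^sub>M lborel)"
    using assms by (simp add: lborel_prod)
  show "(\<integral>\<^sup>+x. f x \<partial>lborel) = (\<integral>\<^sup>+x. \<integral>\<^sup>+y. f (x, y) \<partial>lborel \<partial>lborel)"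
    using lborel.nn_integral_fst[OF f] by (simp add: lborel_prod)
  show "(\<integral>\<^sup>+x. f x \<partial>lborel) = (\<integral>\<^sup>+y. \<integral>\<^sup>+x. f (x, y) \<partial>lborel \<partial>lborel)"
    using lborel_pair.nn_integral_snd[OF f] by (simp add: lborel_prod)
qed

lemma scales_swap: "scales (aff 0 1 1 0 0 0) 1"
  unfolding scales_def
proof safe
  fix f :: "real \<times> real \<Rightarrow> ennreal" assume f: "f \<in> borel_measurable borel"
  have g: "(\<lambda>x. f (aff 0 1 1 0 0 0 x)) \<in> borel_measurable borel"
    by (rule measurable_compose[OF borel_measurable_aff f])
  show "(\<integral>\<^sup>+x. f x \<partial>lborel) = ennreal 1 * (\<integral>\<^sup>+x. f (aff 0 1 1 0 0 0 x) \<partial>lborel)"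
    by (subst nn_integral_lborel_pair(1)[OF f], subst nn_integral_lborel_pair(2)[OF g])
      (simp add: aff_Pair)
qed (rule borel_measurable_aff)

lemma scales_lower:
  assumes "d \<noteq> 0" shows "scales (aff 1 0 c d 0 f) \<bar>d\<bar>"
  unfolding scales_def
proof safe
  fix h :: "real \<times> real \<Rightarrow> ennreal" assume h: "h \<in> borel_measurable borel"
  have g: "(\<lambda>x. h (aff 1 0 c d 0 f x)) \<in> borel_measurable borel"
    by (rule measurable_compose[OF borel_measurable_aff h])
  have hx: "(\<lambda>y. h (x, y)) \<in> borel_measurable borel" for x
    using h by (rule measurable_compose[rotated]) (intro borel_measurable_continuous_onI continuous_intros)
  have "(\<integral>\<^sup>+x. h x \<partial>lborel) = (\<integral>\<^sup>+x. \<integral>\<^sup>+y. h (x, y) \<partial>lborel \<partial>lborel)"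
    by (rule nn_integral_lborel_pair(1)[OF h])
  also have "\<dots> = (\<integral>\<^sup>+x. ennreal \<bar>d\<bar> * (\<integral>\<^sup>+y. h (x, (c*x+f) + d*y) \<partial>lborel) \<partial>lborel)"
    by (intro nn_integral_cong nn_integral_real_affine hx assms)
  also have "\<dots> = ennreal \<bar>d\<bar> * (\<integral>\<^sup>+x. (\<integral>\<^sup>+y. h (x, (c*x+f) + d*y) \<partial>lborel) \<partial>lborel)"
  proof (rule nn_integral_cmult)
    have "(\<lambda>p. h (fst p, c * fst p + f + d * snd p)) \<in> borel_measurable (lborel \<Otimes>\<^sub>M lborel)"
      using g by (simp add: lborel_prod aff_def algebra_simps)
    from lborel.borel_measurable_nn_integral_fst[OF this]
    show "(\<lambda>x. \<integral>\<^sup>+y. h (x, (c*x+f) + d*y) \<partial>lborel) \<in> borel_measurable lborel"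
      by simp
  qed
  also have "(\<integral>\<^sup>+x. (\<integral>\<^sup>+y. h (x, (c*x+f) + d*y) \<partial>lborel) \<partial>lborel) = (\<integral>\<^sup>+x. h (aff 1 0 c d 0 f x) \<partial>lborel)"
    by (subst nn_integral_lborel_pair(1)[OF g]) (simp add: aff_Pair algebra_simps)
  finally show "(\<integral>\<^sup>+x. h x \<partial>lborel) = ennreal \<bar>d\<bar> * (\<integral>\<^sup>+x. h (aff 1 0 c d 0 f x) \<partial>lborel)" .
qed (rule borel_measurable_aff)

lemma scales_aff:
  assumes "a*d - b*c \<noteq> 0"
  shows "scales (aff a b c d e f) \<bar>a*d - b*c\<bar>"
proof -
  have main: "scales (aff a b c d e f) \<bar>a*d - b*c\<bar>"
    if "a*d - b*c \<noteq> 0" "a \<noteq> 0" for a b c d e f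
  proof -
    have "scales (aff 0 1 1 0 0 0 \<circ> (aff 1 0 b a 0 e \<circ> aff 0 1 1 0 0 0)) (1 * (\<bar>a\<bar> * 1))"
      by (intro scales_comp scales_swap scales_lower that) auto
    then have 1: "scales (aff a b 0 1 e 0) \<bar>a\<bar>"
      by (simp add: aff_comp)
    have nz: "d - b*c/a \<noteq> 0" using that by (auto simp: field_simps)
    have "scales (aff 1 0 (c/a) (d-b*c/a) 0 (f - c*e/a) \<circ> aff a b 0 1 e 0) (\<bar>d-b*c/a\<bar> * \<bar>a\<bar>)"
      by (intro scales_comp scales_lower 1 nz) auto
    moreover have "\<bar>d-b*c/a\<bar> * \<bar>a\<bar> = \<bar>a*d - b*c\<bar>"
      using that by (simp add: abs_mult[symmetric] field_simps)
    ultimately show ?thesis using that by (simp add: aff_comp algebra_simps)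
  qed
  show ?thesis
  proof (cases "a = 0")
    case True
    then have "scales (aff 0 1 1 0 0 0 \<circ> aff c d a b f e) (1 * \<bar>c*b - d*a\<bar>)"
      by (intro scales_comp scales_swap main) (use assms in auto)
    with True show ?thesis by (simp add: aff_comp abs_minus_commute mult.commute)
  qed (use main assms in auto)
qed

lemma emeasure_aff:
  assumes "a*d - b*c \<noteq> 0" "closed K"
  shows "emeasure lborel (aff a b c d e f ` K) = ennreal \<bar>a*d - b*c\<bar> * emeasure lborel K"
proof -
  let ?T = "aff a b c d e f"
  obtain a' b' c' d' e' f' where i:
    "?T \<circ> aff a' b' c' d' e' f' = id" "aff a' b' c' d' e' f' \<circ> ?T = id"
    using aff_inverse[OF assms(1)] .
  have "?T ` K = aff a' b' c' d' e' f' -` K" using i by (intro image_eq_vimage_if_inverse)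
  then have cl: "closed (?T ` K)" using assms(2) by (simp add: closed_vimage continuous_on_aff)
  have "emeasure lborel (?T ` K) = (\<integral>\<^sup>+x. indicator (?T ` K) x \<partial>lborel)"
    using cl by (intro nn_integral_indicator[symmetric]) (auto intro: borel_closed)
  also have "\<dots> = ennreal \<bar>a*d - b*c\<bar> * (\<integral>\<^sup>+x. indicator (?T ` K) (?T x) \<partial>lborel)"
  proof -
    have "indicator (?T ` K) \<in> borel_measurable (borel :: (real \<times> real) measure)"
      using cl by (intro borel_measurable_indicator borel_closed)
    then show ?thesis using scales_aff[OF assms(1), of e f] unfolding scales_def by blast
  qed
  also have "(\<integral>\<^sup>+x. indicator (?T ` K) (?T x) \<partial>lborel) = (\<integral>\<^sup>+x. indicator K x \<partial>lborel)"
    using bij_aff[OF assms(1), of e f] by (intro nn_integral_cong) (auto simp: indicator_def bij_def inj_def)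
  also have "\<dots> = emeasure lborel K"
    using assms(2) by (intro nn_integral_indicator) (auto intro: borel_closed)
  finally show ?thesis .
qed

lemma measure_aff:
  assumes "a*d - b*c \<noteq> 0" "closed K"
  shows "measure lborel (aff a b c d e f ` K) = \<bar>a*d - b*c\<bar> * measure lborel K"
  by (simp add: measure_def emeasure_aff[OF assms] enn2real_mult)

lemma measure_region:
  fixes l u :: "real \<Rightarrow> real"
  assumes "continuous_on UNIV l" "continuous_on UNIV u" "\<And>x. x \<in> {a..b} \<Longrightarrow> l x \<le> u x"
    and "((\<lambda>x. u x - l x) has_integral I) {a..b}"
  shows "measure lborel {p. a \<le> fst p \<and> fst p \<le> b \<and> l (fst p) \<le> snd p \<and> snd p \<le> u (fst p)} = I"
    (is "measure lborel ?S = I")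
proof -
  have cl: "closed ?S"
    by (intro closed_Collect_conj closed_Collect_le continuous_intros
      continuous_on_compose2[OF assms(1)] continuous_on_compose2[OF assms(2)]) auto
  have "emeasure lborel ?S = (\<integral>\<^sup>+p. indicator ?S p \<partial>lborel)"
    using cl by (intro nn_integral_indicator[symmetric]) (auto intro: borel_closed)
  also have "\<dots> = (\<integral>\<^sup>+x. \<integral>\<^sup>+y. indicator ?S (x, y) \<partial>lborel \<partial>lborel)"
    using cl by (intro nn_integral_lborel_pair(1) borel_measurable_indicator) (auto intro: borel_closed)
  also have "\<dots> = (\<integral>\<^sup>+x. ennreal ((u x - l x) * indicator {a..b} x) \<partial>lborel)"
  proof (rule nn_integral_cong)
    fix x
    have "(\<integral>\<^sup>+y. indicator ?S (x, y) \<partial>lborel) = (\<integral>\<^sup>+y. indicator {l x..u x} y * indicator {a..b} x \<partial>lborel)"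
      by (intro nn_integral_cong) (auto simp: indicator_def)
    also have "\<dots> = (\<integral>\<^sup>+y. indicator {l x..u x} y \<partial>lborel) * indicator {a..b} x"
      by (rule nn_integral_multc) auto
    also have "\<dots> = ennreal ((u x - l x) * indicator {a..b} x)"
      using assms(3)[of x] by (subst nn_integral_indicator) (auto split: split_indicator)
    finally show "(\<integral>\<^sup>+y. indicator ?S (x, y) \<partial>lborel) = ennreal ((u x - l x) * indicator {a..b} x)" .
  qed
  also have "\<dots> = ennreal I"
  proof (rule nn_integral_has_integral_lborel)
    have "(\<lambda>x. u x - l x) \<in> borel_measurable borel"
      by (intro borel_measurable_continuous_onI continuous_intros assms)
    then show "(\<lambda>x. (u x - l x) * indicator {a..b} x) \<in> borel_measurable borel"
      by (intro borel_measurable_times borel_measurable_indicator) auto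
    show "0 \<le> (u x - l x) * indicator {a..b} x" for x
      using assms(3)[of x] by (auto simp: indicator_def)
    have "((\<lambda>x. if x \<in> {a..b} then u x - l x else 0) has_integral I) UNIV"
      using assms(4) by (simp only: has_integral_restrict_UNIV)
    then show "((\<lambda>x. (u x - l x) * indicator {a..b} x) has_integral I) UNIV"
      by (rule has_integral_eq[rotated]) (auto simp: indicator_def)
  qed
  finally have e: "emeasure lborel ?S = ennreal I" .
  have "I \<ge> 0" using has_integral_nonneg[OF assms(4)] assms(3) by auto
  with e show ?thesis by (simp add: measure_def)
qed

lemma std_triangle:
  "convex hull {(0,0), (1,0), (0,1)} =
     {p. (0::real) \<le> fst p \<and> fst p \<le> 1 \<and> (0::real) \<le> snd p \<and> snd p \<le> 1 - fst p}"
  (is "_ = ?R")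
proof
  show "?R \<subseteq> convex hull {(0,0), (1,0), (0,1)}"
  proof
    fix p :: "real \<times> real" assume "p \<in> ?R"
    then show "p \<in> convex hull {(0,0), (1,0), (0,1)}"
      unfolding convex_hull_3
      by (intro CollectI exI[of _ "1 - fst p - snd p"] exI[of _ "fst p"] exI[of _ "snd p"])
        (auto simp: prod_eq_iff)
  qed
qed (auto simp: convex_hull_3)

lemma measure_std_triangle: "measure lborel (convex hull {(0,0), (1,0), (0,1::real)} :: (real\<times>real) set) = 1/2"
proof -
  have "((\<lambda>x::real. (1 - x) - 0) has_integral (1 - 1\<^sup>2/2) - (0 - 0\<^sup>2/2)) {0..1}"
    by (rule fundamental_theorem_of_calculus)
      (auto intro!: derivative_eq_intros simp flip: has_real_derivative_iff_has_vector_derivative)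
  then show ?thesis
    unfolding std_triangle by (subst measure_region[where I="1/2"]) (auto intro!: continuous_intros)
qed

definition cross :: "real \<times> real \<Rightarrow> real \<times> real \<Rightarrow> real \<times> real \<Rightarrow> real" where
  "cross p q r = (fst q - fst p) * (snd r - snd p) - (fst r - fst p) * (snd q - snd p)"

lemma measure_triangle:
  assumes "cross p q r \<noteq> 0"
  shows "measure lborel (convex hull {p, q, r}) = \<bar>cross p q r\<bar> / 2"
proof -
  let ?T = "aff (fst q - fst p) (fst r - fst p) (snd q - snd p) (snd r - snd p) (fst p) (snd p)"
  have "convex hull {p, q, r} = ?T ` (convex hull {(0,0), (1,0), (0,1)})"
    unfolding convex_hull_aff by (simp add: aff_Pair)
  moreover have "closed (convex hull {(0,0), (1,0), (0,1)} :: (real\<times>real) set)"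
    by (intro compact_imp_closed finite_imp_compact_convex_hull) auto
  ultimately show ?thesis
    using assms measure_aff[of "fst q - fst p" "snd r - snd p" "fst r - fst p" "snd q - snd p"
       "convex hull {(0,0), (1,0), (0,1)}"]
    by (simp add: measure_std_triangle cross_def)
qed

lemma compact_fmeasurable: "compact K \<Longrightarrow> K \<in> fmeasurable lborel"
  by (intro fmeasurableI) (use emeasure_bounded_finite[OF compact_imp_bounded] in \<open>auto simp: borel_compact less_top\<close>)

lemma measure_mono_compact:
  assumes "A \<subseteq> B" "compact A" "compact B"
  shows "measure lborel A \<le> measure lborel B"
  using assms by (intro measure_mono_fmeasurable compact_fmeasurable) (auto simp: borel_compact)

lemma triangle_le_measure:
  assumes "compact K" "convex K" "p \<in> K" "q \<in> K" "r \<in> K"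
  shows "\<bar>cross p q r\<bar> / 2 \<le> measure lborel K"
proof (cases "cross p q r = 0")
  case False
  have "convex hull {p, q, r} \<subseteq> K" using assms by (intro hull_minimal) auto
  then show ?thesis
    unfolding measure_triangle[OF False, symmetric] using assms
    by (intro measure_mono_compact finite_imp_compact_convex_hull) auto
qed auto

lemma compact_convex_halves:
  fixes m n c :: real
  assumes "compact K" "convex K"
  shows "compact (K \<inter> {x. m * fst x + n * snd x \<le> c})" "convex (K \<inter> {x. m * fst x + n * snd x \<le> c})"
    "compact (K \<inter> {x. m * fst x + n * snd x \<ge> c})" "convex (K \<inter> {x. m * fst x + n * snd x \<ge> c})"
proof -
  have "{x. m * fst x + n * snd x \<le> c} = {x. (m, n) \<bullet> x \<le> c}" "{x. m * fst x + n * snd x \<ge> c} = {x. (m, n) \<bullet> x \<ge> c}"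
    by (auto simp: inner_prod_def)
  then show "compact (K \<inter> {x. m * fst x + n * snd x \<le> c})" "convex (K \<inter> {x. m * fst x + n * snd x \<le> c})"
    "compact (K \<inter> {x. m * fst x + n * snd x \<ge> c})" "convex (K \<inter> {x. m * fst x + n * snd x \<ge> c})"
    using assms by (auto intro: compact_Int_closed closed_halfspace_le closed_halfspace_ge
      convex_Int convex_halfspace_le convex_halfspace_ge)
qed

lemma measure_split:
  fixes m n c :: real
  assumes "(m, n) \<noteq> (0, 0)" "compact K"
  shows "measure lborel K = measure lborel (K \<inter> {p. m * fst p + n * snd p \<le> c})
     + measure lborel (K \<inter> {p. m * fst p + n * snd p \<ge> c})"
proof -
  let ?A = "K \<inter> {p. m * fst p + n * snd p \<le> c}" and ?B = "K \<inter> {p. m * fst p + n * snd p \<ge> c}"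
  have c: "compact ?A" "compact ?B"
  proof -
    have "closed {p :: real \<times> real. m * fst p + n * snd p \<le> c}"
      by (rule closed_Collect_le; intro continuous_intros)
    moreover have "closed {p :: real \<times> real. c \<le> m * fst p + n * snd p}"
      by (rule closed_Collect_le; intro continuous_intros)
    ultimately show "compact ?A" "compact ?B" using assms(2) by (auto intro: compact_Int_closed)
  qed
  have "compact (?A \<inter> ?B)" by (rule compact_Int[OF c])
  have cl: "closed {p. m * fst p + n * snd p = c}"
    by (intro closed_Collect_eq continuous_intros)
  have "measure lborel (?A \<inter> ?B) = 0"
  proof -
    have n: "emeasure lborel {p. m * fst p + n * snd p = c} = 0"
    proof -
      have "{p. m * fst p + n * snd p = c} = {p. (m, n) \<bullet> p = c}" by (auto simp: inner_prod_def)
      then have "negligible {p. m * fst p + n * snd p = c}"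
        using negligible_hyperplane[of "(m, n)" c] assms(1) by (auto simp: zero_prod_def)
      then have "emeasure lebesgue {p. m * fst p + n * snd p = c} = 0"
        by (auto simp: negligible_iff_null_sets null_sets_def)
      then show ?thesis using cl by (simp add: borel_closed)
    qed
    have "emeasure lborel (?A \<inter> ?B) \<le> emeasure lborel {p. m * fst p + n * snd p = c}"
      by (rule emeasure_mono) (auto simp: borel_closed cl)
    then show ?thesis using n by (simp add: measure_def)
  qed
  moreover have "measure lborel (?A \<union> ?B) + measure lborel (?A \<inter> ?B) = measure lborel ?A + measure lborel ?B"
    using measure_Un3[of ?A lborel ?B] compact_fmeasurable[OF c(1)] compact_fmeasurable[OF c(2)] by linarith
  moreover have "?A \<union> ?B = K" by auto
  ultimately show ?thesis by simp
qed

lemma eq_if_measure_le: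
  fixes K P :: "(real \<times> real) set"
  assumes "closed K" "K \<subseteq> P" "compact P" "convex P" "interior P \<noteq> {}"
    and "measure lborel P \<le> measure lborel K"
  shows "K = P"
proof (rule ccontr)
  assume "K \<noteq> P"
  then obtain z where z: "z \<in> P" "z \<notin> K" using assms by auto
  have "z \<in> closure (interior P)"
    using convex_closure_interior[OF assms(4,5)] z(1) closure_subset by blast
  moreover have "open (- K)" "z \<in> - K" using assms z by (auto simp: open_Compl)
  ultimately have "interior P \<inter> - K \<noteq> {}"
    by (metis open_Int_closure_eq_empty disjoint_iff inf_commute)
  then obtain y where y: "y \<in> interior P \<inter> - K" by auto
  have "open (interior P \<inter> - K)" using \<open>open (- K)\<close> by auto
  then obtain e where e: "e > 0" "cball y e \<subseteq> interior P \<inter> - K"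
    using y open_contains_cball by blast
  have K: "compact K" using assms by (meson compact_Int_closed inf.absorb_iff2 inf_commute compact_eq_bounded_closed bounded_subset)
  have "measure lborel (K \<union> cball y e) = measure lborel K + measure lborel (cball y e)"
  proof -
    have "K \<inter> cball y e = {}" using e(2) by blast
    then show ?thesis using measure_Un3[of K lborel "cball y e"] K by (simp add: compact_fmeasurable)
  qed
  moreover have "measure lborel (K \<union> cball y e) \<le> measure lborel P"
    using K e(2) assms interior_subset[of P] by (intro measure_mono_compact compact_Un) auto
  moreover have "measure lborel (cball y e) > 0" using e(1) content_cball_pos by blast
  ultimately show False using assms(6) by simp
qed

definition iaff :: "(real \<times> real \<Rightarrow> real \<times> real) \<Rightarrow> bool" where
  "iaff S \<longleftrightarrow> (\<exists>(a::int) (b::int) (c::int) (d::int) e f. \<bar>a*d - b*c\<bar> = 1 \<and>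
     S = aff (of_int a) (of_int b) (of_int c) (of_int d) e f)"

definition umap :: "(real \<times> real \<Rightarrow> real \<times> real) \<Rightarrow> bool" where
  "umap S \<longleftrightarrow> (\<exists>(a::int) (b::int) (c::int) (d::int) (e::int) (f::int). \<bar>a*d - b*c\<bar> = 1 \<and>
     S = aff (of_int a) (of_int b) (of_int c) (of_int d) (of_int e) (of_int f))"

lemma iaffI: "\<bar>a*d - b*c\<bar> = (1::int) \<Longrightarrow> iaff (aff (of_int a) (of_int b) (of_int c) (of_int d) e f)"
  unfolding iaff_def by blast

lemma umapI: "\<bar>a*d - b*c\<bar> = (1::int) \<Longrightarrow>
    umap (aff (of_int a) (of_int b) (of_int c) (of_int d) (of_int e) (of_int f))"
  unfolding umap_def by blast

lemma umap_imp_iaff: "umap S \<Longrightarrow> iaff S"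
  unfolding umap_def iaff_def by blast

lemma int_det_real:
  "\<bar>a*d - b*c\<bar> = (1::int) \<Longrightarrow> \<bar>of_int a * of_int d - of_int b * of_int c\<bar> = (1::real)"
  by (metis of_int_1 of_int_abs of_int_diff of_int_mult)

lemma iaff_comp: assumes "iaff S" "iaff T" shows "iaff (S \<circ> T)"
proof -
  obtain a b c d e f where S: "\<bar>a*d - b*c\<bar> = (1::int)" "S = aff (of_int a) (of_int b) (of_int c) (of_int d) e f"
    using assms(1) unfolding iaff_def by blast
  obtain a' b' c' d' e' f' where T: "\<bar>a'*d' - b'*c'\<bar> = (1::int)" "T = aff (of_int a') (of_int b') (of_int c') (of_int d') e' f'"
    using assms(2) unfolding iaff_def by blast
  have "(a*a'+b*c')*(c*b'+d*d') - (a*b'+b*d')*(c*a'+d*c') = (a*d-b*c)*(a'*d'-b'*c')"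
    by (simp add: algebra_simps)
  then have "\<bar>(a*a'+b*c')*(c*b'+d*d') - (a*b'+b*d')*(c*a'+d*c')\<bar> = 1"
    using S(1) T(1) by (simp add: abs_mult)
  then show ?thesis unfolding S(2) T(2) aff_comp
    using iaffI[of "a*a'+b*c'" "c*b'+d*d'" "a*b'+b*d'" "c*a'+d*c'"] by simp
qed

lemma umap_comp: assumes "umap S" "umap T" shows "umap (S \<circ> T)"
proof -
  obtain a b c d e f where S: "\<bar>a*d - b*c\<bar> = (1::int)"
    "S = aff (of_int a) (of_int b) (of_int c) (of_int d) (of_int e) (of_int f)"
    using assms(1) unfolding umap_def by blast
  obtain a' b' c' d' e' f' where T: "\<bar>a'*d' - b'*c'\<bar> = (1::int)"
    "T = aff (of_int a') (of_int b') (of_int c') (of_int d') (of_int e') (of_int f')"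
    using assms(2) unfolding umap_def by blast
  have "(a*a'+b*c')*(c*b'+d*d') - (a*b'+b*d')*(c*a'+d*c') = (a*d-b*c)*(a'*d'-b'*c')"
    by (simp add: algebra_simps)
  then have "\<bar>(a*a'+b*c')*(c*b'+d*d') - (a*b'+b*d')*(c*a'+d*c')\<bar> = 1"
    using S(1) T(1) by (simp add: abs_mult)
  then show ?thesis unfolding S(2) T(2) aff_comp
    using umapI[of "a*a'+b*c'" "c*b'+d*d'" "a*b'+b*d'" "c*a'+d*c'" "a*e'+b*f'+e" "c*e'+d*f'+f"] by simp
qed

lemma umap_inverse:
  assumes "umap S" obtains S' where "umap S'" "S \<circ> S' = id" "S' \<circ> S = id"
proof -
  obtain a b c d e f where S: "\<bar>a*d - b*c\<bar> = (1::int)"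
    "S = aff (of_int a) (of_int b) (of_int c) (of_int d) (of_int e) (of_int f)"
    using assms unfolding umap_def by blast
  define D where "D = a*d - b*c"
  have "D = 1 \<or> D = -1" using S(1) unfolding D_def by linarith
  then have D: "D*D = 1" "D * (a*d) = 1 + D*(b*c)" unfolding D_def by auto
  then have Dr: "real_of_int D * (of_int a * of_int d) = 1 + of_int D*(of_int b* of_int c)"
    by (metis of_int_1 of_int_add of_int_mult)
  have DD: "real_of_int D = of_int a * of_int d - of_int b * of_int c" by (simp add: D_def)
  have DDr: "real_of_int D * of_int D = 1" using D by (metis of_int_1 of_int_mult)
  let ?S = "aff (of_int (D*d)) (of_int (-D*b)) (of_int (-D*c)) (of_int (D*a))
      (of_int (D*(b*f-d*e))) (of_int (D*(c*e-a*f)))"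
  have e: "of_int a*(of_int D * (of_int b* of_int f-of_int d* of_int e)) + of_int b*(of_int D*(of_int c* of_int e-of_int a* of_int f)) = - real_of_int e"
     (is "?l1 = _")
    "of_int c*(of_int D * (of_int b* of_int f-of_int d* of_int e)) + of_int d*(of_int D*(of_int c* of_int e-of_int a* of_int f)) = - real_of_int f"
     (is "?l2 = _")
  proof -
    have "?l1 = - (of_int D * of_int D) * of_int e" unfolding DD by (simp add: algebra_simps)
    then show "?l1 = - of_int e" by (simp add: DDr)
    have "?l2 = - (of_int D * of_int D) * of_int f" unfolding DD by (simp add: algebra_simps)
    then show "?l2 = - of_int f" by (simp add: DDr)
  qed
  have "D * a * (D * d) - D * b * (D * c) = (D*D)*(a*d-b*c)" by (simp add: algebra_simps)
  then have "\<bar>D*d*(D*a) - (-D*b)*(-D*c)\<bar> = 1" using D S(1) by (simp add: algebra_simps)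
  then have "umap ?S" by (rule umapI)
  moreover have "S \<circ> ?S = id" unfolding S(2) aff_comp aff_id[symmetric]
    using Dr e by (simp add: algebra_simps)
  moreover have "?S \<circ> S = id" unfolding S(2) aff_comp aff_id[symmetric]
    using Dr by (simp add: algebra_simps)
  ultimately show ?thesis using that by blast
qed

context
  fixes S assumes S: "iaff S"
begin

lemma iaff_measure: "closed K \<Longrightarrow> measure lborel (S ` K) = measure lborel K"
  using S unfolding iaff_def by (metis int_det_real measure_aff abs_zero mult_1 zero_neq_one)

lemma iaff_emeasure: "closed K \<Longrightarrow> emeasure lborel (S ` K) = emeasure lborel K"
  using S unfolding iaff_def
  by (metis int_det_real emeasure_aff abs_zero ennreal_1 mult_1 zero_neq_one)

lemma iaff_compact: "compact K \<Longrightarrow> compact (S ` K)"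
  using S unfolding iaff_def by (metis compact_aff)

lemma iaff_convex: "convex K \<Longrightarrow> convex (S ` K)"
  using S unfolding iaff_def by (metis convex_aff)

lemma iaff_bij: "bij S"
  using S unfolding iaff_def by (metis int_det_real bij_aff abs_zero zero_neq_one)

lemma iaff_interior: "interior (S ` K) = S ` interior K"
  using S unfolding iaff_def by (metis int_det_real interior_aff abs_zero zero_neq_one)

lemma iaff_hull: "S ` (convex hull K) = convex hull (S ` K)"
  using S unfolding iaff_def by (metis convex_hull_aff)

end

definition wide :: "(real \<times> real) set \<Rightarrow> real \<Rightarrow> bool" where
  "wide K w \<longleftrightarrow> (\<forall>m n::int. (m, n) \<noteq> (0, 0) \<longrightarrow> (\<exists>p\<in>K. \<exists>q\<in>K.
     of_int m * (fst p - fst q) + of_int n * (snd p - snd q) \<ge> w))"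

lemma wide_iaff: assumes "wide K w" "iaff S" shows "wide (S ` K) w"
  unfolding wide_def
proof (intro allI impI)
  fix m n :: int assume mn: "(m, n) \<noteq> (0, 0)"
  obtain a b c d e f where S: "\<bar>a*d - b*c\<bar> = (1::int)" "S = aff (of_int a) (of_int b) (of_int c) (of_int d) e f"
    using assms(2) unfolding iaff_def by blast
  have "(m*a+n*c, m*b+n*d) \<noteq> (0, 0)"
  proof
    assume "(m*a+n*c, m*b+n*d) = (0, 0)"
    then have h: "m*a+n*c = 0" "m*b+n*d = 0" by auto
    have "m*(a*d-b*c) = (m*a+n*c)*d - (m*b+n*d)*c" "n*(a*d-b*c) = (m*b+n*d)*a - (m*a+n*c)*b"
      by (simp_all add: algebra_simps)
    then have "m*(a*d-b*c) = 0" "n*(a*d-b*c) = 0" unfolding h by auto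
    then show False using S(1) mn by auto
  qed
  then obtain p q where pq: "p\<in>K" "q\<in>K"
    "of_int (m*a+n*c) * (fst p - fst q) + of_int (m*b+n*d) * (snd p - snd q) \<ge> w"
    using assms(1) unfolding wide_def by blast
  show "\<exists>p\<in>S ` K. \<exists>q\<in>S ` K. of_int m * (fst p - fst q) + of_int n * (snd p - snd q) \<ge> w"
    by (intro bexI[of _ "S p"] bexI[of _ "S q"]) (use pq in \<open>auto simp: S(2) algebra_simps\<close>)
qed

lemma umap_Z2: assumes "umap S" shows "S ` Z2 = Z2"
proof -
  have sub: "S ` Z2 \<subseteq> Z2" if "umap S" for S
    using that unfolding umap_def Z2_def by (auto simp: aff_def)
  obtain S' where S': "umap S'" "S \<circ> S' = id" using umap_inverse[OF assms] by metis
  have "Z2 = S ` S' ` Z2" using S'(2) by (simp add: image_comp)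
  also have "\<dots> \<subseteq> S ` Z2" using sub[OF S'(1)] by blast
  finally show ?thesis using sub[OF assms] by blast
qed

lemma umap_unimodular: assumes "umap S" shows "unimodular S"
  unfolding unimodular_def
proof (intro conjI umap_Z2 iaff_bij umap_imp_iaff assms)
  obtain a b c d e f where "S = aff a b c d e f" using assms unfolding umap_def by blast
  then show "\<exists>L b. linear L \<and> S = (\<lambda>x. L x + b)"
    using aff_linear_plus linear_aff by blast
qed

lemma umap_free: 
  assumes "umap S" "interior K \<inter> Z2 = {}" shows "interior (S ` K) \<inter> Z2 = {}"
proof -
  have "interior (S ` K) \<inter> Z2 = S ` (interior K \<inter> Z2)"
    using iaff_interior[OF umap_imp_iaff[OF assms(1)]] iaff_bij[OF umap_imp_iaff[OF assms(1)]]
    by (metis image_Int bij_is_inj umap_Z2[OF assms(1)])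
  then show ?thesis using assms(2) by simp
qed

lemma unimodular_comp: assumes "unimodular S" "unimodular T" shows "unimodular (S \<circ> T)"
proof -
  obtain L b where L: "linear L" "S = (\<lambda>x. L x + b)" using assms(1) unfolding unimodular_def by blast
  obtain M c where M: "linear M" "T = (\<lambda>x. M x + c)" using assms(2) unfolding unimodular_def by blast
  have "S \<circ> T = (\<lambda>x. (L \<circ> M) x + (L c + b))"
    unfolding L(2) M(2) using linear_add[OF L(1)] by (auto simp: fun_eq_iff)
  then have "\<exists>L b. linear L \<and> S \<circ> T = (\<lambda>x. L x + b)"
    using linear_compose[OF M(1) L(1)] by blast
  moreover have "(S \<circ> T) ` Z2 = Z2" using assms unfolding unimodular_def by (metis image_comp)
  ultimately show ?thesis using assms bij_comp unfolding unimodular_def by blast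
qed

subsection \<open>The lower bound\<close>

lemma cross_simps: "cross p q r = - cross p r q" "cross p q r = cross q r p"
  by (auto simp: cross_def algebra_simps)

lemma two_triangles_le_measure:
  assumes K: "compact K" "convex K" and p: "p \<in> K" "q \<in> K" "r \<in> K" "t \<in> K"
  shows "cross p q r + cross p r t \<le> 2 * measure lborel K"
proof -
  have 1: "cross p q r \<le> 2 * measure lborel K"
    using triangle_le_measure[OF K p(1) p(2) p(3)] by linarith
  have 2: "cross p r t \<le> 2 * measure lborel K"
    using triangle_le_measure[OF K p(1) p(3) p(4)] by linarith
  show ?thesis
  proof (cases "cross p q r > 0 \<and> cross p r t > 0")
    case True
    define m n c where "m = - (snd r - snd p)" and "n = fst r - fst p" and "c = m * fst p + n * snd p"
    have cr: "cross p r x = m * fst x + n * snd x - c" for x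
      by (simp add: cross_def m_def n_def c_def algebra_simps)
    have nz: "(m, n) \<noteq> (0, 0)" using True by (auto simp: cross_def m_def n_def)
    let ?A = "K \<inter> {x. m * fst x + n * snd x \<le> c}" and ?B = "K \<inter> {x. m * fst x + n * snd x \<ge> c}"
    note A = compact_convex_halves(1,2)[OF K] and B = compact_convex_halves(3,4)[OF K]
    have "cross p p r = 0" "cross p r p = 0" "cross p r r = 0" by (auto simp: cross_def)
    then have in1: "p \<in> ?A" "p \<in> ?B" "r \<in> ?A" "r \<in> ?B" "q \<in> ?A" "t \<in> ?B"
      using p True cr[of p] cr[of r] cr[of q] cr[of t] cross_simps(1)[of p r q] by auto
    have "cross p q r \<le> 2 * measure lborel ?A" "cross p r t \<le> 2 * measure lborel ?B"
      using triangle_le_measure[OF A in1(1) in1(5) in1(3)] triangle_le_measure[OF B in1(2) in1(4) in1(6)]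
      by linarith+
    then show ?thesis using measure_split[OF nz K(1), of c] by simp
  qed (use 1 2 in linarith)
qed

lemma chord_hull_le_measure:
  assumes K: "compact K" "convex K" and c: "(0, 0) \<in> K" "(0, F) \<in> K"
    and p: "T \<in> K" "M' \<in> K" "T' \<in> K" "M \<in> K"
    and x: "fst T \<ge> 0" "fst M' \<ge> 0" "fst T' \<le> 0" "fst M \<le> 0"
  shows "F * fst T + (fst M' * snd T - fst T * snd M')
     - F * fst T' + (fst T' * snd M - fst M * snd T') \<le> 2 * measure lborel K"
proof -
  let ?A = "K \<inter> {x. 1 * fst x + 0 * snd x \<le> (0::real)}" and ?B = "K \<inter> {x. 1 * fst x + 0 * snd x \<ge> (0::real)}"
  note A = compact_convex_halves(1,2)[OF K] and B = compact_convex_halves(3,4)[OF K]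
  have "cross (0,0) M' T + cross (0,0) T (0,F) \<le> 2 * measure lborel ?B"
    by (rule two_triangles_le_measure[OF B]) (use c p x in auto)
  moreover have "cross (0,0) (0,F) T' + cross (0,0) T' M \<le> 2 * measure lborel ?A"
    by (rule two_triangles_le_measure[OF A]) (use c p x in auto)
  moreover have "measure lborel K = measure lborel ?A + measure lborel ?B"
    by (rule measure_split) (use K in auto)
  ultimately show ?thesis by (simp add: cross_def algebra_simps)
qed

lemma sum_inverse_ge_4:
  fixes \<sigma> :: real assumes "0 < \<sigma>" "\<sigma> < 1"
  shows "1/\<sigma> + 1/(1-\<sigma>) \<ge> 4" "1/\<sigma> + 1/(1-\<sigma>) = 4 \<Longrightarrow> \<sigma> = 1/2"
proof -
  have e: "1/\<sigma> + 1/(1-\<sigma>) - 4 = (1 - 2*\<sigma>)\<^sup>2 / (\<sigma>*(1-\<sigma>))"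
    using assms by (simp add: field_simps power2_eq_square)
  then show "1/\<sigma> + 1/(1-\<sigma>) \<ge> 4" using assms
    by (smt (verit) divide_nonneg_pos mult_pos_pos zero_le_power2)
  assume "1/\<sigma> + 1/(1-\<sigma>) = 4"
  then have "(1 - 2*\<sigma>)\<^sup>2 / (\<sigma>*(1-\<sigma>)) = 0" using e by linarith
  then show "\<sigma> = 1/2" using assms by auto
qed

text \<open>The points maximising y, minimising y, maximising y - x and minimising y - x have horizontal
  distances s, r, s', r' from the chord and vertical distances \<open>\<tau>\<close>, \<open>\<mu>\<close>, \<open>\<tau>'\<close>, \<open>\<mu>'\<close> from the
  boundary of the strip; G is twice the area of the hull of these points and the chord.\<close>
lemma lower_numeric:
  fixes F w \<sigma> s r s' r' \<tau> \<mu> \<tau>' \<mu>' :: real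
  assumes pos: "s \<ge> 0" "r \<ge> 0" "s' \<ge> 0" "r' \<ge> 0" "\<tau> \<ge> 0" "\<mu> \<ge> 0" "\<tau>' \<ge> 0" "\<mu>' \<ge> 0"
    and w: "w > 0" "s + r \<le> w" "s' + r' \<le> w" "s \<le> w" "r \<le> w" "s' \<le> w" "r' \<le> w"
    and F: "0 < F" "F \<le> 3/4 * w" and \<sigma>: "0 \<le> \<sigma>" "\<sigma> \<le> 1/2"
    and c: "\<sigma> * (s + r) \<ge> w - F + \<tau> + \<mu>" "(1 - \<sigma>) * (s' + r') \<ge> w - F + \<tau>' + \<mu>'"
  defines "G \<equiv> F*(s+r+s'+r') - r'*\<tau> - s*\<mu>' - r*\<tau>' - s'*\<mu>"
  shows "G \<ge> 3/4 * w\<^sup>2"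
    and "G = 3/4 * w\<^sup>2 \<Longrightarrow> F = 3/4 * w \<and> \<sigma> = 1/2 \<and> \<tau> = 0 \<and> \<mu> = 0 \<and> \<tau>' = 0 \<and> \<mu>' = 0
            \<and> s + r = w/2 \<and> s' + r' = w/2"
proof -
  define k where "k = w - F"
  have k: "k \<ge> w/4" "k > 0" using F w by (auto simp: k_def)
  have "\<sigma> * (s + r) \<le> \<sigma> * w" using \<sigma> w by (intro mult_left_mono) auto
  then have sw: "\<sigma> * w \<ge> k" using c(1) pos by (simp add: k_def)
  then have s0: "\<sigma> > 0" using k \<sigma> by (smt (verit) mult_eq_0_iff)
  have "\<sigma> * w \<le> w/2" using \<sigma> w by simp
  then have F2: "F \<ge> w/2" using sw by (simp add: k_def)
  have F3: "w * (1-\<sigma>) \<le> F" using sw by (simp add: k_def algebra_simps)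
  have a1: "F*(s+r) \<ge> F*k/\<sigma> + w*\<tau> + w*\<mu>"
  proof -
    have "s + r \<ge> (k + (\<tau> + \<mu>))/\<sigma>" using c(1) s0 by (simp add: k_def field_simps)
    then have "F*(s+r) \<ge> F*((k + (\<tau> + \<mu>))/\<sigma>)" using F by (intro mult_left_mono) auto
    moreover have "F*((k + (\<tau> + \<mu>))/\<sigma>) = F*k/\<sigma> + F/\<sigma>*(\<tau>+\<mu>)" by (simp add: add_divide_distrib distrib_left)
    moreover have "F/\<sigma> \<ge> w"
      using s0 F2 \<open>\<sigma> * w \<le> w/2\<close> by (simp add: pos_le_divide_eq mult.commute)
    then have "F/\<sigma>*(\<tau>+\<mu>) \<ge> w*(\<tau>+\<mu>)" using pos by (intro mult_right_mono) auto
    ultimately show ?thesis by (simp add: distrib_left)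
  qed
  have a2: "F*(s'+r') \<ge> F*k/(1-\<sigma>) + w*\<tau>' + w*\<mu>'"
  proof -
    have "s' + r' \<ge> (k + (\<tau>' + \<mu>'))/(1-\<sigma>)" using c(2) \<sigma> by (simp add: k_def field_simps)
    then have "F*(s'+r') \<ge> F*((k + (\<tau>' + \<mu>'))/(1-\<sigma>))" using F by (intro mult_left_mono) auto
    moreover have "F*((k + (\<tau>' + \<mu>'))/(1-\<sigma>)) = F*k/(1-\<sigma>) + F/(1-\<sigma>)*(\<tau>'+\<mu>')"
      by (simp add: add_divide_distrib distrib_left)
    moreover have "F/(1-\<sigma>) \<ge> w"
      using F3 \<sigma> by (simp add: pos_le_divide_eq)
    then have "F/(1-\<sigma>)*(\<tau>'+\<mu>') \<ge> w*(\<tau>'+\<mu>')" using pos by (intro mult_right_mono) auto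
    ultimately show ?thesis by (simp add: distrib_left)
  qed
  have b: "w*\<tau> \<ge> r'*\<tau>" "w*\<mu> \<ge> s'*\<mu>" "w*\<tau>' \<ge> r*\<tau>'" "w*\<mu>' \<ge> s*\<mu>'"
    using pos w by (auto intro: mult_right_mono)
  have G: "G \<ge> F*k/\<sigma> + F*k/(1-\<sigma>)"
    using a1 a2 b by (simp add: G_def algebra_simps)
  have e: "F*k/\<sigma> + F*k/(1-\<sigma>) = F*k*(1/\<sigma> + 1/(1-\<sigma>))" by (simp add: distrib_left)
  have Fk: "F*k > 0" using F k by simp
  have f4: "F*k*(1/\<sigma> + 1/(1-\<sigma>)) \<ge> F*k*4"
    using Fk sum_inverse_ge_4(1)[of \<sigma>] s0 \<sigma> by (intro mult_left_mono) auto
  have q: "F*k*4 - 3/4*w\<^sup>2 = 4*(F - w/4)*(3/4*w - F)"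
    by (simp add: k_def power2_eq_square field_simps)
  have q0: "4*(F - w/4)*(3/4*w - F) \<ge> 0" using F F2 w by (intro mult_nonneg_nonneg) auto
  show "G \<ge> 3/4 * w\<^sup>2" using G e f4 q q0 by linarith
  assume E: "G = 3/4 * w\<^sup>2"
  have "4*(F - w/4)*(3/4*w - F) = 0" using E G e f4 q q0 by linarith
  then have Fe: "F = 3/4 * w" using F2 w by simp
  have "F*k*(1/\<sigma> + 1/(1-\<sigma>)) = F*k*4" using E G e f4 q q0 by linarith
  then have "1/\<sigma> + 1/(1-\<sigma>) = 4" using Fk by (subst (asm) mult_left_cancel) auto
  then have se: "\<sigma> = 1/2" using sum_inverse_ge_4(2)[of \<sigma>] s0 \<sigma> by auto
  have ke: "k = w/4" using Fe by (simp add: k_def)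
  have c': "s + r \<ge> w/2 + 2*\<tau> + 2*\<mu>" "s'+r' \<ge> w/2 + 2*\<tau>' + 2*\<mu>'"
    using c ke unfolding se k_def by (auto simp: field_simps)
  define d1 d2 where "d1 = s + r - (w/2 + 2*\<tau> + 2*\<mu>)" and "d2 = s' + r' - (w/2 + 2*\<tau>' + 2*\<mu>')"
  have d: "d1 \<ge> 0" "d2 \<ge> 0" using c' by (auto simp: d1_def d2_def)
  have sr: "s + r = w/2 + 2*\<tau> + 2*\<mu> + d1" "s' + r' = w/2 + 2*\<tau>' + 2*\<mu>' + d2"
    by (auto simp: d1_def d2_def)
  have "G = F*((s+r)+(s'+r')) - r'*\<tau> - s*\<mu>' - r*\<tau>' - s'*\<mu>" by (simp add: G_def algebra_simps)
  also have "\<dots> = 3/4*w\<^sup>2 + 3/4*w*(d1+d2) + (3/2*w - r')*\<tau> + (3/2*w - s)*\<mu>' + (3/2*w-r)*\<tau>' + (3/2*w-s')*\<mu>"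
    unfolding sr Fe by (simp add: algebra_simps power2_eq_square)
  finally have z: "3/4*w*(d1+d2) + (3/2*w - r')*\<tau> + (3/2*w - s)*\<mu>' + (3/2*w-r)*\<tau>' + (3/2*w-s')*\<mu> = 0"
    using E by simp
  have nn: "3/4*w*(d1+d2) \<ge> 0" "(3/2*w - r')*\<tau> \<ge> 0" "(3/2*w - s)*\<mu>' \<ge> 0" "(3/2*w-r)*\<tau>' \<ge> 0" "(3/2*w-s')*\<mu> \<ge> 0"
    using w pos d by (auto intro!: mult_nonneg_nonneg)
  have "3/4*w*(d1+d2) = 0" "(3/2*w - r')*\<tau> = 0" "(3/2*w - s)*\<mu>' = 0" "(3/2*w-r)*\<tau>' = 0" "(3/2*w-s')*\<mu> = 0"
    using z nn by linarith+
  then have "d1 + d2 = 0" "\<tau> = 0" "\<mu> = 0" "\<tau>' = 0" "\<mu>' = 0" using w by auto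
  then show "F = 3/4 * w \<and> \<sigma> = 1/2 \<and> \<tau> = 0 \<and> \<mu> = 0 \<and> \<tau>' = 0 \<and> \<mu>' = 0
            \<and> s + r = w/2 \<and> s' + r' = w/2"
    using Fe se sr d by auto
qed

definition tri :: "real \<Rightarrow> (real \<times> real) set" where
  "tri w = convex hull {(w/2, 0), (0, w/2), (- w/2, - w/2)}"

lemma lower_bound_normalized:
  assumes K: "compact K" "convex K" "interior K \<noteq> {}" and w: "w > 0" and \<sigma>: "0 \<le> \<sigma>" "\<sigma> \<le> 1/2"
    and c: "(0, 0) \<in> K" "(0, F) \<in> K" and F: "F > 0"
    and strip: "\<And>p. p \<in> K \<Longrightarrow> \<sigma> * fst p \<le> snd p \<and> snd p \<le> F + \<sigma> * fst p"
    and x: "\<And>p. p \<in> K \<Longrightarrow> - P \<le> fst p \<and> fst p \<le> Q" and PQ: "P + Q = w"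
    and ends: "L \<in> K" "fst L = - P" "R \<in> K" "fst R = Q"
    and wide: "wide K w"
  shows "3/8 * w\<^sup>2 \<le> measure lborel K"
    and "measure lborel K = 3/8 * w\<^sup>2 \<Longrightarrow> \<exists>S. iaff S \<and> S ` K = tri w"
proof -
  obtain T0 M0 where TM0: "T0 \<in> K" "M0 \<in> K" "snd T0 - snd M0 \<ge> w"
    using wide[unfolded wide_def, rule_format, of 0 1] by auto
  obtain T0' M0' where TM0': "T0' \<in> K" "M0' \<in> K" "(snd T0' - fst T0') - (snd M0' - fst M0') \<ge> w"
    using wide[unfolded wide_def, rule_format, of "-1" 1] by (auto simp: algebra_simps)
  define T M where "T = (if snd T0 \<ge> F then T0 else (0, F))" and "M = (if snd M0 \<le> 0 then M0 else (0,0))"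
  define T' M' where "T' = (if snd T0' - fst T0' \<ge> F then T0' else (0, F))"
    and "M' = (if snd M0' - fst M0' \<le> 0 then M0' else (0,0))"
  have in_K: "T \<in> K" "M \<in> K" "T' \<in> K" "M' \<in> K"
    using TM0 TM0' c by (auto simp: T_def M_def T'_def M'_def)
  have yw: "snd T - snd M \<ge> w" "snd T \<ge> F" "snd M \<le> 0" using TM0 by (auto simp: T_def M_def)
  have zw: "(snd T' - fst T') - (snd M' - fst M') \<ge> w" "snd T' - fst T' \<ge> F" "snd M' - fst M' \<le> 0"
    using TM0' by (auto simp: T'_def M'_def)
  have xl: "-P \<le> 0" "0 \<le> Q" using x[OF c(1)] by auto
    have Fw: "F * w \<le> 2 * measure lborel K"
      using chord_hull_le_measure[OF K(1,2) c ends(3) c(1) ends(1) c(1)] ends xl PQ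
      by (simp add: algebra_simps flip: PQ)
    define A :: "(real \<times> real) set \<Rightarrow> real" where "A = measure lborel"
    have res: "3/8 * w\<^sup>2 \<le> A K \<and> (A K = 3/8 * w\<^sup>2 \<longrightarrow> (\<exists>S. iaff S \<and> S ` K = tri w))"
    proof (cases "F \<le> 3/4 * w")
      case False
      then have "F * w > 3/4 * w * w" using w by simp
      then show ?thesis using Fw by (auto simp: power2_eq_square A_def)
    next
      case True
      have \<sigma>0: "\<sigma> > 0"
      proof (rule ccontr)
        assume "\<not> \<sigma> > 0"
        then have "\<sigma> = 0" using \<sigma> by simp
        then have "snd T \<le> F" "snd M \<ge> 0" using strip[OF in_K(1)] strip[OF in_K(2)] by auto
        then show False using yw True w by simp
      qed
      define s r s' r' where "s = fst T" and "r = - fst M" and "s' = - fst T'" and "r' = fst M'"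
      define \<tau> \<mu> \<tau>' \<mu>' where "\<tau> = F + \<sigma> * s - snd T" and "\<mu> = snd M + \<sigma> * r"
        and "\<tau>' = F - \<sigma> * s' - snd T'" and "\<mu>' = snd M' - \<sigma> * r'"
      have eqs: "fst T = s" "snd T = F + \<sigma> * s - \<tau>" "fst M = - r" "snd M = \<mu> - \<sigma> * r"
        "fst T' = - s'" "snd T' = F - \<sigma> * s' - \<tau>'" "fst M' = r'" "snd M' = \<mu>' + \<sigma> * r'"
        by (auto simp: s_def r_def s'_def r'_def \<tau>_def \<mu>_def \<tau>'_def \<mu>'_def)
      have t: "\<tau> \<ge> 0" "\<mu> \<ge> 0" "\<tau>' \<ge> 0" "\<mu>' \<ge> 0"
        using strip[OF in_K(1)] strip[OF in_K(2)] strip[OF in_K(3)] strip[OF in_K(4)] unfolding eqs by auto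
      have "\<sigma> * s \<ge> 0" "\<sigma> * r \<ge> 0" using yw t unfolding eqs by linarith+
      then have s: "s \<ge> 0" "r \<ge> 0" using \<sigma>0 by (auto simp: zero_le_mult_iff)
      have "(1-\<sigma>) * s' \<ge> 0" "(1-\<sigma>) * r' \<ge> 0" using zw t unfolding eqs by (auto simp: algebra_simps)
      then have s': "s' \<ge> 0" "r' \<ge> 0" using \<sigma> by (auto simp: zero_le_mult_iff)
      have lim: "s \<le> Q" "r \<le> P" "s' \<le> P" "r' \<le> Q"
        using x[OF in_K(1)] x[OF in_K(2)] x[OF in_K(3)] x[OF in_K(4)] unfolding eqs by auto
      have cc: "\<sigma> * (s + r) \<ge> w - F + \<tau> + \<mu>" "(1 - \<sigma>) * (s' + r') \<ge> w - F + \<tau>' + \<mu>'"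
        using yw(1) zw(1) unfolding eqs by (simp_all add: algebra_simps)
      define G where "G = F*(s+r+s'+r') - r'*\<tau> - s*\<mu>' - r*\<tau>' - s'*\<mu>"
      have num: "G \<ge> 3/4 * w\<^sup>2"
        "G = 3/4 * w\<^sup>2 \<Longrightarrow> F = 3/4 * w \<and> \<sigma> = 1/2 \<and> \<tau> = 0 \<and> \<mu> = 0 \<and> \<tau>' = 0 \<and> \<mu>' = 0
            \<and> s + r = w/2 \<and> s' + r' = w/2"
        unfolding G_def
        by (rule lower_numeric[OF s s' t w(1) _ _ _ _ _ _ F True \<sigma> cc]; use lim PQ xl in linarith)+
      have GA: "G \<le> 2 * A J" if J: "compact J" "convex J" "{(0,0), (0,F), T, M', T', M} \<subseteq> J" for J
      proof -
        have "F * fst T + (fst M' * snd T - fst T * snd M')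
           - F * fst T' + (fst T' * snd M - fst M * snd T') \<le> 2 * measure lborel J"
          by (rule chord_hull_le_measure) (use J s s' eqs in auto)
        moreover have "F * fst T + (fst M' * snd T - fst T * snd M')
           - F * fst T' + (fst T' * snd M - fst M * snd T') = G"
          unfolding eqs G_def by (simp add: algebra_simps)
        ultimately show ?thesis unfolding A_def by simp
      qed
      have GK: "G \<le> 2 * A K" using GA[of K] K c in_K by auto
      have "\<exists>S. iaff S \<and> S ` K = tri w" if E: "A K = 3/8 * w\<^sup>2"
      proof -
        have Ge: "G = 3/4 * w\<^sup>2" using GK num(1) E by simp
        from num(2)[OF this] have v: "F = 3/4 * w" "\<sigma> = 1/2" "\<tau> = 0" "\<mu> = 0" "\<tau>' = 0" "\<mu>' = 0"
            "s + r = w/2" "s' + r' = w/2" by auto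
        define H where "H = convex hull {(0,0), (0,F), T, M', T', M}"
        have H: "compact H" "convex H" "{(0,0), (0,F), T, M', T', M} \<subseteq> H"
          by (auto simp: H_def finite_imp_compact_convex_hull hull_inc)
        have HK: "H \<subseteq> K" unfolding H_def by (rule hull_minimal) (use K c in_K in auto)
        have "A K \<le> A H" using GA[OF H] Ge E by simp
        then have "H = K" using H HK K by (intro eq_if_measure_le compact_imp_closed) (auto simp: A_def)
        have hx: "- max r s' \<le> fst p \<and> fst p \<le> max s r'" if "p \<in> K" for p
        proof -
          have "H \<subseteq> {p. (1,0) \<bullet> p \<le> max s r'} \<inter> {p. (1,0) \<bullet> p \<ge> - max r s'}"
            unfolding H_def 
            by (intro hull_minimal convex_Int convex_halfspace_le convex_halfspace_ge)
              (use eqs s s' in \<open>auto simp: inner_prod_def\<close>)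
          then show ?thesis using that \<open>H = K\<close> by (auto simp: inner_prod_def)
        qed
        have "max s r' + max r s' \<ge> w" using hx[OF ends(1)] hx[OF ends(3)] ends PQ by linarith
        then consider "r = 0" "r' = 0" "s = w/2" "s' = w/2" | "s = 0" "s' = 0" "r = w/2" "r' = w/2"
          using v s s' w by linarith
        then show ?thesis
        proof cases
          case 1
          have TT: "T = (w/2, w)" "T' = (-w/2, w/2)" using eqs v 1 by (auto simp: prod_eq_iff)
          let ?Y = "convex hull {(0,0), (w/2, w), (-w/2, w/2)}"
          have cr: "cross (0,0) (w/2, w) (-w/2, w/2) = 3/4*w\<^sup>2" by (simp add: cross_def power2_eq_square)
          have "A ?Y = 3/8 * w\<^sup>2" unfolding A_def using measure_triangle[of "(0,0)" "(w/2, w)" "(-w/2, w/2)"] w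
            unfolding cr by simp
          moreover have "compact ?Y" by (simp add: finite_imp_compact_convex_hull)
          moreover have "?Y \<subseteq> K" using c(1) in_K(1,3) K(2) unfolding TT by (intro hull_minimal) auto
          ultimately have "?Y = K" using E K by (intro eq_if_measure_le compact_imp_closed) (auto simp: A_def)
          then have "aff (-1) 0 0 (-1) 0 (w/2) ` K = tri w"
            unfolding tri_def
            by (subst \<open>?Y = K\<close>[symmetric], subst convex_hull_aff) (simp add: aff_Pair insert_commute)
          then show ?thesis using iaffI[of "-1" "-1" 0 0 0 "w/2"] by auto
        next
          case 2
          have TT: "M = (-w/2, -w/4)" "M' = (w/2, w/4)" using eqs v 2 by (auto simp: prod_eq_iff)
          let ?Y = "convex hull {(0,3/4*w), (w/2, w/4), (-w/2, -w/4)}"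
          have cr: "cross (0,3/4*w) (w/2, w/4) (-w/2, -w/4) = - (3/4*w\<^sup>2)" by (simp add: cross_def power2_eq_square)
          have "A ?Y = 3/8 * w\<^sup>2" unfolding A_def using measure_triangle[of "(0,3/4*w)" "(w/2, w/4)" "(-w/2, -w/4)"] w
            unfolding cr by simp
          moreover have "compact ?Y" by (simp add: finite_imp_compact_convex_hull)
          moreover have "?Y \<subseteq> K" using c(2) in_K(2,4) K(2) unfolding TT v by (intro hull_minimal) auto
          ultimately have "?Y = K" using E K by (intro eq_if_measure_le compact_imp_closed) (auto simp: A_def)
          then have "aff 1 0 0 1 0 (-w/4) ` K = tri w"
            unfolding tri_def
            by (subst \<open>?Y = K\<close>[symmetric], subst convex_hull_aff) (simp add: aff_Pair insert_commute)
          then show ?thesis using iaffI[of 1 1 0 0 0 "-w/4"] by auto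
        qed
      qed
      then show ?thesis using GK num(1) by auto
    qed
    then show "3/8 * w\<^sup>2 \<le> measure lborel K"
      and "measure lborel K = 3/8 * w\<^sup>2 \<Longrightarrow> \<exists>S. iaff S \<and> S ` K = tri w" by (auto simp: A_def)
qed

lemma max_vertical_chord:
  fixes K :: "(real \<times> real) set"
  assumes K: "compact K" "convex K" "interior K \<noteq> {}"
  obtains x y F \<sigma> where "F > 0" "(x, y) \<in> K" "(x, y + F) \<in> K"
    "\<And>p. p \<in> K \<Longrightarrow> y + \<sigma> * (fst p - x) \<le> snd p \<and> snd p \<le> y + F + \<sigma> * (fst p - x)"
proof -
  obtain c e where ce: "e > 0" "cball c e \<subseteq> K"
    using K(3) by (metis ex_in_conv interior_subset open_contains_cball open_interior subset_trans)
  have cK: "c \<in> K" "c + (0, e) \<in> K" "c + (e, 0) \<in> K"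
    by (rule subsetD[OF ce(2)], use ce(1) in \<open>simp add: dist_norm\<close>)+
  define D where "D = (K \<times> K) \<inter> {z. fst (fst z) = fst (snd z)}"
  have "compact D" unfolding D_def
    by (intro compact_Int_closed compact_Times K closed_Collect_eq continuous_intros)
  moreover have "(c + (0, e), c) \<in> D" using cK by (auto simp: D_def)
  moreover have "continuous_on D (\<lambda>z. snd (fst z) - snd (snd z))" by (intro continuous_intros)
  ultimately obtain z where z: "z \<in> D" "\<And>z'. z' \<in> D \<Longrightarrow> snd (fst z') - snd (snd z') \<le> snd (fst z) - snd (snd z)"
    using continuous_attains_sup[of D "\<lambda>z. snd (fst z) - snd (snd z)"] by blast
  define x y F where "x = fst (snd z)" and "y = snd (snd z)" and "F = snd (fst z) - snd (snd z)"
  have p: "(x, y) \<in> K" "(x, y + F) \<in> K"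
    using z(1) by (cases z, auto simp: D_def x_def y_def F_def)+
  have mx: "v - u \<le> F" if "(t, u) \<in> K" "(t, v) \<in> K" for t u v
    using z(2)[of "((t, v), (t, u))"] that by (auto simp: D_def F_def)
  have F: "F > 0" using mx[of "fst c" "snd c" "snd c + e"] cK ce by (cases c) auto
  define T where "T = (\<lambda>q. (0, F) + q) ` interior K"
  have "K \<inter> T = {}"
  proof (rule ccontr)
    assume "K \<inter> T \<noteq> {}"
    then obtain q where q: "q \<in> interior K" "(0, F) + q \<in> K" by (auto simp: T_def)
    obtain d where d: "d > 0" "cball q d \<subseteq> K"
      using q(1) by (metis interior_subset open_contains_cball open_interior subset_trans)
    have "(fst q, snd q - d) \<in> K" using d by (cases q) (auto simp: dist_Pair_Pair dist_real_def subset_iff)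
    moreover have "(fst q, snd q + F) \<in> K" using q(2) by (cases q) (auto simp: add.commute)
    ultimately show False using mx[of "fst q" "snd q - d" "snd q + F"] d by simp
  qed
  moreover have "convex T" unfolding T_def by (intro convex_translation convex_interior K)
  ultimately obtain a b where ab: "a \<noteq> 0" "\<forall>p\<in>K. a \<bullet> p \<le> b" "\<forall>p\<in>T. a \<bullet> p \<ge> b"
  proof -
    have "K \<noteq> {}" "T \<noteq> {}" using p K(3) by (auto simp: T_def)
    then show ?thesis using that separating_hyperplane_sets[OF K(2) \<open>convex T\<close>] \<open>K \<inter> T = {}\<close> by blast
  qed
  have low: "a \<bullet> q \<ge> b - snd a * F" if "q \<in> K" for q
  proof -
    have "interior K \<subseteq> {q. a \<bullet> q \<ge> b - snd a * F}"
      using ab(3) by (auto simp: T_def inner_add_right inner_prod_def algebra_simps)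
    then have "closure (interior K) \<subseteq> {q. a \<bullet> q \<ge> b - snd a * F}"
      by (intro closure_minimal closed_halfspace_ge)
    then show ?thesis using convex_closure_interior[OF K(2,3)] that closure_subset by blast
  qed
  define m n where "m = fst a" and "n = snd a"
  have up: "m * fst q + n * snd q \<le> b" "m * fst q + n * snd q \<ge> b - n * F" if "q \<in> K" for q
    using ab(2) low[OF that] that by (auto simp: inner_prod_def m_def n_def)
  have b: "b = m * x + n * (y + F)" using up[OF p(2)] up[OF p(1)] by (simp add: algebra_simps)
  have "n \<noteq> 0"
  proof
    assume n: "n = 0"
    then have "m \<noteq> 0" using ab(1) by (auto simp: m_def n_def prod_eq_iff)
    then have "m * fst (c + (e, 0)) = m * fst c" using up[of c] up[of "c + (e, 0)"] cK n by auto
    then show False using \<open>m \<noteq> 0\<close> ce by (auto simp: algebra_simps)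
  qed
  moreover have "n * F \<ge> 0" using up[OF p(1)] by (simp add: b algebra_simps)
  ultimately have n: "n > 0" using F by (auto simp: zero_le_mult_iff)
  show ?thesis
  proof (rule that[OF F p, of "- m / n"])
    fix q assume "q \<in> K"
    from up[OF this] show "y + - m / n * (fst q - x) \<le> snd q \<and> snd q \<le> y + F + - m / n * (fst q - x)"
      using n unfolding b by (simp add: field_simps)
  qed
qed

lemma lower_bound:
  assumes K: "compact K" "convex K" "interior K \<noteq> {}" and w: "w > 0" and wide: "wide K w"
    and range: "\<And>p. p \<in> K \<Longrightarrow> a \<le> fst p \<and> fst p \<le> a + w"
  shows "3/8 * w\<^sup>2 \<le> measure lborel K"
    and "measure lborel K = 3/8 * w\<^sup>2 \<Longrightarrow> \<exists>S. iaff S \<and> S ` K = tri w"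
proof -
  obtain x y F \<sigma> where c: "F > 0" "(x, y) \<in> K" "(x, y + F) \<in> K"
    "\<And>p. p \<in> K \<Longrightarrow> y + \<sigma> * (fst p - x) \<le> snd p \<and> snd p \<le> y + F + \<sigma> * (fst p - x)"
    using max_vertical_chord[OF K] by metis
  obtain L R where LR: "R \<in> K" "L \<in> K" "fst R - fst L \<ge> w"
    using wide[unfolded wide_def, rule_format, of 1 0] by auto
  then have LRx: "fst L = a" "fst R = a + w" using range[OF LR(1)] range[OF LR(2)] by auto
  define j where "j = round \<sigma>"
  define \<epsilon> :: int where "\<epsilon> = (if \<sigma> \<ge> j then 1 else -1)"
  define S where "S = aff (of_int \<epsilon>) (of_int 0) (of_int (-j)) (of_int 1) (- \<epsilon> * x) (j * x - y)"
  have S: "iaff S" unfolding S_def by (rule iaffI) (auto simp: \<epsilon>_def)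
  have Sp: "fst (S p) = \<epsilon> * (fst p - x)" "snd (S p) = snd p - y - j * (fst p - x)" for p
    by (simp_all add: S_def algebra_simps)
  have \<epsilon>: "\<epsilon> = 1 \<or> \<epsilon> = -1" "\<epsilon> * (\<sigma> - j) = \<bar>\<sigma> - j\<bar>" by (auto simp: \<epsilon>_def)
  have \<sigma>: "\<bar>\<sigma> - j\<bar> \<le> 1/2" using of_int_round_abs_le[of \<sigma>] by (simp add: j_def abs_minus_commute)
  let ?K = "S ` K"
  have slope: "\<bar>\<sigma> - j\<bar> * fst (S p) = (\<sigma> - j) * (fst p - x)" for p
    using \<epsilon> by (auto simp: Sp)
  have S0: "S (x, y) = (0, 0)" "S (x, y + F) = (0, F)" by (auto simp: prod_eq_iff Sp)
  define P Q where "P = (if \<epsilon> = 1 then x - a else a + w - x)" and "Q = (if \<epsilon> = 1 then a + w - x else x - a)"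
  define L' R' where "L' = (if \<epsilon> = 1 then L else R)" and "R' = (if \<epsilon> = 1 then R else L)"
  have *: "3/8 * w\<^sup>2 \<le> measure lborel ?K \<and> (measure lborel ?K = 3/8 * w\<^sup>2 \<longrightarrow> (\<exists>S. iaff S \<and> S ` ?K = tri w))"
  proof -
    have 1: "compact ?K" "convex ?K" "interior ?K \<noteq> {}"
      using K S by (auto simp: iaff_compact iaff_convex iaff_interior)
    have 2: "(0,0) \<in> ?K" "(0,F) \<in> ?K" using c(2,3) S0 by (metis image_eqI)+
    have 3: "\<bar>\<sigma> - j\<bar> * fst p \<le> snd p \<and> snd p \<le> F + \<bar>\<sigma> - j\<bar> * fst p" if "p \<in> ?K" for p
    proof -
      obtain p' where p': "p' \<in> K" "p = S p'" using \<open>p \<in> ?K\<close> by blast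
      show ?thesis using c(4)[OF p'(1)] unfolding p'(2) slope by (simp add: Sp algebra_simps)
    qed
    have 4: "- P \<le> fst p \<and> fst p \<le> Q" if "p \<in> ?K" for p
    proof -
      obtain p' where "p' \<in> K" "p = S p'" using \<open>p \<in> ?K\<close> by blast
      then show ?thesis using range[of p'] \<epsilon>(1) by (auto simp: P_def Q_def Sp)
    qed
    have 5: "S L' \<in> ?K" "fst (S L') = - P" "S R' \<in> ?K" "fst (S R') = Q"
      using LR LRx \<epsilon>(1) by (auto simp: L'_def R'_def P_def Q_def Sp)
    have 6: "P + Q = w" by (auto simp: P_def Q_def)
    show ?thesis
      using lower_bound_normalized[OF 1 w _ \<sigma> 2 c(1) 3 4 6 5 wide_iaff[OF wide S]] by auto
  qed
  have m: "measure lborel ?K = measure lborel K"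
    using K S by (simp add: iaff_measure compact_imp_closed)
  show "3/8 * w\<^sup>2 \<le> measure lborel K" using * m by simp
  assume "measure lborel K = 3/8 * w\<^sup>2"
  then obtain S' where "iaff S'" "S' ` S ` K = tri w" using * m by auto
  then show "\<exists>S. iaff S \<and> S ` K = tri w" using S
    by (intro exI[of _ "S' \<circ> S"]) (auto simp: iaff_comp image_comp)
qed

subsection \<open>Supporting lines at lattice points\<close>

lemma supporting_line:
  fixes K :: "(real \<times> real) set"
  assumes K: "convex K" "interior K \<noteq> {}" and p: "p \<notin> interior K"
  obtains m n :: real where
    "\<And>q. q \<in> K \<Longrightarrow> m * fst q + n * snd q \<le> m * fst p + n * snd p"
    "\<And>q. q \<in> interior K \<Longrightarrow> m * fst q + n * snd q < m * fst p + n * snd p"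
proof -
  obtain a b where ab: "a \<noteq> 0" "\<forall>q\<in>interior K. a \<bullet> q \<le> b" "\<forall>q\<in>{p}. a \<bullet> q \<ge> b"
    using separating_hyperplane_sets[of "interior K" "{p}"] K p by (auto simp: convex_interior)
  have "closure (interior K) \<subseteq> {q. a \<bullet> q \<le> b}"
    using ab(2) by (intro closure_minimal closed_halfspace_le) auto
  then have le: "a \<bullet> q \<le> a \<bullet> p" if "q \<in> K" for q
    using that ab(3) closure_subset[of K] unfolding convex_closure_interior[OF K] by fastforce
  have less: "a \<bullet> q < a \<bullet> p" if q: "q \<in> interior K" for q
  proof -
    obtain e where e: "e > 0" "cball q e \<subseteq> K"
      using q by (metis interior_subset open_contains_cball open_interior subset_trans)
    have "q + (e / norm a) *\<^sub>R a \<in> K"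
      by (rule subsetD[OF e(2)]) (use e(1) ab(1) in \<open>simp add: dist_norm\<close>)
    from le[OF this] have "a \<bullet> q + e / norm a * (a \<bullet> a) \<le> a \<bullet> p" by (simp add: inner_add_right)
    moreover have "e / norm a * (a \<bullet> a) > 0" using e ab(1) by simp
    ultimately show ?thesis by linarith
  qed
  show ?thesis
    by (rule that[of "fst a" "snd a"]) (use le less in \<open>auto simp: inner_prod_def\<close>)
qed

lemma line_above:
  fixes K :: "(real \<times> real) set"
  assumes K: "convex K" and y: "(i, y) \<in> interior K" "y < v" and p: "(i, v) \<notin> interior K"
  obtains \<alpha> where "\<And>q. q \<in> K \<Longrightarrow> snd q \<le> v + \<alpha> * (fst q - i)"
    "\<And>q. q \<in> interior K \<Longrightarrow> snd q < v + \<alpha> * (fst q - i)"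
proof -
  have "interior K \<noteq> {}" using y by auto
  then obtain m n where mn: "\<And>q. q \<in> K \<Longrightarrow> m * fst q + n * snd q \<le> m * i + n * v"
    "\<And>q. q \<in> interior K \<Longrightarrow> m * fst q + n * snd q < m * i + n * v"
    using supporting_line[OF K _ p] by auto
  have "0 < n * (v - y)" using mn(2)[OF y(1)] by (simp add: algebra_simps)
  then have n: "n > 0" using y(2) by (simp add: zero_less_mult_iff)
  show ?thesis
  proof (rule that[of "- m / n"])
    show "snd q \<le> v + - m / n * (fst q - i)" if "q \<in> K" for q
      using mn(1)[OF that] n by (simp add: field_simps)
    show "snd q < v + - m / n * (fst q - i)" if "q \<in> interior K" for q
      using mn(2)[OF that] n by (simp add: field_simps)
  qed
qed

lemma line_below:
  fixes K :: "(real \<times> real) set"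
  assumes K: "convex K" and y: "(i, y) \<in> interior K" "v < y" and p: "(i, v) \<notin> interior K"
  obtains \<gamma> where "\<And>q. q \<in> K \<Longrightarrow> v - \<gamma> * (fst q - i) \<le> snd q"
    "\<And>q. q \<in> interior K \<Longrightarrow> v - \<gamma> * (fst q - i) < snd q"
proof -
  have "interior K \<noteq> {}" using y by auto
  then obtain m n where mn: "\<And>q. q \<in> K \<Longrightarrow> m * fst q + n * snd q \<le> m * i + n * v"
    "\<And>q. q \<in> interior K \<Longrightarrow> m * fst q + n * snd q < m * i + n * v"
    using supporting_line[OF K _ p] by auto
  have "0 < n * (v - y)" using mn(2)[OF y(1)] by (simp add: algebra_simps)
  then have n: "n < 0" using y(2) by (simp add: zero_less_mult_iff)
  show ?thesis
  proof (rule that[of "m / n"])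
    show "v - m / n * (fst q - i) \<le> snd q" if "q \<in> K" for q
      using mn(1)[OF that] n by (simp add: field_simps)
    show "v - m / n * (fst q - i) < snd q" if "q \<in> interior K" for q
      using mn(2)[OF that] n by (simp add: field_simps)
  qed
qed

lemma interior_segment:
  fixes K :: "(real \<times> real) set"
  assumes "convex K" "c \<in> interior K" "r \<in> K" "0 < t" "t \<le> 1"
  shows "t *\<^sub>R c + (1 - t) *\<^sub>R r \<in> interior K"
  using mem_interior_convex_shrink[OF assms] by (simp add: algebra_simps)

lemma interior_on_vertical:
  fixes K :: "(real \<times> real) set"
  assumes K: "convex K" "interior K \<noteq> {}" and LR: "L \<in> K" "R \<in> K" "fst L < i" "i < fst R"
  obtains y where "(i, y) \<in> interior K"
proof -
  obtain c where c: "c \<in> interior K" using K by auto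
  define r where "r = (if fst c \<le> i then R else L)"
  define t where "t = (fst r - i) / (fst r - fst c)"
  have r: "r \<in> K" using LR by (auto simp: r_def)
  have ne: "fst r - fst c \<noteq> 0" using LR by (auto simp: r_def)
  have t: "0 < t" "t \<le> 1" using LR by (auto simp: t_def r_def field_simps)
  have "fst (t *\<^sub>R c + (1 - t) *\<^sub>R r) = fst r - t * (fst r - fst c)" by (simp add: algebra_simps)
  also have "\<dots> = i" using ne by (simp add: t_def)
  finally have "t *\<^sub>R c + (1 - t) *\<^sub>R r = (i, snd (t *\<^sub>R c + (1 - t) *\<^sub>R r))" by (simp add: prod_eq_iff)
  then show ?thesis using interior_segment[OF K(1) c r t] that by metis
qed

lemma lines_at_integer:
  fixes K :: "(real \<times> real) set" and i :: int
  assumes K: "convex K" and free: "interior K \<inter> Z2 = {}" and y: "(of_int i, y) \<in> interior K"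
  obtains j :: int and \<alpha> \<gamma> where "of_int j < y" "y < of_int j + 1"
    "\<And>q. q \<in> K \<Longrightarrow> snd q \<le> of_int j + 1 + \<alpha> * (fst q - of_int i)"
    "\<And>q. q \<in> interior K \<Longrightarrow> snd q < of_int j + 1 + \<alpha> * (fst q - of_int i)"
    "\<And>q. q \<in> K \<Longrightarrow> of_int j - \<gamma> * (fst q - of_int i) \<le> snd q"
    "\<And>q. q \<in> interior K \<Longrightarrow> of_int j - \<gamma> * (fst q - of_int i) < snd q"
proof -
  have Z: "(of_int i, of_int k) \<notin> interior K" for k
    using free by (auto simp: Z2_def)
  define j where "j = \<lfloor>y\<rfloor>"
  have "y \<noteq> of_int j" using Z[of j] y by auto
  then have j: "of_int j < y" "y < of_int j + 1" unfolding j_def by linarith+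
  have Z': "(of_int i, of_int j + 1) \<notin> interior K" using Z[of "j+1"] by simp
  obtain \<alpha> where a: "\<And>q. q \<in> K \<Longrightarrow> snd q \<le> of_int j + 1 + \<alpha> * (fst q - of_int i)"
    "\<And>q. q \<in> interior K \<Longrightarrow> snd q < of_int j + 1 + \<alpha> * (fst q - of_int i)"
    using line_above[OF K y j(2) Z'] by metis
  obtain \<gamma> where g: "\<And>q. q \<in> K \<Longrightarrow> of_int j - \<gamma> * (fst q - of_int i) \<le> snd q"
    "\<And>q. q \<in> interior K \<Longrightarrow> of_int j - \<gamma> * (fst q - of_int i) < snd q"
    using line_below[OF K y j(1) Z] by metis
  show ?thesis using that j a g by metis
qed

lemma compact_region:
  fixes l u :: "real \<Rightarrow> real"
  assumes "continuous_on UNIV l" "continuous_on UNIV u"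
  shows "compact {p. a \<le> fst p \<and> fst p \<le> b \<and> l (fst p) \<le> snd p \<and> snd p \<le> u (fst p)}" (is "compact ?S")
proof -
  have cl: "closed ?S"
    by (intro closed_Collect_conj closed_Collect_le continuous_intros
      continuous_on_compose2[OF assms(1)] continuous_on_compose2[OF assms(2)]) auto
  have "bounded (l ` {a..b})" "bounded (u ` {a..b})"
    using assms by (auto intro!: compact_imp_bounded compact_continuous_image intro: continuous_on_subset)
  then obtain B C where "\<forall>x\<in>l ` {a..b}. norm x \<le> B" "\<forall>x\<in>u ` {a..b}. norm x \<le> C"
    unfolding bounded_iff by blast
  then have BC: "\<bar>l x\<bar> \<le> B" "\<bar>u x\<bar> \<le> C" if "a \<le> x" "x \<le> b" for x
    using that by auto
  have "?S \<subseteq> {a..b} \<times> {-B..C}"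
  proof
    fix p assume "p \<in> ?S"
    then show "p \<in> {a..b} \<times> {-B..C}" using BC[of "fst p"] by (cases p) auto
  qed
  moreover have "compact ({a..b} \<times> {-B..C})" by (intro compact_Times) auto
  ultimately show ?thesis using cl by (meson bounded_subset compact_eq_bounded_closed)
qed

lemma convex_linear_region:
  "convex {p. a \<le> fst p \<and> fst p \<le> b \<and> l0 + l1 * fst p \<le> snd p \<and> snd p \<le> u0 + u1 * fst (p :: real \<times> real)}"
    (is "convex ?S")
proof -
  have "?S = {p. (1,0) \<bullet> p \<ge> a} \<inter> {p. (1,0) \<bullet> p \<le> b} \<inter> {p. (-l1,1) \<bullet> p \<ge> l0} \<inter> {p. (-u1,1) \<bullet> p \<le> u0}"
    by (auto simp: inner_prod_def algebra_simps)
  then show ?thesis by (simp add: convex_Int convex_halfspace_le convex_halfspace_ge)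
qed

lemma has_integral_linear_fun:
  assumes "a \<le> (b::real)"
  shows "((\<lambda>x. k0 + k1 * x) has_integral (k0 * (b - a) + k1 * (b\<^sup>2 - a\<^sup>2) / 2)) {a..b}"
proof -
  have "((\<lambda>x. k0 + k1 * x) has_integral (k0 * b + k1 * b\<^sup>2/2) - (k0 * a + k1 * a\<^sup>2/2)) {a..b}"
    by (rule fundamental_theorem_of_calculus[OF assms])
      (auto intro!: derivative_eq_intros simp flip: has_real_derivative_iff_has_vector_derivative)
  then show ?thesis by (simp add: algebra_simps diff_divide_distrib)
qed

lemma crossing_segments_le_measure:
  assumes K: "compact K" "convex K"
    and p: "(x0, y0) \<in> K" "(x0 + h, y0) \<in> K" "(x1, y1) \<in> K" "(x1, y1 + v) \<in> K"
    and c: "x0 \<le> x1" "x1 \<le> x0 + h" "y1 \<le> y0" "y0 \<le> y1 + v"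
  shows "h * v \<le> 2 * measure lborel K"
proof -
  let ?A = "K \<inter> {x. 1 * fst x + 0 * snd x \<le> x1}" and ?B = "K \<inter> {x. 1 * fst x + 0 * snd x \<ge> x1}"
  note A = compact_convex_halves(1,2)[OF K] and B = compact_convex_halves(3,4)[OF K]
  have "\<bar>cross (x0,y0) (x1,y1) (x1,y1+v)\<bar> / 2 \<le> measure lborel ?A"
    by (rule triangle_le_measure[OF A]) (use p c in auto)
  moreover have "\<bar>cross (x0+h,y0) (x1,y1) (x1,y1+v)\<bar> / 2 \<le> measure lborel ?B"
    by (rule triangle_le_measure[OF B]) (use p c in auto)
  moreover have "measure lborel K = measure lborel ?A + measure lborel ?B"
    by (rule measure_split) (use K in auto)
  moreover have "cross (x0,y0) (x1,y1) (x1,y1+v) = (x1 - x0) * v" "cross (x0+h,y0) (x1,y1) (x1,y1+v) = - ((x0 + h - x1) * v)"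
    by (simp_all add: cross_def algebra_simps)
  moreover have "(x1 - x0) * v \<ge> 0" "(x0 + h - x1) * v \<ge> 0" using c by auto
  moreover have "h * v = (x1 - x0) * v + (x0 + h - x1) * v" by (simp add: algebra_simps)
  ultimately show ?thesis by linarith
qed

definition cross_shape :: "(real \<times> real) set \<Rightarrow> real \<Rightarrow> bool" where
  "cross_shape K w \<longleftrightarrow> (\<exists>T t1 t2. unimodular T \<and>
     (let I1 = (\<lambda>x. t1 + x) ` (convex hull {(0, 0), (w, 0)});
          I2 = (\<lambda>x. t2 + x) ` (convex hull {(0, 0), (0, w / (w - 1))})
      in I1 \<inter> I2 \<noteq> {} \<and> T ` K = convex hull (I1 \<union> I2)))"

lemma cross_shape_unimodular:
  assumes "cross_shape (S ` K) w" "unimodular S" shows "cross_shape K w"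
proof -
  obtain T t1 t2 where "unimodular T" and
    h: "let I1 = (\<lambda>x. t1 + x) ` (convex hull {(0, 0), (w, 0)});
          I2 = (\<lambda>x. t2 + x) ` (convex hull {(0, 0), (0, w / (w - 1))})
      in I1 \<inter> I2 \<noteq> {} \<and> T ` S ` K = convex hull (I1 \<union> I2)"
    using assms(1) unfolding cross_shape_def by blast
  then have "unimodular (T \<circ> S)" using assms(2) unimodular_comp by blast
  then show ?thesis unfolding cross_shape_def
    by (intro exI[of _ "T \<circ> S"] exI[of _ t1] exI[of _ t2] conjI) (use h in \<open>simp_all only: image_comp\<close>)
qed

lemma translated_segment:
  "(\<lambda>x. (s, t) + x) ` (convex hull {(0, 0), (h, v)}) = closed_segment (s, t) (s + h, t + v :: real)"
  by (simp add: segment_convex_hull flip: convex_hull_translation)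

lemma horizontal_segment:
  fixes s t h :: real
  assumes "h \<ge> 0"
  shows "closed_segment (s, t) (s + h, t) = {p. s \<le> fst p \<and> fst p \<le> s + h \<and> snd p = t}"
proof (cases "h = 0")
  case False
  show ?thesis
  proof (intro set_eqI iffI)
    fix p assume "p \<in> closed_segment (s, t) (s + h, t)"
    then obtain u where u: "0 \<le> u" "u \<le> 1" "p = (1 - u) *\<^sub>R (s, t) + u *\<^sub>R (s + h, t)" by (auto simp: in_segment)
    have "u * h \<le> 1 * h" "0 \<le> u * h" using u assms by (intro mult_right_mono mult_nonneg_nonneg; auto)+
    then show "p \<in> {p. s \<le> fst p \<and> fst p \<le> s + h \<and> snd p = t}" using u by (auto simp: algebra_simps)
  next
    fix p assume p: "p \<in> {p. s \<le> fst p \<and> fst p \<le> s + h \<and> snd p = t}"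
    show "p \<in> closed_segment (s, t) (s + h, t)"
      unfolding in_segment using p False assms
      by (intro exI[of _ "(fst p - s)/h"]) (auto simp: prod_eq_iff field_simps)
  qed
qed (auto simp: prod_eq_iff)

lemma vertical_segment:
  fixes s t v :: real
  assumes "v \<ge> 0"
  shows "closed_segment (s, t) (s, t + v) = {p. fst p = s \<and> t \<le> snd p \<and> snd p \<le> t + v}"
proof (cases "v = 0")
  case False
  show ?thesis
  proof (intro set_eqI iffI)
    fix p assume "p \<in> closed_segment (s, t) (s, t + v)"
    then obtain u where u: "0 \<le> u" "u \<le> 1" "p = (1 - u) *\<^sub>R (s, t) + u *\<^sub>R (s, t + v)" by (auto simp: in_segment)
    have "u * v \<le> 1 * v" "0 \<le> u * v" using u assms by (intro mult_right_mono mult_nonneg_nonneg; auto)+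
    then show "p \<in> {p. fst p = s \<and> t \<le> snd p \<and> snd p \<le> t + v}" using u by (auto simp: algebra_simps)
  next
    fix p assume p: "p \<in> {p. fst p = s \<and> t \<le> snd p \<and> snd p \<le> t + v}"
    show "p \<in> closed_segment (s, t) (s, t + v)"
      unfolding in_segment using p False assms
      by (intro exI[of _ "(snd p - t)/v"]) (auto simp: prod_eq_iff field_simps)
  qed
qed (auto simp: prod_eq_iff)

lemma cross_shape_iff:
  assumes "w > 1"
  shows "cross_shape K w \<longleftrightarrow> (\<exists>T x0 y0 x1 y1. unimodular T \<and>
     x0 \<le> x1 \<and> x1 \<le> x0 + w \<and> y1 \<le> y0 \<and> y0 \<le> y1 + w/(w-1) \<and>
     T ` K = convex hull {(x0, y0), (x0 + w, y0), (x1, y1), (x1, y1 + w/(w-1))})"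
proof -
  have w: "w \<ge> 0" "w/(w-1) \<ge> 0" using assms by auto
  have h: "convex hull (closed_segment a b \<union> closed_segment c d) = convex hull {a, b, c, d}" for a b c d :: "real \<times> real"
  proof -
    have "closed_segment a b \<union> closed_segment c d \<subseteq> convex hull {a, b, c, d}"
      unfolding segment_convex_hull by (intro Un_least hull_mono) auto
    moreover have "{a, b, c, d} \<subseteq> closed_segment a b \<union> closed_segment c d" by auto
    ultimately show ?thesis
      by (intro subset_antisym hull_mono hull_minimal convex_convex_hull)
  qed
  have i: "closed_segment (x0, y0) (x0 + w, y0) \<inter> closed_segment (x1, y1) (x1, y1 + w/(w-1)) \<noteq> {} \<longleftrightarrow>
     x0 \<le> x1 \<and> x1 \<le> x0 + w \<and> y1 \<le> y0 \<and> y0 \<le> y1 + w/(w-1)"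
    (is "?l \<longleftrightarrow> ?r") for x0 y0 x1 y1 :: real
  proof
    show "?l \<Longrightarrow> ?r" unfolding horizontal_segment[OF w(1)] vertical_segment[OF w(2)] by auto
    assume ?r
    then have "(x1, y0) \<in> closed_segment (x0, y0) (x0 + w, y0) \<inter> closed_segment (x1, y1) (x1, y1 + w/(w-1))"
      unfolding horizontal_segment[OF w(1)] vertical_segment[OF w(2)] by auto
    then show ?l by blast
  qed
  have s: "(\<lambda>x. (x0, y0) + x) ` (convex hull {(0, 0), (w, 0)}) = closed_segment (x0, y0) (x0 + w, y0)"
    "(\<lambda>x. (x0, y0) + x) ` (convex hull {(0, 0), (0, w/(w-1))}) = closed_segment (x0, y0) (x0, y0 + w/(w-1))" for x0 y0 :: real
    using translated_segment[of x0 y0 w 0] translated_segment[of x0 y0 0 "w/(w-1)"] by auto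
  show ?thesis unfolding cross_shape_def Let_def split_paired_Ex s h i by (simp only: conj_assoc)
qed

lemma cross_shapeI:
  assumes K: "compact K" "convex K" "interior K \<noteq> {}" and w: "w > 1"
    and m: "measure lborel K = w\<^sup>2 / (2 * (w - 1))"
    and p: "(x0, y0) \<in> K" "(x0 + w, y0) \<in> K" "(x1, y1) \<in> K" "(x1, y1 + w/(w-1)) \<in> K"
    and c: "x0 \<le> x1" "x1 \<le> x0 + w" "y1 \<le> y0" "y0 \<le> y1 + w/(w-1)"
  shows "cross_shape K w"
proof -
  define H where "H = convex hull {(x0, y0), (x0 + w, y0), (x1, y1), (x1, y1 + w/(w-1))}"
  have H: "compact H" "convex H" by (auto simp: H_def finite_imp_compact_convex_hull)
  have HK: "H \<subseteq> K" unfolding H_def by (rule hull_minimal) (use K p in auto)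
  have "w * (w/(w-1)) \<le> 2 * measure lborel H"
    by (rule crossing_segments_le_measure[OF H _ _ _ _ c]) (auto simp: H_def hull_inc)
  moreover have "w * (w/(w-1)) = 2 * (w\<^sup>2 / (2 * (w - 1)))" using w by (simp add: power2_eq_square field_simps)
  ultimately have "measure lborel K \<le> measure lborel H" using m by linarith
  then have "H = K" using H HK K by (intro eq_if_measure_le compact_imp_closed) auto
  moreover have "unimodular id" using umap_unimodular[OF umapI[of 1 1 0 0 0 0]] by (simp add: aff_id)
  ultimately show ?thesis unfolding cross_shape_iff[OF w] H_def using c by (metis image_id id_apply)
qed

lemma unimodular_imp_umap: assumes "unimodular T" shows "umap T"
proof -
  obtain L t where L: "linear L" "T = (\<lambda>x. L x + t)" and Z: "T ` Z2 = Z2"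
    using assms unfolding unimodular_def by blast
  have inZ: "T p \<in> Z2" if "p \<in> Z2" for p using Z that by blast
  have "L 0 = 0" using L(1) by (rule linear_0)
  moreover have "0 \<in> Z2" by (simp add: Z2_def zero_prod_def)
  ultimately have "t \<in> Z2" using inZ[of 0] L(2) by simp
  have diff: "p - q \<in> Z2" if "p \<in> Z2" "q \<in> Z2" for p q
    using that by (auto simp: Z2_def)
  have "L p \<in> Z2" if "p \<in> Z2" for p using diff[OF inZ[OF that] \<open>t \<in> Z2\<close>] by (simp add: L(2))
  from this[of "(1,0)"] this[of "(0,1)"] \<open>t \<in> Z2\<close>
  obtain a b c d e f :: int where abcd: "L (1,0) = (of_int a, of_int c)" "L (0,1) = (of_int b, of_int d)"
      "t = (of_int e, of_int f)"
    unfolding Z2_def by (auto elim!: Ints_cases)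
  have Lp: "L (x, y) = x *\<^sub>R (of_int a, of_int c) + y *\<^sub>R (of_int b, of_int d)" for x y
  proof -
    have "L (x, y) = L (x *\<^sub>R (1, 0) + y *\<^sub>R (0, 1))" by simp
    then show ?thesis using L(1) by (simp only: linear_add linear_scale abcd)
  qed
  have T: "T = aff (of_int a) (of_int b) (of_int c) (of_int d) (of_int e) (of_int f)"
    by (auto simp: fun_eq_iff L(2) Lp aff_Pair abcd(3) algebra_simps)
  have pre: "\<exists>x y :: int. a * x + b * y = k \<and> c * x + d * y = l" for k l :: int
  proof -
    have "(of_int (k + e), of_int (l + f)) \<in> Z2" by (auto simp: Z2_def)
    then obtain p where "p \<in> Z2" "T p = (of_int (k + e), of_int (l + f))" using Z by (metis imageE)
    then obtain x y :: int where "T (of_int x, of_int y) = (of_int (k + e), of_int (l + f))"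
      unfolding Z2_def by (auto elim!: Ints_cases)
    then have "real_of_int (a * x + b * y) = of_int k" "real_of_int (c * x + d * y) = of_int l"
      by (auto simp: T aff_Pair)
    then show ?thesis unfolding of_int_eq_iff by blast
  qed
  obtain x y x' y' where "a * x + b * y = 1" "c * x + d * y = 0" "a * x' + b * y' = 0" "c * x' + d * y' = 1"
    using pre[of 1 0] pre[of 0 1] by blast
  moreover have "(a * d - b * c) * (x * y' - x' * y) =
    (a * x + b * y) * (c * x' + d * y') - (c * x + d * y) * (a * x' + b * y')"
    by (simp add: algebra_simps)
  ultimately have "(a * d - b * c) * (x * y' - x' * y) = 1" by simp
  then have "\<bar>a * d - b * c\<bar> = 1" by (rule zmult_eq_1_iff[THEN iffD1, THEN disjE]) auto
  then show ?thesis unfolding T by (rule umapI)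
qed

lemma cross_shape_measure:
  assumes K: "compact K" and w: "w > 1" and cs: "cross_shape K w"
  shows "w\<^sup>2 / (2 * (w - 1)) \<le> measure lborel K"
proof -
  obtain T x0 y0 x1 y1 where T: "unimodular T" and c: "x0 \<le> x1" "x1 \<le> x0 + w" "y1 \<le> y0" "y0 \<le> y1 + w/(w-1)"
    and H: "T ` K = convex hull {(x0, y0), (x0 + w, y0), (x1, y1), (x1, y1 + w/(w-1))}"
    using cs unfolding cross_shape_iff[OF w] by blast
  have "w * (w/(w-1)) \<le> 2 * measure lborel (T ` K)"
    unfolding H
    by (rule crossing_segments_le_measure[OF _ _ _ _ _ _ c]) (auto simp: hull_inc finite_imp_compact_convex_hull)
  moreover have "measure lborel (T ` K) = measure lborel K"
    using T K by (simp add: iaff_measure umap_imp_iaff unimodular_imp_umap compact_imp_closed)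
  moreover have "w * (w/(w-1)) = 2 * (w\<^sup>2 / (2 * (w - 1)))" using w by (simp add: power2_eq_square field_simps)
  ultimately show ?thesis by linarith
qed

subsection \<open>Lattice width between 1 and 2\<close>

lemma wideD:
  assumes "wide K w" "\<And>p. p \<in> K \<Longrightarrow> lo \<le> of_int m * fst p + of_int n * snd p \<and> of_int m * fst p + of_int n * snd p \<le> hi"
    and "(m, n) \<noteq> (0, 0)"
  shows "w \<le> hi - lo"
proof -
  obtain p q where pq: "p \<in> K" "q \<in> K" "of_int m * (fst p - fst q) + of_int n * (snd p - snd q) \<ge> w"
    using assms(1,3) unfolding wide_def by blast
  then have "w \<le> (of_int m * fst p + of_int n * snd p) - (of_int m * fst q + of_int n * snd q)"
    by (simp add: algebra_simps)
  then show ?thesis using assms(2)[OF pq(1)] assms(2)[OF pq(2)] by linarith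
qed

definition body :: "(real \<times> real) set \<Rightarrow> real \<Rightarrow> bool" where
  "body K w \<longleftrightarrow> compact K \<and> convex K \<and> interior K \<noteq> {} \<and> wide K w"

lemma bodyD:
  assumes "body K w"
  shows "compact K" "convex K" "interior K \<noteq> {}" "wide K w" "closed K"
  using assms by (auto simp: body_def compact_imp_closed)

lemma body_iaff: "body K w \<Longrightarrow> iaff S \<Longrightarrow> body (S ` K) w"
  by (auto simp: body_def iaff_compact iaff_convex iaff_interior wide_iaff)

lemma body_measure: "body K w \<Longrightarrow> iaff S \<Longrightarrow> measure lborel (S ` K) = measure lborel K"
  by (auto simp: body_def iaff_measure compact_imp_closed)

definition shear :: "int \<Rightarrow> real \<times> real \<Rightarrow> real \<times> real" where
  "shear k = aff (of_int 1) (of_int 0) (of_int (-k)) (of_int 1) (of_int 0) (of_int 0)"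

lemma umap_shear: "umap (shear k)"
  unfolding shear_def by (rule umapI) simp

lemma iaff_shear: "iaff (shear k)"
  by (rule umap_imp_iaff[OF umap_shear])

lemma mem_shear: "p \<in> shear k ` K \<longleftrightarrow> (fst p, snd p + of_int k * fst p) \<in> K"
proof
  assume "(fst p, snd p + of_int k * fst p) \<in> K"
  moreover have "p = shear k (fst p, snd p + of_int k * fst p)" by (simp add: shear_def prod_eq_iff)
  ultimately show "p \<in> shear k ` K" by blast
qed (auto simp: shear_def)

definition xflip :: "int \<Rightarrow> real \<times> real \<Rightarrow> real \<times> real" where
  "xflip i = aff (of_int (-1)) (of_int 0) (of_int 0) (of_int 1) (of_int i) (of_int 0)"

lemma umap_xflip: "umap (xflip i)" unfolding xflip_def by (rule umapI) simp

lemma mem_xflip: "p \<in> xflip i ` K \<longleftrightarrow> (of_int i - fst p, snd p) \<in> K"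
proof
  assume "(of_int i - fst p, snd p) \<in> K"
  moreover have "p = xflip i (of_int i - fst p, snd p)" by (simp add: xflip_def prod_eq_iff)
  ultimately show "p \<in> xflip i ` K" by blast
qed (auto simp: xflip_def)

lemma cross_shape_umap: "cross_shape (S ` K) w \<Longrightarrow> umap S \<Longrightarrow> cross_shape K w"
  using cross_shape_unimodular umap_unimodular by blast

lemma measure_linear_region:
  assumes "a \<le> b" and "l0 + l1 * a \<le> u0 + u1 * a" "l0 + l1 * b \<le> u0 + u1 * b"
  shows "measure lborel {p. a \<le> fst p \<and> fst p \<le> b \<and> l0 + l1 * fst p \<le> snd p \<and> snd p \<le> u0 + u1 * fst p}
    = (u0 - l0) * (b - a) + (u1 - l1) * (b\<^sup>2 - a\<^sup>2) / 2"
proof (rule measure_region)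
  fix x assume x: "x \<in> {a..b}"
  show "l0 + l1 * x \<le> u0 + u1 * x"
  proof (cases "u1 \<ge> l1")
    case True
    then have "(u1 - l1) * a \<le> (u1 - l1) * x" using x by (intro mult_left_mono) auto
    then show ?thesis using assms(2) by (simp add: algebra_simps)
  next
    case False
    then have "(l1 - u1) * x \<le> (l1 - u1) * b" using x by (intro mult_left_mono) auto
    then show ?thesis using assms(3) by (simp add: algebra_simps)
  qed
next
  have "(\<lambda>x. u0 + u1 * x - (l0 + l1 * x)) = (\<lambda>x. (u0 - l0) + (u1 - l1) * x)" by (auto simp: algebra_simps)
  then show "((\<lambda>x. u0 + u1 * x - (l0 + l1 * x)) has_integral (u0 - l0) * (b - a) + (u1 - l1) * (b\<^sup>2 - a\<^sup>2) / 2) {a..b}"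
    using has_integral_linear_fun[OF assms(1)] by simp
qed (intro continuous_intros)+

lemma linear_region_upper_bound:
  assumes K: "body K w" and ab: "a \<le> b" and LR: "L \<in> K" "fst L = a" "R \<in> K" "fst R = b"
    and x: "\<And>p. p \<in> K \<Longrightarrow> a \<le> fst p \<and> fst p \<le> b"
    and l: "\<And>p. p \<in> K \<Longrightarrow> - \<gamma> * fst p \<le> snd p \<and> snd p \<le> 1 + \<alpha> * fst p"
  shows "measure lborel K \<le> (b - a) * (1 + (\<alpha> + \<gamma>) * (a + b) / 2)"
    and "0 \<le> 1 + (\<alpha> + \<gamma>) * a" "0 \<le> 1 + (\<alpha> + \<gamma>) * b"
    and "measure lborel K = (b - a) * (1 + (\<alpha> + \<gamma>) * (a + b) / 2) \<Longrightarrow>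
      p \<in> K \<longleftrightarrow> a \<le> fst p \<and> fst p \<le> b \<and> - \<gamma> * fst p \<le> snd p \<and> snd p \<le> 1 + \<alpha> * fst p"
proof -
  let ?P = "{p. a \<le> fst p \<and> fst p \<le> b \<and> 0 + - \<gamma> * fst p \<le> snd p \<and> snd p \<le> 1 + \<alpha> * fst p}"
  show ends: "0 \<le> 1 + (\<alpha> + \<gamma>) * a" "0 \<le> 1 + (\<alpha> + \<gamma>) * b"
    using l[OF LR(1)] l[OF LR(3)] LR by (simp_all add: algebra_simps)
  have sub: "K \<subseteq> ?P" using x l by auto
  have mP: "measure lborel ?P = (b - a) * (1 + (\<alpha> + \<gamma>) * (a + b) / 2)"
    by (subst measure_linear_region)
      (use ab ends in \<open>auto simp: algebra_simps power2_eq_square add_divide_distrib diff_divide_distrib\<close>)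
  have cP: "compact ?P" by (rule compact_region) (intro continuous_intros)+
  show "measure lborel K \<le> (b - a) * (1 + (\<alpha> + \<gamma>) * (a + b) / 2)"
    unfolding mP[symmetric] by (intro measure_mono_compact sub cP bodyD[OF K])
  assume "measure lborel K = (b - a) * (1 + (\<alpha> + \<gamma>) * (a + b) / 2)"
  then have "K = ?P"
  proof (intro eq_if_measure_le bodyD[OF K] sub cP convex_linear_region)
    show "interior ?P \<noteq> {}" using bodyD(3)[OF K] interior_mono[OF sub] by blast
  qed (use mP in simp)
  then show "p \<in> K \<longleftrightarrow> a \<le> fst p \<and> fst p \<le> b \<and> - \<gamma> * fst p \<le> snd p \<and> snd p \<le> 1 + \<alpha> * fst p"
    by auto
qed

lemma trapezoid_cross_shape:
  assumes K: "body K 2" and m: "measure lborel K = 2"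
    and mem: "\<And>p. p \<in> K \<longleftrightarrow> -1 \<le> fst p \<and> fst p \<le> 1 \<and> - \<gamma> * fst p \<le> snd p \<and> snd p \<le> 1 + \<alpha> * fst p"
    and \<alpha>\<gamma>: "0 \<le> \<alpha> + \<gamma>" "\<alpha> + \<gamma> \<le> 1"
  shows "cross_shape K 2"
proof (rule cross_shape_umap[OF _ umap_shear])
  define k where "k = \<lfloor>\<alpha>\<rfloor>"
  define \<beta> g where "\<beta> = \<alpha> - k" and "g = - \<gamma> - k"
  have \<beta>: "0 \<le> \<beta>" "\<beta> < 1" unfolding \<beta>_def k_def by linarith+
  have g: "g \<le> \<beta>" "\<beta> \<le> g + 1" using \<alpha>\<gamma> by (auto simp: \<beta>_def g_def)
  let ?K = "shear k ` K"
  note K' = body_iaff[OF K iaff_shear[of k]]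
  have m': "measure lborel ?K = 2" using body_measure[OF K iaff_shear] m by simp
  have mem': "p \<in> ?K \<longleftrightarrow> -1 \<le> fst p \<and> fst p \<le> 1 \<and> g * fst p \<le> snd p \<and> snd p \<le> 1 + \<beta> * fst p" for p
    unfolding mem_shear mem by (auto simp: \<beta>_def g_def algebra_simps)
  show "cross_shape ?K 2"
  proof (cases "g \<le> 0")
    case True
    have "2 \<le> (1 + \<beta>) - g"
    proof (rule wideD[OF bodyD(4)[OF K'], of _ 0 1])
      fix p assume "p \<in> ?K"
      then have p: "-1 \<le> fst p" "fst p \<le> 1" "g * fst p \<le> snd p" "snd p \<le> 1 + \<beta> * fst p" using mem' by auto
      have "g * 1 \<le> g * fst p" using p True by (intro mult_left_mono_neg) auto
      moreover have "\<beta> * fst p \<le> \<beta> * 1" using p \<beta> by (intro mult_left_mono) auto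
      ultimately show "g \<le> of_int 0 * fst p + of_int 1 * snd p \<and> of_int 0 * fst p + of_int 1 * snd p \<le> 1 + \<beta>"
        using p by simp
    qed auto
    then have e: "\<beta> = g + 1" using g by linarith
    show ?thesis
      by (rule cross_shapeI[OF bodyD(1-3)[OF K'], where ?x0.0 = "-1" and ?y0.0 = "-g" and ?x1.0 = 1 and ?y1.0 = g])
        (use True e m' \<beta> in \<open>auto simp: mem'\<close>)
  next
    case False
    have "2 \<le> (1 + \<beta>) - (- g)"
    proof (rule wideD[OF bodyD(4)[OF K'], of _ 0 1])
      fix p assume "p \<in> ?K"
      then have p: "-1 \<le> fst p" "fst p \<le> 1" "g * fst p \<le> snd p" "snd p \<le> 1 + \<beta> * fst p" using mem' by auto
      have "g * (-1) \<le> g * fst p" using p False by (intro mult_left_mono) auto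
      moreover have "\<beta> * fst p \<le> \<beta> * 1" using p \<beta> by (intro mult_left_mono) auto
      ultimately show "- g \<le> of_int 0 * fst p + of_int 1 * snd p \<and> of_int 0 * fst p + of_int 1 * snd p \<le> 1 + \<beta>"
        using p by simp
    qed auto
    moreover have "2 \<le> (1 + (1 - \<beta>)) - (- (1 - g))"
    proof (rule wideD[OF bodyD(4)[OF K'], of _ "-1" 1])
      fix p assume "p \<in> ?K"
      then have p: "-1 \<le> fst p" "fst p \<le> 1" "g * fst p \<le> snd p" "snd p \<le> 1 + \<beta> * fst p" using mem' by auto
      have "(1 - g) * fst p \<le> (1 - g) * 1" using p g \<beta> by (intro mult_left_mono) auto
      moreover have "(1 - \<beta>) * (-1) \<le> (1 - \<beta>) * fst p" using p \<beta> by (intro mult_left_mono) auto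
      ultimately show "- (1 - g) \<le> of_int (-1) * fst p + of_int 1 * snd p \<and> of_int (-1) * fst p + of_int 1 * snd p \<le> 1 + (1 - \<beta>)"
        using p by (simp add: algebra_simps)
    qed auto
    ultimately have e: "\<beta> = 1 - g" by linarith
    define S where "S = aff (of_int 1) (of_int (-1)) (of_int 0) (of_int 1) (of_int 0) (of_int 0)"
    have S: "umap S" unfolding S_def by (rule umapI) simp
    have memS: "p \<in> S ` ?K" if "(fst p + snd p, snd p) \<in> ?K" for p
    proof -
      have "p = S (fst p + snd p, snd p)" by (simp add: S_def prod_eq_iff)
      then show ?thesis using that by blast
    qed
    have "cross_shape (S ` ?K) 2"
    proof (rule cross_shapeI[OF bodyD(1-3)[OF body_iaff[OF K' umap_imp_iaff[OF S]]],
         where ?x0.0 = "-1 - g" and ?y0.0 = g and ?x1.0 = "g - 1" and ?y1.0 = "-g"])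
      show "measure lborel (S ` ?K) = 2\<^sup>2 / (2 * (2 - 1))"
        using body_measure[OF K' umap_imp_iaff[OF S]] m' by simp
    qed (use False e \<beta> in \<open>auto intro!: memS simp: mem' simp del: image_eqI\<close>)
    then show ?thesis by (rule cross_shape_umap[OF _ S])
  qed
qed

lemma upper_bound_one_integer:
  assumes K: "body K w" and w: "1 < w" "w \<le> 2"
    and ab: "b = a + w" "a < 0" "-1 \<le> a" "0 < b" "b \<le> 1" "0 \<le> a + b"
    and LR: "L \<in> K" "fst L = a" "R \<in> K" "fst R = b"
    and x: "\<And>p. p \<in> K \<Longrightarrow> a \<le> fst p \<and> fst p \<le> b"
    and l: "\<And>p. p \<in> K \<Longrightarrow> - \<gamma> * fst p \<le> snd p \<and> snd p \<le> 1 + \<alpha> * fst p"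
  shows "measure lborel K \<le> w\<^sup>2 / (2 * (w - 1))"
    and "measure lborel K = w\<^sup>2 / (2 * (w - 1)) \<Longrightarrow> cross_shape K w"
proof -
  have ab': "a \<le> b" using ab by simp
  note ub = linear_region_upper_bound(1-3)[OF K ab' LR x l]
  define m where "m = \<alpha> + \<gamma>"
  have m: "m \<le> 1/(-a)" using ub(2) ab by (simp add: m_def field_simps)
  have bw: "b - a = w" using ab by simp
  have s1: "w * (1 + m * (a + b) / 2) \<le> w * (1 + (1/(-a)) * (a + b) / 2)"
    using m ab w by (intro mult_left_mono add_left_mono divide_right_mono mult_right_mono) auto
  have s2: "w * (1 + (1/(-a)) * (a + b) / 2) = w\<^sup>2 / (2 * (-a))"
    using ab by (simp add: field_simps power2_eq_square)
  have s3: "w\<^sup>2 / (2 * (-a)) \<le> w\<^sup>2 / (2 * (w - 1))"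
    using ab w by (intro divide_left_mono mult_pos_pos) auto
  have u: "measure lborel K \<le> w * (1 + m * (a + b) / 2)" using ub(1) by (simp add: m_def bw)
  then show "measure lborel K \<le> w\<^sup>2 / (2 * (w - 1))" using s1 s2 s3 by linarith
  assume E: "measure lborel K = w\<^sup>2 / (2 * (w - 1))"
  have e: "measure lborel K = (b - a) * (1 + (\<alpha> + \<gamma>) * (a + b) / 2)"
    using u s1 s2 s3 E by (simp add: m_def bw)
  have mem: "p \<in> K \<longleftrightarrow> a \<le> fst p \<and> fst p \<le> b \<and> - \<gamma> * fst p \<le> snd p \<and> snd p \<le> 1 + \<alpha> * fst p" for p
    by (rule linear_region_upper_bound(4)[OF K ab' LR _ _ e]) (use x l in auto)
  have "w\<^sup>2 / (2 * (-a)) = w\<^sup>2 / (2 * (w - 1))" using u s1 s2 s3 E by linarith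
  then have "w\<^sup>2 = 0 \<or> 2 * (-a) = 2 * (w - 1)" by (simp only: divide_cancel_left)
  then have aw: "- a = w - 1" using w by simp
  then have b1: "b = 1" using ab by simp
  have "w * (1 + m * (a + b) / 2) = w * (1 + (1/(-a)) * (a + b) / 2)" using u s1 s2 s3 E by linarith
  moreover have "w \<noteq> 0" using w by simp
  ultimately have "1 + m * (a + b) / 2 = 1 + (1/(-a)) * (a + b) / 2" by (metis mult_left_cancel)
  moreover have "1 + X / 2 = 1 + Y / 2 \<Longrightarrow> X = Y" for X Y :: real by simp
  ultimately have mab: "m * (a + b) = 1/(-a) * (a + b)" by blast
  show "cross_shape K w"
  proof (cases "m = 1/(w-1)")
    case True
    define k where "k = \<lceil>- \<gamma>\<rceil>"
    have m1: "m \<ge> 1" using True w by simp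
    have mw: "m * (w - 1) = 1" using True w by simp
    define \<alpha>' \<gamma>' where "\<alpha>' = \<alpha> - k" and "\<gamma>' = \<gamma> + k"
    have p: "\<alpha>' \<ge> 0" "\<gamma>' \<ge> 0" using m1 unfolding \<alpha>'_def \<gamma>'_def k_def m_def by linarith+
    have me: "m = \<alpha>' + \<gamma>'" by (simp add: \<alpha>'_def \<gamma>'_def m_def)
    let ?K = "shear k ` K"
    note K' = body_iaff[OF K iaff_shear[of k]]
    have mem': "p \<in> ?K \<longleftrightarrow> 1 - w \<le> fst p \<and> fst p \<le> 1 \<and> - \<gamma>' * fst p \<le> snd p \<and> snd p \<le> 1 + \<alpha>' * fst p" for p
      unfolding mem_shear mem using aw b1 by (auto simp: \<alpha>'_def \<gamma>'_def algebra_simps)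
    have g1: "\<gamma>' * (w - 1) = 1 - \<alpha>' * (w - 1)" using mw by (simp add: me algebra_simps)
    have g2: "\<gamma>' * (w - 1) \<ge> 0" "\<alpha>' * (w - 1) \<ge> 0" using w p by auto
    note g = g1 g2
    have q: "- \<gamma>' + w/(w-1) = 1 + \<alpha>'"
    proof -
      have "w/(w-1) = 1 + m" using True w by (simp add: field_simps)
      then show ?thesis by (simp add: me)
    qed
    have "cross_shape ?K w"
    proof (rule cross_shapeI[OF bodyD(1-3)[OF K'] w(1),
        where ?x0.0 = "1 - w" and ?y0.0 = "\<gamma>' * (w - 1)" and ?x1.0 = 1 and ?y1.0 = "- \<gamma>'"], unfold q)
      show "measure lborel ?K = w\<^sup>2 / (2 * (w - 1))" using E body_measure[OF K iaff_shear] by simp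
    qed (use p g w in \<open>auto simp: mem' algebra_simps\<close>)
    then show ?thesis by (rule cross_shape_umap[OF _ umap_shear])
  next
    case m_ne: False
    have "m * (a + b) = 1/(w-1) * (a + b)" using mab unfolding aw .
    then have "m = 1/(w-1) \<or> a + b = 0" by (metis mult_right_cancel)
    with m_ne have "a + b = 0" by simp
    then have a: "a = -1" "w = 2" using b1 aw by auto
    have mem': "p \<in> K \<longleftrightarrow> -1 \<le> fst p \<and> fst p \<le> 1 \<and> - \<gamma> * fst p \<le> snd p \<and> snd p \<le> 1 + \<alpha> * fst p" for p
      using mem a b1 by simp
    have m1: "m \<le> 1" "-1 \<le> m" using ub(2,3) a b1 by (auto simp: m_def)
    have K2: "body K 2" "measure lborel K = 2" using K E a by auto
    show ?thesis
    proof (cases "m \<ge> 0")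
      case True
      then show ?thesis using trapezoid_cross_shape[OF K2 mem'] m1 a by (simp add: m_def)
    next
      case False
      have "cross_shape (xflip 0 ` K) 2"
      proof (rule trapezoid_cross_shape[of _ "- \<gamma>" "- \<alpha>"])
        show "measure lborel (xflip 0 ` K) = 2"
          using body_measure[OF K2(1) umap_imp_iaff[OF umap_xflip]] K2 by simp
      qed (use m1 False K2 umap_xflip in \<open>auto simp: mem_xflip mem' m_def body_iaff umap_imp_iaff\<close>)
      then show ?thesis using a cross_shape_umap umap_xflip by blast
    qed
  qed
qed

lemma two_integer_numeric:
  fixes m n p q w :: real
  assumes p: "p > 0" "q > 0" and w: "p + q = w - 1" "w \<le> 2" and m: "m > 0" "n > 0" "m * p \<le> 1" "n * q \<le> 1"
  defines "I \<equiv> w - m * p\<^sup>2 / 2 - n * q\<^sup>2 / 2 + m * n / (m + n) / 2"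
  shows "I \<le> w\<^sup>2 / (2 * (w - 1))"
    and "I = w\<^sup>2 / (2 * (w - 1)) \<Longrightarrow> m * p = n * q \<and> (w < 2 \<longrightarrow> m * p = 1)"
proof -
  define v H where "v = w - 1" and "H = m * n / (m + n)"
  have v: "0 < v" "v \<le> 1" "p + q = v" "w = 1 + v" using p w by (auto simp: v_def)
  have mn: "m + n > 0" using m by simp
  have "m * n * (p + q) = n * (m * p) + m * (n * q)" by (simp add: algebra_simps)
  also have "\<dots> \<le> n * 1 + m * 1" using m by (intro add_mono mult_left_mono) auto
  finally have "m * n * v \<le> m + n" using v by simp
  then have Hv: "H * v \<le> 1" using mn by (simp add: H_def)
  have "(m * p\<^sup>2 + n * q\<^sup>2) * (m + n) = m * n * (p + q)\<^sup>2 + (m * p - n * q)\<^sup>2"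
    by (simp add: power2_eq_square algebra_simps)
  then have "m * p\<^sup>2 + n * q\<^sup>2 = (m * n * v\<^sup>2 + (m * p - n * q)\<^sup>2) / (m + n)"
    unfolding v(3) using mn by (simp only: eq_divide_eq) simp
  then have e1: "m * p\<^sup>2 + n * q\<^sup>2 = H * v\<^sup>2 + (m * p - n * q)\<^sup>2 / (m + n)"
    by (simp add: H_def add_divide_distrib)
  have I: "I = w + (H - (m * p\<^sup>2 + n * q\<^sup>2)) / 2" by (simp add: I_def H_def[symmetric] field_simps)
  have t: "w\<^sup>2 / (2 * (w - 1)) = w + (1 - v\<^sup>2) / v / 2"
    using v by (simp add: field_simps power2_eq_square)
  have e3: "w\<^sup>2 / (2 * (w - 1)) - I = ((1 - H * v) * ((1 - v\<^sup>2) / v) + (m * p - n * q)\<^sup>2 / (m + n)) / 2"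
    unfolding t I e1 using v by (simp add: field_simps power2_eq_square)
  have v2: "v\<^sup>2 \<le> 1" using v by (simp add: power2_eq_square mult_le_one)
  define X Y where "X = (1 - H * v) * ((1 - v\<^sup>2) / v)" and "Y = (m * p - n * q)\<^sup>2 / (m + n)"
  have nn: "X \<ge> 0" "Y \<ge> 0"
    using Hv v v2 mn by (auto simp: X_def Y_def intro!: mult_nonneg_nonneg divide_nonneg_pos)
  define Z where "Z = w\<^sup>2 / (2 * (w - 1))"
  have e4: "Z - I = (X + Y) / 2" using e3 by (simp only: X_def Y_def Z_def)
  then have "I \<le> Z" using nn by (simp add: field_simps)
  then show "I \<le> w\<^sup>2 / (2 * (w - 1))" by (simp only: Z_def)
  assume "I = w\<^sup>2 / (2 * (w - 1))"
  then have "I = Z" by (simp only: Z_def)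
  then have "X + Y = 0" using e4 by simp
  then have "X = 0" "Y = 0" using add_nonneg_eq_0_iff[OF nn] by blast+
  then have z: "(1 - H * v) * ((1 - v\<^sup>2) / v) = 0" "(m * p - n * q)\<^sup>2 / (m + n) = 0"
    by (simp_all only: X_def Y_def)
  then have eq: "m * p = n * q" using mn by simp
  moreover have "m * p = 1" if "w < 2"
  proof -
    have "v < 1" using that v by simp
    then have "v\<^sup>2 < 1" using v by (simp add: power_less_one_iff)
    then have "H * v = 1" using z v by simp
    then have "m * n * v = m + n" using mn by (simp add: H_def field_simps)
    moreover have "n * (m * p) + m * (n * q) = m * n * (p + q)" by (simp add: algebra_simps)
    ultimately have "n * (m * p) + m * (n * q) = m + n" unfolding v(3) by simp
    then have "(m + n) * (m * p) = (m + n) * 1" unfolding eq[symmetric] by (simp add: algebra_simps)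
    then show ?thesis using mn by simp
  qed
  ultimately show "m * p = n * q \<and> (w < 2 \<longrightarrow> m * p = 1)" by simp
qed

lemma half_le_bound: "1 < w \<Longrightarrow> w \<le> 2 \<Longrightarrow> (w::real) \<le> w\<^sup>2 / (2 * (w - 1))"
  "1 < w \<Longrightarrow> w \<le> 2 \<Longrightarrow> w = w\<^sup>2 / (2 * (w - 1)) \<Longrightarrow> w = (2::real)"
  by (auto simp: field_simps power2_eq_square)

lemma upper_bound_two_integers_monotone:
  assumes K: "body K w" and w: "1 < w" "w \<le> 2"
    and ab: "b = a + w" "a < 0" "1 < b"
    and LR: "L \<in> K" "fst L = a" "R \<in> K" "fst R = b"
    and x: "\<And>p. p \<in> K \<Longrightarrow> a \<le> fst p \<and> fst p \<le> b"
    and l0: "\<And>p. p \<in> K \<Longrightarrow> - \<gamma> * fst p \<le> snd p \<and> snd p \<le> 1 + \<alpha> * fst p"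
    and l1: "\<And>p. p \<in> K \<Longrightarrow> - \<delta> * (1 - fst p) \<le> snd p \<and> snd p \<le> 1 + \<beta> * (1 - fst p)"
    and m: "\<alpha> + \<gamma> \<le> 0"
  shows "measure lborel K < w\<^sup>2 / (2 * (w - 1))"
proof -
  have ab': "a \<le> b" using ab by simp
  note ub = linear_region_upper_bound(1)[OF K ab' LR x l0]
  have bw: "b - a = w" "a + b > 0" using ab w by auto
  have s: "(b - a) * (1 + (\<alpha> + \<gamma>) * (a + b) / 2) \<le> w"
  proof -
    have "(\<alpha> + \<gamma>) * (a + b) \<le> 0" using m bw by (simp add: mult_nonpos_nonneg)
    then have "w * (1 + (\<alpha> + \<gamma>) * (a + b) / 2) \<le> w * 1" using w by (intro mult_left_mono) auto
    then show ?thesis using bw by simp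
  qed
  note h = half_le_bound[OF w]
  show ?thesis
  proof (rule ccontr)
    assume "\<not> ?thesis"
    then have e: "w = w\<^sup>2 / (2 * (w - 1))" "measure lborel K = (b - a) * (1 + (\<alpha> + \<gamma>) * (a + b) / 2)"
      "(b - a) * (1 + (\<alpha> + \<gamma>) * (a + b) / 2) = w"
      using ub s h(1) by linarith+
    have w2: "w = 2" using h(2) e by simp
    have "w * ((\<alpha> + \<gamma>) * (a + b)) = 0" using e(3) bw by (simp add: algebra_simps)
    then have g: "\<gamma> = - \<alpha>" using bw w by auto
    have mem: "p \<in> K \<longleftrightarrow> a \<le> fst p \<and> fst p \<le> b \<and> - \<gamma> * fst p \<le> snd p \<and> snd p \<le> 1 + \<alpha> * fst p" for p
      by (rule linear_region_upper_bound(4)[OF K ab' LR _ _ e(2)]) (use x l0 in auto)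
    have "(1, \<alpha>) \<in> K" "(1, 1 + \<alpha>) \<in> K" using ab g by (auto simp: mem)
    then have "\<alpha> = 0" using l1[of "(1, \<alpha>)"] l1[of "(1, 1 + \<alpha>)"] by simp
    then have "w \<le> 1 - 0" using mem g by (intro wideD[OF bodyD(4)[OF K], of 0 0 1 1]) auto
    then show False using w2 by simp
  qed
qed

lemma has_integral_min_lines:
  assumes "a \<le> t" "t \<le> b" "m * t = n * (1 - t)" "m + n \<ge> 0"
  shows "((\<lambda>x. min (1 + m * x) (1 + n * (1 - x))) has_integral
    (t - a + m * (t\<^sup>2 - a\<^sup>2) / 2 + ((1 + n) * (b - t) - n * (b\<^sup>2 - t\<^sup>2) / 2))) {a..b::real}"
proof (rule has_integral_combine[OF assms(1,2)])
  have l: "m * x \<le> n * (1 - x)" if "x \<le> t" for x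
  proof -
    have "(m + n) * x \<le> (m + n) * t" using that assms(4) by (intro mult_left_mono)
    then show ?thesis using assms(3) by (simp add: algebra_simps)
  qed
  have "((\<lambda>x. 1 + m * x) has_integral t - a + m * (t\<^sup>2 - a\<^sup>2) / 2) {a..t}"
    using has_integral_linear_fun[OF assms(1), of 1 m] by simp
  then show "((\<lambda>x. min (1 + m * x) (1 + n * (1 - x))) has_integral t - a + m * (t\<^sup>2 - a\<^sup>2) / 2) {a..t}"
    by (rule has_integral_eq[rotated]) (use l in auto)
  have r: "m * x \<ge> n * (1 - x)" if "x \<ge> t" for x
  proof -
    have "(m + n) * x \<ge> (m + n) * t" using that assms(4) by (intro mult_left_mono)
    then show ?thesis using assms(3) by (simp add: algebra_simps)
  qed
  have "((\<lambda>x. (1 + n) + - n * x) has_integral (1 + n) * (b - t) - n * (b\<^sup>2 - t\<^sup>2) / 2) {t..b}"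
    using has_integral_linear_fun[OF assms(2), of "1 + n" "- n"] by simp
  then show "((\<lambda>x. min (1 + m * x) (1 + n * (1 - x))) has_integral (1 + n) * (b - t) - n * (b\<^sup>2 - t\<^sup>2) / 2) {t..b}"
  proof (rule has_integral_eq[rotated])
    fix x assume "x \<in> {t..b}"
    then show "(1 + n) + - n * x = min (1 + m * x) (1 + n * (1 - x))"
      using r[of x] by (simp add: min_def algebra_simps)
  qed
qed

lemma upper_bound_two_integers:
  assumes K: "body K w" and w: "1 < w" "w \<le> 2"
    and ab: "b = a + w" "a < 0" "1 < b"
    and LR: "L \<in> K" "fst L = a" "R \<in> K" "fst R = b"
    and x: "\<And>p. p \<in> K \<Longrightarrow> a \<le> fst p \<and> fst p \<le> b"
    and l0: "\<And>p. p \<in> K \<Longrightarrow> - \<gamma> * fst p \<le> snd p \<and> snd p \<le> 1 + \<alpha> * fst p"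
    and l1: "\<And>p. p \<in> K \<Longrightarrow> - \<delta> * (1 - fst p) \<le> snd p \<and> snd p \<le> 1 + \<beta> * (1 - fst p)"
  shows "measure lborel K \<le> w\<^sup>2 / (2 * (w - 1)) \<and>
    (measure lborel K = w\<^sup>2 / (2 * (w - 1)) \<longrightarrow> cross_shape K w)"
proof -
  define m n where "m = \<alpha> + \<gamma>" and "n = \<beta> + \<delta>"
  consider "m \<le> 0" | "n \<le> 0" | "m > 0" "n > 0" by linarith
  then show ?thesis
  proof cases
    case 1
    then show ?thesis using upper_bound_two_integers_monotone[OF K w ab LR x l0 l1] by (simp add: m_def)
  next
    case 2
    note fl = umap_imp_iaff[OF umap_xflip[of 1]]
    have LR': "(a, snd L) \<in> K" "(b, snd R) \<in> K" using LR by (metis prod.collapse)+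
    have "measure lborel (xflip 1 ` K) < w\<^sup>2 / (2 * (w - 1))"
    proof (rule upper_bound_two_integers_monotone[of _ w "1 - a" "1 - b" "(1 - b, snd R)" "(1 - a, snd L)" \<delta> \<beta> \<gamma> \<alpha>])
      show "body (xflip 1 ` K) w" by (rule body_iaff[OF K fl])
      show "- \<delta> * fst p \<le> snd p \<and> snd p \<le> 1 + \<beta> * fst p" if "p \<in> xflip 1 ` K" for p
        using l1[of "(1 - fst p, snd p)"] that by (auto simp: mem_xflip)
      show "- \<gamma> * (1 - fst p) \<le> snd p \<and> snd p \<le> 1 + \<alpha> * (1 - fst p)" if "p \<in> xflip 1 ` K" for p
        using l0[of "(1 - fst p, snd p)"] that by (auto simp: mem_xflip)
      show "1 - b \<le> fst p \<and> fst p \<le> 1 - a" if "p \<in> xflip 1 ` K" for p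
        using x[of "(1 - fst p, snd p)"] that by (auto simp: mem_xflip)
    qed (use w ab LR' 2 in \<open>auto simp: mem_xflip n_def\<close>)
    then show ?thesis using body_measure[OF K fl] by simp
  next
    case 3
    define p q t where "p = - a" and "q = b - 1" and "t = n / (m + n)"
    have pq: "p > 0" "q > 0" "p + q = w - 1" using ab by (auto simp: p_def q_def)
    have t: "0 < t" "t < 1" "m * t = n * (1 - t)" using 3 by (auto simp: t_def field_simps)
    have mp: "m * p \<le> 1" using l0[OF LR(1)] LR by (simp add: m_def p_def algebra_simps)
    have nq: "n * q \<le> 1" using l1[OF LR(3)] LR by (simp add: n_def q_def algebra_simps)
    define I where "I = w - m * p\<^sup>2 / 2 - n * q\<^sup>2 / 2 + m * n / (m + n) / 2"
    note num = two_integer_numeric[OF pq w(2) 3 mp nq, folded I_def]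
    define lo up bd :: "real \<Rightarrow> real" where "lo x = max (- \<gamma> * x) (- \<delta> * (1 - x))"
      and "up x = min (1 + \<alpha> * x) (1 + \<beta> * (1 - x))" and "bd x = min (1 + m * x) (1 + n * (1 - x))" for x
    have cont: "continuous_on S lo" "continuous_on S up" "continuous_on S bd" for S
      unfolding lo_def up_def bd_def by (intro continuous_intros)+
    have le_bd: "up x - lo x \<le> bd x" for x
      unfolding lo_def up_def bd_def m_def n_def by (simp add: algebra_simps) linarith
    have hi: "(bd has_integral I) {a..b}"
    proof -
      have "t - a + m * (t\<^sup>2 - a\<^sup>2) / 2 + ((1 + n) * (b - t) - n * (b\<^sup>2 - t\<^sup>2) / 2) = I"
      proof -
        have at: "a = - p" "b = 1 + q" "w = 1 + p + q" using pq by (auto simp: p_def q_def)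
        have tt: "m * n / (m + n) = n * (1 - t)" using 3 by (simp add: t_def field_simps)
        have "t * (m * t) = t * (n * (1 - t))" using t(3) by simp
        then have "m * (t * t) + n * (t * t) = n * t" by (simp add: algebra_simps)
        then show ?thesis unfolding I_def tt at
          by (simp add: field_simps power2_eq_square)
      qed
      then show ?thesis unfolding bd_def using has_integral_min_lines[of a t b m n] t ab 3 by simp
    qed
    have inP: "lo (fst z) \<le> snd z \<and> snd z \<le> up (fst z)" if "z \<in> K" for z
      using l0[OF that] l1[OF that] by (auto simp: lo_def up_def)
    have lu: "lo y \<le> up y" if y: "y \<in> {a..b}" for y
    proof -
      have "convex (fst ` K)" using bodyD(2)[OF K] by (rule convex_linear_image[OF linear_fst])
      moreover have "a \<in> fst ` K" "b \<in> fst ` K" using LR by (metis image_eqI)+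
      ultimately have "closed_segment a b \<subseteq> fst ` K" by (intro closed_segment_subset)
      then obtain z where "z \<in> K" "fst z = y" using y ab by (auto simp: closed_segment_eq_real_ivl)
      then show ?thesis using inP[of z] by auto
    qed
    define P where "P = {z. a \<le> fst z \<and> fst z \<le> b \<and> lo (fst z) \<le> snd z \<and> snd z \<le> up (fst z)}"
    have KP: "K \<subseteq> P" using inP x by (auto simp: P_def)
    have cP: "compact P" unfolding P_def by (rule compact_region[OF cont(1,2)])
    have vP: "convex P"
    proof -
      have eq: "P = {z. a \<le> fst z \<and> fst z \<le> b \<and> 0 + - \<gamma> * fst z \<le> snd z \<and> snd z \<le> 1 + \<alpha> * fst z} \<inter>
        {z. a \<le> fst z \<and> fst z \<le> b \<and> - \<delta> + \<delta> * fst z \<le> snd z \<and> snd z \<le> (1 + \<beta>) + - \<beta> * fst z}"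
        unfolding P_def lo_def up_def by (auto simp: algebra_simps)
      show ?thesis unfolding eq by (intro convex_Int convex_linear_region)
    qed
    have int: "(\<lambda>x. up x - lo x) integrable_on {a..b}"
      by (intro integrable_continuous_interval continuous_intros cont)
    have mP: "measure lborel P = integral {a..b} (\<lambda>x. up x - lo x)"
      unfolding P_def by (rule measure_region[OF cont(1,2) lu integrable_integral[OF int]])
    have PI: "measure lborel P \<le> I"
      unfolding mP by (rule has_integral_le[OF integrable_integral[OF int] hi le_bd])
    have KmP: "measure lborel K \<le> measure lborel P"
      by (intro measure_mono_compact KP cP bodyD[OF K])
    have "cross_shape K w" if E: "measure lborel K = w\<^sup>2 / (2 * (w - 1))"
    proof -
      have "P = K"
      proof (rule eq_if_measure_le[symmetric, OF bodyD(5)[OF K] KP cP vP])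
        show "interior P \<noteq> {}" using bodyD(3)[OF K] interior_mono[OF KP] by blast
      qed (use KmP PI E num(1) in linarith)
      have Ie: "I = w\<^sup>2 / (2 * (w - 1))" "measure lborel P = I" using KmP PI E num(1) by linarith+
      note eq = num(2)[OF Ie(1)]
      have "((\<lambda>x. bd x - (up x - lo x)) has_integral I - I) {a..b}"
        using has_integral_diff[OF hi integrable_integral[OF int]] Ie mP by simp
      then have h0: "((\<lambda>x. bd x - (up x - lo x)) has_integral 0) (cbox a b)" by simp
      have tight: "up x - lo x = bd x" if "x \<in> {a..b}" for x
      proof -
        have "bd x - (up x - lo x) = 0"
          by (rule has_integral_0_cbox_imp_0[OF _ _ h0])
            (use le_bd that ab in \<open>auto intro!: continuous_intros cont\<close>)
        then show ?thesis by simp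
      qed
      have t0: "up 0 - lo 0 = bd 0" "up 1 - lo 1 = bd 1" "up t - lo t = bd t"
        using ab t by (auto intro!: tight)
      have pos: "\<alpha> \<ge> 0" "\<beta> \<ge> 0" "\<gamma> \<ge> 0" "\<delta> \<ge> 0"
        using t0(1,2) 3 unfolding up_def lo_def bd_def by (auto simp: min_def max_def split: if_splits)
      have tt: "\<alpha> * t = \<beta> * (1 - t)" "\<gamma> * t = \<delta> * (1 - t)"
      proof -
        have "m * t = \<alpha> * t + \<gamma> * t" "n * (1 - t) = \<beta> * (1 - t) + \<delta> * (1 - t)"
          by (auto simp: m_def n_def algebra_simps)
        then show "\<alpha> * t = \<beta> * (1 - t)" "\<gamma> * t = \<delta> * (1 - t)"
          using t0(3) t(3) unfolding up_def lo_def bd_def by (auto simp: min_def max_def split: if_splits)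
      qed
      have mpnq: "m * p = n * q" using eq by simp
      have upt: "up y \<le> 1 + \<alpha> * t" "lo y \<ge> - \<gamma> * t" for y
      proof -
        have "\<alpha> * y \<le> \<alpha> * t \<and> \<gamma> * y \<le> \<gamma> * t \<or> \<beta> * (1 - y) \<le> \<beta> * (1 - t) \<and> \<delta> * (1 - y) \<le> \<delta> * (1 - t)"
          using pos by (cases "y \<le> t") (auto intro: mult_left_mono)
        then show "up y \<le> 1 + \<alpha> * t" "lo y \<ge> - \<gamma> * t" unfolding up_def lo_def using tt by auto
      qed
      have "t * (m * p + n * p) = n * p" using 3 by (simp add: t_def field_simps)
      then have "t * n * (p + q) = n * p" unfolding mpnq by (simp add: algebra_simps)
      then have tpq: "t * (p + q) = p" using 3 by simp
      then have tpq': "(1 - t) * (p + q) = q" by (simp add: algebra_simps)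
      have mp1: "m * p = 1"
      proof (cases "w < 2")
        case False
        then have "w = 2" using w by simp
        have "w \<le> (1 + \<alpha> * t) - (- \<gamma> * t)"
        proof (rule wideD[OF bodyD(4)[OF K], of _ 0 1])
          fix z assume "z \<in> K"
          from inP[OF this] upt[of "fst z"]
          show "- \<gamma> * t \<le> of_int 0 * fst z + of_int 1 * snd z \<and> of_int 0 * fst z + of_int 1 * snd z \<le> 1 + \<alpha> * t"
            by simp
        qed simp
        moreover have "t = p" using tpq pq \<open>w = 2\<close> by simp
        ultimately show ?thesis using mp \<open>w = 2\<close> by (simp add: m_def algebra_simps)
      qed (use eq in simp)
      have ap: "\<alpha> * p = \<beta> * q" "\<gamma> * p = \<delta> * q"
      proof -
        have "\<alpha> * p = \<alpha> * t * (p + q)" using tpq by (simp add: mult.assoc)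
        also have "\<dots> = \<beta> * q" unfolding tt mult.assoc tpq' ..
        finally show "\<alpha> * p = \<beta> * q" .
        have "\<gamma> * p = \<gamma> * t * (p + q)" using tpq by (simp add: mult.assoc)
        also have "\<dots> = \<delta> * q" unfolding tt mult.assoc tpq' ..
        finally show "\<gamma> * p = \<delta> * q" .
      qed
      have gp: "\<gamma> * p = 1 - \<alpha> * p" using mp1 by (simp add: m_def algebra_simps)
      have y0: "0 \<le> 1 - \<alpha> * p" "1 - \<alpha> * p \<le> 1" 
      proof -
        have "\<gamma> * p \<ge> 0" "\<alpha> * p \<ge> 0" using pos pq by auto
        then show "0 \<le> 1 - \<alpha> * p" "1 - \<alpha> * p \<le> 1" using gp by linarith+
      qed
      have len: "- \<gamma> * t + w / (w - 1) = 1 + \<alpha> * t"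
      proof -
        have "m * t * (p + q) = 1" using tpq mp1 by (simp add: mult.assoc)
        then have "w / (w - 1) = 1 + m * t" using pq w by (simp add: field_simps)
        then show ?thesis by (simp add: m_def algebra_simps)
      qed
      have memK: "z \<in> K \<longleftrightarrow> a \<le> fst z \<and> fst z \<le> b \<and> lo (fst z) \<le> snd z \<and> snd z \<le> up (fst z)" for z
        unfolding \<open>P = K\<close>[symmetric] P_def by simp
      have ends: "a + w = b" "a = - p" "b = 1 + q" using ab by (auto simp: p_def q_def)
      have np: "\<beta> * (1 + p) \<ge> 0" "\<delta> * (1 + p) \<ge> 0" "\<alpha> * (1 + q) \<ge> 0" "\<gamma> * (1 + q) \<ge> 0"
         "\<alpha> * t \<ge> 0" "\<gamma> * t \<ge> 0" "\<alpha> * p \<ge> 0" "\<gamma> * p \<ge> 0"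
        using pos pq t by auto
      show ?thesis
      proof (rule cross_shapeI[OF bodyD(1-3)[OF K] w(1) E, 
          where ?x0.0 = a and ?y0.0 = "1 - \<alpha> * p" and ?x1.0 = t and ?y1.0 = "- \<gamma> * t"], unfold len)
        have ea: "- \<gamma> * a = \<gamma> * p" "- \<delta> * (1 - a) \<le> 0" "1 + \<alpha> * a = 1 - \<alpha> * p" "1 + \<beta> * (1 - a) \<ge> 1"
          using np unfolding ends(2) by simp_all
        show "(a, 1 - \<alpha> * p) \<in> K"
          unfolding memK lo_def up_def fst_conv snd_conv max.bounded_iff min.bounded_iff
          using ea gp y0 ab by linarith
        have eb: "- \<gamma> * b \<le> 0" "- \<delta> * (1 - b) = \<delta> * q" "1 + \<alpha> * b \<ge> 1" "1 + \<beta> * (1 - b) = 1 - \<beta> * q"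
          using np unfolding ends(3) by simp_all
        have "(b, 1 - \<alpha> * p) \<in> K"
          unfolding memK lo_def up_def fst_conv snd_conv max.bounded_iff min.bounded_iff
          using eb gp ap y0 ab by linarith
        then show "(a + w, 1 - \<alpha> * p) \<in> K" by (simp only: ends(1))
        have et: "- \<delta> * (1 - t) = - \<gamma> * t" "1 + \<beta> * (1 - t) = 1 + \<alpha> * t" using tt by simp_all
        show "(t, - \<gamma> * t) \<in> K" "(t, 1 + \<alpha> * t) \<in> K"
          unfolding memK lo_def up_def fst_conv snd_conv max.bounded_iff min.bounded_iff et
          using np t ab by auto
        show "- \<gamma> * t \<le> 1 - \<alpha> * p" "1 - \<alpha> * p \<le> 1 + \<alpha> * t" using np y0 by auto
      qed (use t ab in auto)
    qed
    then show ?thesis using KmP PI num(1) by auto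
  qed
qed

definition normal :: "int \<Rightarrow> int \<Rightarrow> int \<Rightarrow> real \<times> real \<Rightarrow> real \<times> real" where
  "normal i j k = aff (of_int 1) (of_int 0) (of_int (-k)) (of_int 1) (of_int (-i)) (of_int (k * i - j))"

lemma umap_normal: "umap (normal i j k)"
  unfolding normal_def by (rule umapI) simp

lemma mem_normal: "p \<in> normal i j k ` K \<longleftrightarrow> (fst p + of_int i, snd p + of_int j + of_int k * fst p) \<in> K"
proof
  assume "(fst p + of_int i, snd p + of_int j + of_int k * fst p) \<in> K"
  moreover have "p = normal i j k (fst p + of_int i, snd p + of_int j + of_int k * fst p)"
    by (simp add: normal_def prod_eq_iff algebra_simps)
  ultimately show "p \<in> normal i j k ` K" by blast
qed (auto simp: normal_def algebra_simps)

lemma width_attained: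
  assumes K: "body K w" and x: "\<And>p. p \<in> K \<Longrightarrow> a \<le> fst p \<and> fst p \<le> a + w"
  obtains L R where "L \<in> K" "fst L = a" "R \<in> K" "fst R = a + w"
proof -
  obtain L R where "R \<in> K" "L \<in> K" "fst R - fst L \<ge> w"
    using bodyD(4)[OF K, unfolded wide_def, rule_format, of 1 0] by auto
  then show ?thesis using that[of L R] x[of L] x[of R] by auto
qed

lemma upper_bound_le_2:
  assumes K: "body K w" and free: "interior K \<inter> Z2 = {}" and w: "1 < w" "w \<le> 2"
    and x: "\<And>p. p \<in> K \<Longrightarrow> a \<le> fst p \<and> fst p \<le> a + w"
  shows "measure lborel K \<le> w\<^sup>2 / (2 * (w - 1)) \<and>
    (measure lborel K = w\<^sup>2 / (2 * (w - 1)) \<longrightarrow> cross_shape K w)"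
proof -
  define good where "good S \<longleftrightarrow> measure lborel (S ` K) \<le> w\<^sup>2 / (2 * (w - 1)) \<and>
    (measure lborel (S ` K) = w\<^sup>2 / (2 * (w - 1)) \<longrightarrow> cross_shape (S ` K) w)" for S
  have red: ?thesis if "umap S" "good S" for S
  proof -
    have "measure lborel (S ` K) = measure lborel K" using body_measure[OF K umap_imp_iaff[OF that(1)]] .
    then show ?thesis using that(2) cross_shape_umap[OF _ that(1), of K w] unfolding good_def by simp
  qed
  obtain L R where LR: "L \<in> K" "fst L = a" "R \<in> K" "fst R = a + w"
    using width_attained[OF K x] by metis
  define i where "i = \<lfloor>a\<rfloor> + 1"
  have i: "a < of_int i" "of_int i \<le> a + 1" unfolding i_def by linarith+
  note cv = bodyD(2)[OF K] and ne = bodyD(3)[OF K]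
  obtain y where "(of_int i, y) \<in> interior K"
    by (rule interior_on_vertical[OF cv ne LR(1,3)]) (use LR i w in auto)
  from lines_at_integer[OF cv free this]
  obtain j \<alpha> \<gamma> where up: "\<And>q. q \<in> K \<Longrightarrow> snd q \<le> of_int j + 1 + \<alpha> * (fst q - of_int i)"
    and lo: "\<And>q. q \<in> K \<Longrightarrow> of_int j - \<gamma> * (fst q - of_int i) \<le> snd q" by metis
  define a' b' where "a' = a - of_int i" and "b' = a' + w"
  have ab: "a' < 0" "-1 \<le> a'" "0 < b'" "b' = a' + w" using i w by (auto simp: a'_def b'_def)
  have LR': "(a, snd L) \<in> K" "(a + w, snd R) \<in> K" using LR by (metis prod.collapse)+
  then have LRn: "(a', snd L - of_int j - of_int k * a') \<in> normal i j k ` K"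
    "(b', snd R - of_int j - of_int k * b') \<in> normal i j k ` K" for k
    by (auto simp: mem_normal a'_def b'_def algebra_simps)
  have xn: "a' \<le> fst p \<and> fst p \<le> b'" if "p \<in> normal i j k ` K" for p k
    using that[unfolded mem_normal, THEN x] by (auto simp: a'_def b'_def)
  have ln: "- (\<gamma> + of_int k) * fst p \<le> snd p \<and> snd p \<le> 1 + (\<alpha> - of_int k) * fst p"
    if "p \<in> normal i j k ` K" for p k
    using that[unfolded mem_normal, THEN up] that[unfolded mem_normal, THEN lo] by (simp add: algebra_simps)
  note bn = body_iaff[OF K umap_imp_iaff[OF umap_normal]]
  show ?thesis
  proof (cases "b' \<le> 1")
    case True
    let ?K = "normal i j 0 ` K"
    show ?thesis
    proof (cases "0 \<le> a' + b'")
      case c: True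
      have 3: "- \<gamma> * fst p \<le> snd p \<and> snd p \<le> 1 + \<alpha> * fst p" if "p \<in> ?K" for p
        using ln[OF that] by simp
      have "measure lborel ?K \<le> w\<^sup>2 / (2 * (w - 1))"
        "measure lborel ?K = w\<^sup>2 / (2 * (w - 1)) \<Longrightarrow> cross_shape ?K w"
        by (rule upper_bound_one_integer[OF bn w ab(4,1,2,3) True c LRn(1) _ LRn(2) _ xn 3]; simp)+
      then have "good (normal i j 0)" unfolding good_def by blast
      then show ?thesis by (rule red[OF umap_normal])
    next
      case c: False
      let ?M = "xflip 0 ` normal i j 0 ` K"
      note bm = body_iaff[OF bn umap_imp_iaff[OF umap_xflip]]
      have m: "p \<in> ?M \<longleftrightarrow> (- fst p, snd p) \<in> ?K" for p by (simp add: mem_xflip)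
      have 1: "(- b', snd R - of_int j) \<in> ?M" "(- a', snd L - of_int j) \<in> ?M"
        using LRn[of 0] by (auto simp: m)
      have 2: "- b' \<le> fst p \<and> fst p \<le> - a'" if "p \<in> ?M" for p
        using xn[OF that[unfolded m]] by auto
      have 3: "- (- \<gamma>) * fst p \<le> snd p \<and> snd p \<le> 1 + (- \<alpha>) * fst p" if "p \<in> ?M" for p
        using ln[OF that[unfolded m]] by auto
      have "measure lborel ?M \<le> w\<^sup>2 / (2 * (w - 1))"
        "measure lborel ?M = w\<^sup>2 / (2 * (w - 1)) \<Longrightarrow> cross_shape ?M w"
        by (rule upper_bound_one_integer[OF bm w _ _ _ _ _ _ 1(1) _ 1(2) _ 2 3]; use ab True c in simp)+
      then have "good (xflip 0 \<circ> normal i j 0)" unfolding good_def image_comp by blast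
      then show ?thesis by (rule red[OF umap_comp[OF umap_xflip umap_normal]])
    qed
  next
    case False
    have i1: "real_of_int (i + 1) < a + w" using False by (simp add: b'_def a'_def)
    obtain y1 where "(of_int (i + 1), y1) \<in> interior K"
      by (rule interior_on_vertical[OF cv ne LR(1,3)]) (use LR i i1 in auto)
    from lines_at_integer[OF cv free this]
    obtain j1 \<alpha>1 \<gamma>1 where up1: "\<And>q. q \<in> K \<Longrightarrow> snd q \<le> of_int j1 + 1 + \<alpha>1 * (fst q - of_int (i + 1))"
      and lo1: "\<And>q. q \<in> K \<Longrightarrow> of_int j1 - \<gamma>1 * (fst q - of_int (i + 1)) \<le> snd q" by metis
    define k where "k = j1 - j"
    have ln1: "- (- \<gamma>1 - of_int k) * (1 - fst p) \<le> snd p \<and> snd p \<le> 1 + (of_int k - \<alpha>1) * (1 - fst p)"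
      if "p \<in> normal i j k ` K" for p
      using that[unfolded mem_normal, THEN up1] that[unfolded mem_normal, THEN lo1]
      by (simp add: algebra_simps k_def)
    have "good (normal i j k)"
      unfolding good_def
      by (rule upper_bound_two_integers[OF bn w ab(4,1) _ LRn(1) _ LRn(2) _ xn ln ln1]) (use False in auto)
    then show ?thesis by (rule red[OF umap_normal])
  qed
qed

subsection \<open>Lattice width greater than 2\<close>

lemma four_lines_width:
  assumes K: "body K w" and pos: "\<alpha> > 0" "\<beta> > 0" "\<gamma> \<ge> 0" "\<delta> \<ge> 0"
    and l: "\<And>p. p \<in> K \<Longrightarrow> snd p \<le> 1 + \<alpha> * fst p" "\<And>p. p \<in> K \<Longrightarrow> snd p \<le> 1 + \<beta> * (1 - fst p)"
     "\<And>p. p \<in> K \<Longrightarrow> - \<gamma> * fst p \<le> snd p" "\<And>p. p \<in> K \<Longrightarrow> - \<delta> * (1 - fst p) \<le> snd p"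
  shows "w \<le> 2"
proof (rule ccontr)
  assume "\<not> w \<le> 2"
  define m n S1 S2 where "m = \<alpha> + \<gamma>" and "n = \<beta> + \<delta>" and "S1 = \<alpha> + \<beta>" and "S2 = \<gamma> + \<delta>"
  have p: "m > 0" "n > 0" "S1 > 0" "S2 \<ge> 0" using pos by (auto simp: m_def n_def S1_def S2_def)
  have "w \<le> (1 + 1/n) - (- 1/m)"
  proof (rule wideD[OF bodyD(4)[OF K], of _ 1 0])
    fix p assume "p \<in> K"
    from l[OF this] have "0 \<le> 1 + m * fst p" "0 \<le> 1 + n * (1 - fst p)"
      by (auto simp: m_def n_def algebra_simps)
    then have "- 1/m \<le> fst p" "fst p \<le> 1 + 1/n" using p by (simp_all add: field_simps)
    then show "- 1/m \<le> of_int 1 * fst p + of_int 0 * snd p \<and> of_int 1 * fst p + of_int 0 * snd p \<le> 1 + 1/n" by simp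
  qed simp
  then have w1: "w - 1 \<le> (m + n) / (m * n)" using p by (simp add: field_simps)
  have "w \<le> (1 + \<alpha> * \<beta> / S1) - (- (\<gamma> * \<delta> / S2))"
  proof (rule wideD[OF bodyD(4)[OF K], of _ 0 1])
    fix p assume pK: "p \<in> K"
    have "\<beta> * snd p + \<alpha> * snd p \<le> \<beta> * (1 + \<alpha> * fst p) + \<alpha> * (1 + \<beta> * (1 - fst p))"
      using l[OF pK] pos by (intro add_mono mult_left_mono) auto
    then have u: "snd p \<le> 1 + \<alpha> * \<beta> / S1" using p(3) by (simp add: S1_def field_simps)
    have lo: "- (\<gamma> * \<delta> / S2) \<le> snd p"
    proof (cases "S2 = 0")
      case True
      then have "\<gamma> = 0" using pos unfolding S2_def by linarith
      then show ?thesis using l(3)[OF pK] True by simp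
    next
      case False
      have "\<delta> * snd p + \<gamma> * snd p \<ge> \<delta> * (- \<gamma> * fst p) + \<gamma> * (- \<delta> * (1 - fst p))"
        using l[OF pK] pos by (intro add_mono mult_left_mono) auto
      then have "S2 * snd p \<ge> - (\<gamma> * \<delta>)" by (simp add: S2_def algebra_simps)
      then show ?thesis using False p(4) by (simp add: field_simps)
    qed
    show "- (\<gamma> * \<delta> / S2) \<le> of_int 0 * fst p + of_int 1 * snd p \<and> of_int 0 * fst p + of_int 1 * snd p \<le> 1 + \<alpha> * \<beta> / S1"
      using u lo by simp
  qed simp
  moreover have "\<alpha> * \<beta> / S1 + \<gamma> * \<delta> / S2 \<le> m * n / (m + n)"
  proof (cases "S2 = 0")
    case True
    then have "\<gamma> = 0" "\<delta> = 0" using pos by (auto simp: S2_def)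
    then show ?thesis by (simp add: m_def n_def S1_def)
  next
    case False
    have S: "m + n = S1 + S2" "S2 > 0" using False p by (auto simp: m_def n_def S1_def S2_def)
    have "m * n * (S1 * S2) - (\<alpha> * \<beta> * S2 + \<gamma> * \<delta> * S1) * (S1 + S2) = (\<alpha> * \<delta> - \<beta> * \<gamma>)\<^sup>2"
      by (simp add: m_def n_def S1_def S2_def algebra_simps power2_eq_square)
    then have "(\<alpha> * \<beta> * S2 + \<gamma> * \<delta> * S1) * (S1 + S2) \<le> m * n * (S1 * S2)"
      using zero_le_power2[of "\<alpha> * \<delta> - \<beta> * \<gamma>"] by linarith
    then have "(\<alpha> * \<beta> * S2 + \<gamma> * \<delta> * S1) / (S1 * S2) \<le> m * n / (S1 + S2)"
      using p(3) S(2) by (simp add: divide_le_eq le_divide_eq mult.commute)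
    moreover have "(\<alpha> * \<beta> * S2 + \<gamma> * \<delta> * S1) / (S1 * S2) = \<alpha> * \<beta> / S1 + \<gamma> * \<delta> / S2"
      using p(3) S(2) by (simp add: add_divide_distrib)
    ultimately show ?thesis unfolding S(1) by simp
  qed
  ultimately have w2: "w - 1 \<le> m * n / (m + n)" by simp
  have "(w - 1) * (w - 1) \<le> (m + n) / (m * n) * (m * n / (m + n))"
    using w1 w2 p \<open>\<not> w \<le> 2\<close> by (intro mult_mono) auto
  also have "\<dots> = 1" using p by simp
  finally have "(w - 1) * (w - 1) \<le> 1" .
  moreover have "(w - 1) * (w - 1) > 1 * 1" using \<open>\<not> w \<le> 2\<close> by (intro mult_strict_mono) auto
  ultimately show False by simp
qed

lemma free_not_interior:
  "interior K \<inter> Z2 = {} \<Longrightarrow> (of_int i, of_int j) \<notin> interior K"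
  by (auto simp: Z2_def)

lemma four_sides_width:
  assumes K: "body K w" and free: "interior K \<inter> Z2 = {}"
    and p: "(0, y0) \<in> interior K" "(1, y1) \<in> interior K" "(xt, 1) \<in> interior K" "(xb, 0) \<in> interior K"
    and lim: "0 < y0" "y0 < 1" "0 < y1" "y1 < 1" "0 < xt" "xt < 1" "0 < xb" "xb < 1"
  shows "w \<le> 2"
proof -
  note Z = free_not_interior[OF free]
  have Z': "(0, 0) \<notin> interior K" "(0, 1) \<notin> interior K" "(1, 0) \<notin> interior K" "(1, 1) \<notin> interior K"
    using Z[of 0 0] Z[of 0 1] Z[of 1 0] Z[of 1 1] by auto
  note cv = bodyD(2)[OF K]
  obtain \<alpha> where a: "\<And>q. q \<in> K \<Longrightarrow> snd q \<le> 1 + \<alpha> * (fst q - 0)"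
    "\<And>q. q \<in> interior K \<Longrightarrow> snd q < 1 + \<alpha> * (fst q - 0)"
    using line_above[OF cv p(1) lim(2) Z'(2)] by blast
  obtain \<beta> where b: "\<And>q. q \<in> K \<Longrightarrow> snd q \<le> 1 + \<beta> * (fst q - 1)"
    "\<And>q. q \<in> interior K \<Longrightarrow> snd q < 1 + \<beta> * (fst q - 1)"
    using line_above[OF cv p(2) lim(4) Z'(4)] by blast
  obtain \<gamma> where c: "\<And>q. q \<in> K \<Longrightarrow> 0 - \<gamma> * (fst q - 0) \<le> snd q"
    "\<And>q. q \<in> interior K \<Longrightarrow> 0 - \<gamma> * (fst q - 0) < snd q"
    using line_below[OF cv p(1) lim(1) Z'(1)] by blast
  obtain \<delta> where d: "\<And>q. q \<in> K \<Longrightarrow> 0 - \<delta> * (fst q - 1) \<le> snd q"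
    "\<And>q. q \<in> interior K \<Longrightarrow> 0 - \<delta> * (fst q - 1) < snd q"
    using line_below[OF cv p(2) lim(3) Z'(3)] by blast
  have "\<alpha> > 0" using a(2)[OF p(3)] lim by (simp add: zero_less_mult_iff)
  moreover have "0 < \<beta> * (xt - 1)" using b(2)[OF p(3)] by simp
  then have "- \<beta> > 0" using lim by (simp add: zero_less_mult_iff)
  moreover have "\<gamma> > 0" using c(2)[OF p(4)] lim by (simp add: zero_less_mult_iff)
  moreover have "0 < \<delta> * (xb - 1)" using d(2)[OF p(4)] by simp
  then have "- \<delta> > 0" using lim by (simp add: zero_less_mult_iff)
  ultimately show ?thesis
    using four_lines_width[OF K, of \<alpha> "- \<beta>" \<gamma> "- \<delta>"] a(1) b(1) c(1) d(1) by (auto simp: algebra_simps)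
qed

definition lam :: "real \<Rightarrow> real" where
  "lam w = (3 * w + 1 - sqrt (1 + 6 * w - 3 * w\<^sup>2)) / (6 * w)"

lemma triangle_numeric:
  assumes w: "w > 2" and a: "a \<le> 1" "b \<le> 1" "c \<le> 1" and D: "D = a*b*c + (1-a)*(1-b)*(1-c)" "D > 0"
    and x: "w * D \<le> a" "w * D \<le> b" "w * D \<le> c" and s: "a + b \<ge> 1" "b + c \<ge> 1" "a + c \<ge> 1"
  shows "lam w \<le> w * D" "w * D = lam w \<Longrightarrow> a = lam w \<and> b = lam w \<and> c = lam w" "0 < lam w"
proof -
  have half: "q > 1/2" if q: "D = p*q*r + (1-p)*(1-q)*(1-r)" "w * D \<le> q" "p + q \<ge> 1" "q + r \<ge> 1" for p q r
  proof (rule ccontr)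
    assume q2: "\<not> q > 1/2"
    define e f where "e = p - (1 - q)" and "f = r - (1 - q)"
    have ef: "e \<ge> 0" "f \<ge> 0" using q by (auto simp: e_def f_def)
    have "D = q * (1 - q) + e * f" unfolding q(1) e_def f_def by (simp add: algebra_simps)
    then have "D \<ge> q * (1 - q)" using ef by simp
    then have "w * (q * (1 - q)) \<le> w * D" using w by (intro mult_left_mono) auto
    then have 1: "q * (w * (1 - q)) \<le> q * 1" using q(2) by (simp add: algebra_simps)
    have "0 < w * D" using w D by simp
    then have "q > 0" using q(2) by linarith
    then have "w * (1 - q) \<le> 1" using 1 by (subst (asm) mult_le_cancel_left_pos) auto
    moreover have "w * (1 - q) \<ge> w * (1/2)" using w q2 by (intro mult_left_mono) auto
    ultimately show False using w by simp
  qed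
  have h: "a > 1/2" "b > 1/2" "c > 1/2"
  proof -
    have "D = b*a*c + (1-b)*(1-a)*(1-c)" "D = a*c*b + (1-a)*(1-c)*(1-b)" using D(1) by (simp_all add: algebra_simps)
    from half[OF this(1) x(1)] half[OF D(1) x(2)] half[OF this(2) x(3)] s
    show "a > 1/2" "b > 1/2" "c > 1/2" by (simp_all add: add.commute)
  qed
  define e f g \<xi> where "e = a - 1/2" and "f = b - 1/2" and "g = c - 1/2" and "\<xi> = w * D - 1/2"
  have abc: "a = e + 1/2" "b = f + 1/2" "c = g + 1/2" by (auto simp: e_def f_def g_def)
  have pos: "e > 0" "f > 0" "g > 0" using h by (auto simp: abc)
  have De: "D = 1/4 + (e*f + f*g + e*g)" unfolding D(1) abc by (simp add: field_simps)
  moreover have "e*f + f*g + e*g > 0" using pos by (intro add_pos_pos mult_pos_pos)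
  ultimately have "D > 1/4" by linarith
  then have "w * D > 2 * (1/4)" using w by (intro mult_strict_mono) auto
  then have \<xi>: "\<xi> > 0" by (simp add: \<xi>_def)
  have le: "\<xi> \<le> e" "\<xi> \<le> f" "\<xi> \<le> g" using x by (auto simp: \<xi>_def e_def f_def g_def)
  have D3: "D \<ge> 1/4 + 3 * \<xi>\<^sup>2"
  proof -
    have "\<xi> * \<xi> \<le> e * f" "\<xi> * \<xi> \<le> f * g" "\<xi> * \<xi> \<le> e * g" using le \<xi> pos by (auto intro!: mult_mono)
    then show ?thesis unfolding De by (simp add: power2_eq_square)
  qed
  define X where "X = w * D"
  have Xw: "w * (1/4 + 3 * (X - 1/2)\<^sup>2) \<le> X"
  proof -
    have "w * (1/4 + 3 * \<xi>\<^sup>2) \<le> w * D" using D3 w by (intro mult_left_mono) auto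
    then show ?thesis by (simp add: X_def \<xi>_def)
  qed
  define s where "s = 1 + 6 * w - 3 * w\<^sup>2"
  have lam_s: "lam w = (3 * w + 1 - sqrt s) / (6 * w)" by (simp only: lam_def s_def)
  have id: "(6 * w * X - (3 * w + 1))\<^sup>2 - s = 12 * w * (w * (1/4 + 3 * (X - 1/2)\<^sup>2) - X)"
    by (simp add: s_def power2_eq_square field_simps)
  have "12 * w * (w * (1/4 + 3 * (X - 1/2)\<^sup>2) - X) \<le> 0"
    using Xw w by (intro mult_nonneg_nonpos) auto
  then have sq: "(6 * w * X - (3 * w + 1))\<^sup>2 \<le> s" using id by linarith
  then have "\<bar>6 * w * X - (3 * w + 1)\<bar> \<le> sqrt s" by (metis real_le_rsqrt real_sqrt_abs real_sqrt_le_mono)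
  then have "6 * w * X \<ge> 3 * w + 1 - sqrt s" by linarith
  then show "lam w \<le> w * D" using w by (simp add: lam_s X_def field_simps)
  have s0: "s \<ge> 0" using sq zero_le_power2[of "6 * w * X - (3 * w + 1)"] by linarith
  have "s < (3 * w + 1)\<^sup>2" using w by (simp add: s_def power2_eq_square algebra_simps add_pos_pos)
  then have "sqrt s < 3 * w + 1" using w by (intro real_less_lsqrt) auto
  then show "0 < lam w" using w by (simp add: lam_s)
  assume E: "w * D = lam w"
  then have "6 * w * X - (3 * w + 1) = - sqrt s" using w by (simp add: X_def lam_s)
  then have "(6 * w * X - (3 * w + 1))\<^sup>2 = s" using s0 by simp
  then have "w * (1/4 + 3 * (X - 1/2)\<^sup>2) = X" using id w by simp
  then have "w * (1/4 + 3 * \<xi>\<^sup>2) = w * D" by (simp add: X_def \<xi>_def)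
  then have D4: "D = 1/4 + 3 * \<xi>\<^sup>2" using w by simp
  define e' f' g' where "e' = e - \<xi>" and "f' = f - \<xi>" and "g' = g - \<xi>"
  have e': "e = e' + \<xi>" "f = f' + \<xi>" "g = g' + \<xi>" "e' \<ge> 0" "f' \<ge> 0" "g' \<ge> 0" using le by (auto simp: e'_def f'_def g'_def)
  have "D - (1/4 + 3 * \<xi>\<^sup>2) = 2 * \<xi> * (e' + f' + g') + (e'*f' + f'*g' + e'*g')"
    unfolding De e'(1-3) by (simp add: power2_eq_square algebra_simps)
  moreover have "e'*f' + f'*g' + e'*g' \<ge> 0" using e' by simp
  moreover have "2 * \<xi> * (e' + f' + g') \<ge> 0" using e' \<xi> by simp
  ultimately have "2 * \<xi> * (e' + f' + g') = 0" using D4 by linarith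
  then have "e' + f' + g' = 0" using \<xi> by simp
  then have "e' = 0" "f' = 0" "g' = 0" using e' by linarith+
  then show "a = lam w \<and> b = lam w \<and> c = lam w" using E by (simp add: abc e' \<xi>_def)
qed

definition pivot_triangle :: "(real \<times> real) set \<Rightarrow> real \<Rightarrow> bool" where
  "pivot_triangle K l \<longleftrightarrow> (\<exists>q0 q1 q2. \<not> collinear {q0, q1, q2} \<and> K = convex hull {q0, q1, q2}
               \<and> l *\<^sub>R q1 + (1 - l) *\<^sub>R q2 \<in> Z2
               \<and> l *\<^sub>R q2 + (1 - l) *\<^sub>R q0 \<in> Z2
               \<and> l *\<^sub>R q0 + (1 - l) *\<^sub>R q1 \<in> Z2)"

lemma collinear_cross:
  assumes "collinear {p, q, r}" shows "cross p q r = 0"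
proof -
  obtain u where u: "\<forall>x\<in>{p,q,r}. \<forall>y\<in>{p,q,r}. \<exists>c. x - y = c *\<^sub>R u"
    using assms unfolding collinear_def by blast
  then obtain c d where "q - p = c *\<^sub>R u" "r - p = d *\<^sub>R u" by blast
  then have "fst q - fst p = c * fst u" "snd q - snd p = c * snd u" "fst r - fst p = d * fst u" "snd r - snd p = d * snd u"
    by (metis fst_diff fst_scaleR real_scaleR_def, metis snd_diff snd_scaleR real_scaleR_def,
        metis fst_diff fst_scaleR real_scaleR_def, metis snd_diff snd_scaleR real_scaleR_def)
  then show ?thesis unfolding cross_def by simp
qed

lemma hull_linear_bounds:
  assumes "p \<in> convex hull S" "\<And>q. q \<in> S \<Longrightarrow> lo \<le> m * fst q + n * snd q \<and> m * fst q + n * snd q \<le> hi"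
  shows "lo \<le> m * fst p + n * snd p \<and> m * fst p + n * snd p \<le> (hi::real)"
proof -
  have "convex hull S \<subseteq> {q. (m, n) \<bullet> q \<ge> lo} \<inter> {q. (m, n) \<bullet> q \<le> hi}"
    by (intro hull_minimal convex_Int convex_halfspace_le convex_halfspace_ge)
      (use assms(2) in \<open>auto simp: inner_prod_def\<close>)
  then show ?thesis using assms(1) by (auto simp: inner_prod_def)
qed

definition tri_bound :: "real \<Rightarrow> real" where
  "tri_bound w = 3 * w\<^sup>2 / (3 * w + 1 - sqrt (1 + 6 * w - 3 * w\<^sup>2))"

lemma tri_bound_lam: "w > 0 \<Longrightarrow> tri_bound w = w / (2 * lam w)"
proof -
  assume "w > 0"
  then have "3 * w\<^sup>2 / N = w / (2 * (N / (6 * w)))" for N by (simp add: field_simps power2_eq_square)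
  then show ?thesis unfolding tri_bound_def lam_def .
qed

lemma pivot_solve:
  fixes a b c u v r :: real
  assumes "a * v + (1 - a) * r = e1" "b * u + (1 - b) * v = e2" "c * r + (1 - c) * u = e3"
  shows "(a*b*c + (1-a)*(1-b)*(1-c)) * r = a * b * e3 - a * (1 - c) * e2 + (1 - b) * (1 - c) * e1"
    "(a*b*c + (1-a)*(1-b)*(1-c)) * u = a * c * e2 - c * (1 - b) * e1 + (1 - a) * (1 - b) * e3"
    "(a*b*c + (1-a)*(1-b)*(1-c)) * v = b * c * e1 - (1 - a) * b * e3 + (1 - a) * (1 - c) * e2"
  unfolding assms[symmetric] by (simp_all add: algebra_simps)

text \<open>D is the determinant of the barycentric coordinates of the lattice points (0,0), (0,1), (1,1),
  so the triangle has area 1 / (2 D); its widths in the directions y - x, x and y are a / D, b / D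
  and c / D.\<close>
lemma triangle_area_bound:
  assumes K: "body K w" and w: "w > 2" and KH: "K \<subseteq> convex hull {U, V, R}"
    and a: "0 < a" "a < 1" "0 < b" "b < 1" "0 < c" "c < 1"
    and p: "a *\<^sub>R V + (1 - a) *\<^sub>R R = (0, 0)" "b *\<^sub>R U + (1 - b) *\<^sub>R V = (0, 1)"
       "c *\<^sub>R R + (1 - c) *\<^sub>R U = (1, 1)"
    and ord: "fst U \<le> fst R" "snd V - fst V \<le> snd U - fst U" "snd V \<le> snd R"
  shows "measure lborel K \<le> tri_bound w \<and> (measure lborel K = tri_bound w \<longrightarrow> pivot_triangle K (lam w))"
proof -
  define D where "D = a*b*c + (1-a)*(1-b)*(1-c)"
  have D: "D > 0" using a by (auto simp: D_def intro!: add_pos_pos)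
  have q: "a * fst V + (1 - a) * fst R = 0" "a * snd V + (1 - a) * snd R = 0"
    "b * fst U + (1 - b) * fst V = 0" "b * snd U + (1 - b) * snd V = 1"
    "c * fst R + (1 - c) * fst U = 1" "c * snd R + (1 - c) * snd U = 1"
    using p by (auto simp: prod_eq_iff)
  note sol = pivot_solve[OF q(1,3,5), folded D_def] pivot_solve[OF q(2,4,6), folded D_def]
  have x: "D * fst R = a * b" "D * fst V = - ((1 - a) * b)" "D * fst U = (1 - a) * (1 - b)"
    using sol by simp_all
  have y: "D * snd U = a * c + (1 - a) * (1 - b)" "D * snd V = (1 - a) * (1 - c) - (1 - a) * b"
    "D * snd R = a * b - a * (1 - c)"
    using sol by simp_all
  have cr: "cross U V R = 1 / D"
  proof -
    have "D * D * cross U V R = (D * fst V - D * fst U) * (D * snd R - D * snd U) - (D * fst R - D * fst U) * (D * snd V - D * snd U)"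
      by (simp add: cross_def algebra_simps)
    also have "\<dots> = D" unfolding x y by (simp add: D_def algebra_simps)
    finally show ?thesis using D by (simp add: field_simps)
  qed
  have mH: "measure lborel (convex hull {U, V, R}) = 1 / (2 * D)"
    using measure_triangle[of U V R] D by (simp add: cr)
  have cH: "compact (convex hull {U, V, R})" by (simp add: finite_imp_compact_convex_hull)
  have le: "measure lborel K \<le> 1 / (2 * D)"
    unfolding mH[symmetric] by (intro measure_mono_compact KH cH bodyD[OF K])
  have xs: "fst R = a * b / D" "fst V = - ((1 - a) * b) / D" "fst U = (1 - a) * (1 - b) / D"
    using x D by (auto simp: field_simps)
  have ys: "snd U = (a * c + (1 - a) * (1 - b)) / D" "snd V = ((1 - a) * (1 - c) - (1 - a) * b) / D"
    "snd R = (a * b - a * (1 - c)) / D"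
    using y D by (auto simp: field_simps)
  have "D * fst U \<le> D * fst R" "D * (snd V - fst V) \<le> D * (snd U - fst U)" "D * snd V \<le> D * snd R"
    using ord D by (intro mult_left_mono; simp)+
  then have "D * fst U \<le> D * fst R" "D * snd V - D * fst V \<le> D * snd U - D * fst U" "D * snd V \<le> D * snd R"
    by (simp_all add: right_diff_distrib)
  then have sums: "a + b \<ge> 1" "b + c \<ge> 1" "a + c \<ge> 1" unfolding x y by (simp_all add: algebra_simps)
  have "w \<le> fst R - fst V"
  proof (rule wideD[OF bodyD(4)[OF K], of _ 1 0])
    fix z assume "z \<in> K"
    then have z: "z \<in> convex hull {U, V, R}" using KH by auto
    have "fst V \<le> 0" "0 \<le> fst U" unfolding xs using a D by (auto simp: divide_nonpos_pos)
    then have "fst V \<le> 1 * fst z + 0 * snd z \<and> 1 * fst z + 0 * snd z \<le> fst R"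
      by (intro hull_linear_bounds[OF z]) (use ord in auto)
    then show "fst V \<le> of_int 1 * fst z + of_int 0 * snd z \<and> of_int 1 * fst z + of_int 0 * snd z \<le> fst R"
      by simp
  qed simp
  also have "\<dots> = b / D" unfolding xs by (simp add: algebra_simps flip: diff_divide_distrib add_divide_distrib)
  finally have wb: "w * D \<le> b" using D by (simp add: field_simps)
  have zs: "snd U - fst U = a * c / D" "snd V - fst V = (1 - a) * (1 - c) / D" "snd R - fst R = - (a * (1 - c)) / D"
    unfolding xs ys by (simp_all add: algebra_simps flip: diff_divide_distrib add_divide_distrib)
  have "w \<le> (snd U - fst U) - (snd R - fst R)"
  proof (rule wideD[OF bodyD(4)[OF K], of _ "-1" 1])
    fix z assume "z \<in> K"
    then have z: "z \<in> convex hull {U, V, R}" using KH by auto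
    have "snd R - fst R \<le> 0" "0 \<le> snd V - fst V" unfolding zs using a D by (auto simp: divide_nonpos_pos)
    then have "snd R - fst R \<le> -1 * fst z + 1 * snd z \<and> -1 * fst z + 1 * snd z \<le> snd U - fst U"
      by (intro hull_linear_bounds[OF z]) (use ord in auto)
    then show "snd R - fst R \<le> of_int (-1) * fst z + of_int 1 * snd z \<and> of_int (-1) * fst z + of_int 1 * snd z \<le> snd U - fst U"
      by simp
  qed simp
  also have "\<dots> = a / D" unfolding zs by (simp add: algebra_simps flip: diff_divide_distrib add_divide_distrib)
  finally have wa: "w * D \<le> a" using D by (simp add: field_simps)
  have ts: "1 - snd V = b * c / D" "1 - snd U = - ((1 - b) * c) / D" "1 - snd R = (1 - b) * (1 - c) / D"
    unfolding ys using D by (simp_all add: field_simps) (simp_all add: D_def algebra_simps)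
  have "w \<le> snd U - snd V"
  proof (rule wideD[OF bodyD(4)[OF K], of _ 0 1])
    fix z assume "z \<in> K"
    then have z: "z \<in> convex hull {U, V, R}" using KH by auto
    have "1 - snd U \<le> 0" "0 \<le> 1 - snd R" unfolding ts using a D by (auto simp: divide_nonpos_pos)
    then have "snd V \<le> 0 * fst z + 1 * snd z \<and> 0 * fst z + 1 * snd z \<le> snd U"
      by (intro hull_linear_bounds[OF z]) (use ord in auto)
    then show "snd V \<le> of_int 0 * fst z + of_int 1 * snd z \<and> of_int 0 * fst z + of_int 1 * snd z \<le> snd U"
      by simp
  qed simp
  also have "\<dots> = (1 - snd V) - (1 - snd U)" by simp
  also have "\<dots> = c / D" unfolding ts by (simp add: algebra_simps flip: diff_divide_distrib add_divide_distrib)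
  finally have wc: "w * D \<le> c" using D by (simp add: field_simps)
  have ab1: "a \<le> 1" "b \<le> 1" "c \<le> 1" using a by auto
  note num = triangle_numeric[OF w ab1 D_def D wa wb wc sums]
  have tb: "tri_bound w = w / (2 * lam w)" using tri_bound_lam w by simp
  have DB: "1 / (2 * D) \<le> tri_bound w"
    unfolding tb using num(1,3) D w by (simp add: field_simps)
  have "pivot_triangle K (lam w)" if E: "measure lborel K = tri_bound w"
  proof -
    have "1 / (2 * D) = w / (2 * lam w)" using E le DB tb by linarith
    then have "w * D = lam w" using D num(3) w by (simp add: field_simps)
    from num(2)[OF this] have abc: "a = lam w" "b = lam w" "c = lam w" by auto
    have "K = convex hull {U, V, R}"
    proof (rule eq_if_measure_le[OF bodyD(5)[OF K] KH cH convex_convex_hull])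
      show "interior (convex hull {U, V, R}) \<noteq> {}" using bodyD(3)[OF K] interior_mono[OF KH] by blast
    qed (use E DB mH in linarith)
    moreover have "\<not> collinear {U, V, R}" using collinear_cross[of U V R] cr D by auto
    moreover have "(0, 0) \<in> Z2" "(0, 1) \<in> Z2" "(1, 1) \<in> Z2" by (auto simp: Z2_def)
    ultimately show ?thesis using p unfolding abc pivot_triangle_def by metis
  qed
  then show ?thesis using le DB by linarith
qed
lemma cross_on_line:
  assumes "snd q = k + m * fst q" "snd r = k + m * fst r"
  shows "cross p q r = (k + m * fst p - snd p) * (fst q - fst r)"
  unfolding cross_def assms by (simp add: algebra_simps)

lemma in_triangle_if_cross_nonneg:
  assumes "cross U V R > 0" "cross p V R \<ge> 0" "cross p R U \<ge> 0" "cross p U V \<ge> 0"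
  shows "p \<in> convex hull {U, V, R}"
proof -
  let ?C = "cross U V R"
  have s: "cross p V R + cross p R U + cross p U V = ?C" by (simp add: cross_def algebra_simps)
  have f: "cross p V R * fst U + cross p R U * fst V + cross p U V * fst R = ?C * fst p"
    by (simp add: cross_def algebra_simps)
  have g: "cross p V R * snd U + cross p R U * snd V + cross p U V * snd R = ?C * snd p"
    by (simp add: cross_def algebra_simps)
  have "p = (cross p V R / ?C) *\<^sub>R U + (cross p R U / ?C) *\<^sub>R V + (cross p U V / ?C) *\<^sub>R R"
    using assms(1) f g by (simp add: prod_eq_iff field_simps)
  moreover have "cross p V R / ?C + cross p R U / ?C + cross p U V / ?C = 1"
    using assms(1) s by (simp flip: add_divide_distrib)
  ultimately show ?thesis unfolding convex_hull_3 using assms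
    by (intro CollectI exI[of _ "cross p V R / ?C"] exI[of _ "cross p R U / ?C"] exI[of _ "cross p U V / ?C"]) auto
qed

definition good_gt_2 :: "(real \<times> real) set \<Rightarrow> real \<Rightarrow> bool" where
  "good_gt_2 K w \<longleftrightarrow> measure lborel K \<le> tri_bound w \<and> (measure lborel K = tri_bound w \<longrightarrow> pivot_triangle K (lam w))"

lemma three_lines_triangle:
  assumes K: "body K w" and w: "w > 2" and g: "0 < g" "g < 1" and ab: "\<alpha> \<ge> 1" "\<beta> > 0"
    and l: "\<And>p. p \<in> K \<Longrightarrow> g * fst p \<le> snd p" "\<And>p. p \<in> K \<Longrightarrow> snd p \<le> 1 + \<alpha> * fst p"
       "\<And>p. p \<in> K \<Longrightarrow> snd p \<le> 1 + \<beta> * (1 - fst p)"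
  shows "good_gt_2 K w"
proof -
  define P r u where "P = 1 / (\<alpha> - g)" and "r = (1 + \<beta>) / (g + \<beta>)" and "u = \<beta> / (\<alpha> + \<beta>)"
  have P: "P > 0" using g ab by (simp add: P_def)
  have r: "r > 1" using g ab by (simp add: r_def)
  have u: "0 < u" "u < 1" using g ab by (auto simp: u_def)
  define U V R where "U = (u, 1 + \<alpha> * u)" and "V = (- P, 1 - \<alpha> * P)" and "R = (r, g * r)"
  have "P * (\<alpha> - g) = 1" using g ab by (simp add: P_def)
  then have V2: "snd V = g * fst V" by (simp add: V_def algebra_simps)
  have "u * (\<alpha> + \<beta>) = \<beta>" using ab by (simp add: u_def)
  then have U2: "snd U = (1 + \<beta>) - \<beta> * fst U" by (simp add: U_def algebra_simps)
  have "r * (g + \<beta>) = 1 + \<beta>" using ab g by (simp add: r_def)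
  then have R2: "snd R = (1 + \<beta>) - \<beta> * fst R" by (simp add: R_def algebra_simps)
  have VR: "cross p V R = (0 + g * fst p - snd p) * (fst V - fst R)" for p
    by (rule cross_on_line) (use V2 in \<open>auto simp: R_def\<close>)
  have UV: "cross p U V = (1 + \<alpha> * fst p - snd p) * (fst U - fst V)" for p
    by (rule cross_on_line) (auto simp: U_def V_def)
  have RU: "cross p R U = ((1 + \<beta>) + - \<beta> * fst p - snd p) * (fst R - fst U)" for p
    by (rule cross_on_line) (use R2 U2 in auto)
  have lt: "fst V < fst R" "fst V < fst U" "fst U < fst R" using P r u by (auto simp: U_def V_def R_def)
  have gu: "g * u < \<alpha> * u" using u g ab by simp
  have pos: "cross U V R > 0" unfolding VR using lt gu
    by (intro mult_neg_neg) (auto simp: U_def)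
  have KH: "K \<subseteq> convex hull {U, V, R}"
  proof
    fix p assume p: "p \<in> K"
    show "p \<in> convex hull {U, V, R}"
    proof (rule in_triangle_if_cross_nonneg[OF pos])
      show "cross p V R \<ge> 0" unfolding VR using l(1)[OF p] lt by (intro mult_nonpos_nonpos) auto
      show "cross p U V \<ge> 0" unfolding UV using l(2)[OF p] lt by (intro mult_nonneg_nonneg) auto
      show "cross p R U \<ge> 0" unfolding RU using l(3)[OF p] lt by (intro mult_nonneg_nonneg) (auto simp: algebra_simps)
    qed
  qed
  define a b c where "a = r / (r + P)" and "b = P / (u + P)" and "c = (1 - u) / (r - u)"
  have abc: "0 < a" "a < 1" "0 < b" "b < 1" "0 < c" "c < 1" using P r u by (auto simp: a_def b_def c_def)
  have ea: "a * P = (1 - a) * r" using P r by (simp add: a_def field_simps)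
  have eb: "b * u = (1 - b) * P" using P u by (simp add: b_def field_simps)
  have "c * (r - u) = 1 - u" using r u by (simp add: c_def)
  then have ec: "c * r + (1 - c) * u = 1" by (simp add: algebra_simps)
  show ?thesis unfolding good_gt_2_def
  proof (rule triangle_area_bound[OF K w KH abc])
    have "a * fst V + (1 - a) * fst R = 0" using ea by (simp add: V_def R_def)
    moreover have "a * snd V + (1 - a) * snd R = g * (a * fst V + (1 - a) * fst R)"
      unfolding V2 by (simp add: R_def algebra_simps)
    ultimately show "a *\<^sub>R V + (1 - a) *\<^sub>R R = (0, 0)" by (simp add: prod_eq_iff)
    have "b * fst U + (1 - b) * fst V = 0" using eb by (simp add: U_def V_def)
    moreover have "b * snd U + (1 - b) * snd V = 1 + \<alpha> * (b * fst U + (1 - b) * fst V)"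
      by (simp add: U_def V_def algebra_simps)
    ultimately show "b *\<^sub>R U + (1 - b) *\<^sub>R V = (0, 1)" by (simp add: prod_eq_iff)
    have "c * fst R + (1 - c) * fst U = 1" using ec by (simp add: U_def R_def)
    moreover have "c * snd R + (1 - c) * snd U = 1 + \<beta> - \<beta> * (c * fst R + (1 - c) * fst U)"
      unfolding U2 R2 by (simp add: algebra_simps)
    ultimately show "c *\<^sub>R R + (1 - c) *\<^sub>R U = (1, 1)" by (simp add: prod_eq_iff)
    show "fst U \<le> fst R" using lt by simp
    have "(\<alpha> - 1) * fst V \<le> (\<alpha> - 1) * fst U" using lt ab by (intro mult_left_mono) auto
    then show "snd V - fst V \<le> snd U - fst U" by (simp add: U_def V_def algebra_simps)
    show "snd V \<le> snd R" unfolding V2 using lt g by (simp add: R_def)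
  qed
qed

lemma interior_crossing:
  fixes K :: "(real \<times> real) set"
  assumes K: "convex K" and c: "c \<in> interior K" and p: "p \<in> K"
    and f: "m * fst c + n * snd c < k" "k < m * fst p + n * snd p"
  obtains t where "0 < t" "t < 1" "t *\<^sub>R c + (1 - t) *\<^sub>R p \<in> interior K"
    "m * fst (t *\<^sub>R c + (1 - t) *\<^sub>R p) + n * snd (t *\<^sub>R c + (1 - t) *\<^sub>R p) = k"
proof -
  define x y where "x = m * fst c + n * snd c" and "y = m * fst p + n * snd p"
  define t where "t = (y - k) / (y - x)"
  have xy: "x < k" "k < y" using f by (auto simp: x_def y_def)
  have t: "0 < t" "t < 1" using xy by (auto simp: t_def)
  have "m * fst (t *\<^sub>R c + (1 - t) *\<^sub>R p) + n * snd (t *\<^sub>R c + (1 - t) *\<^sub>R p) = t * x + (1 - t) * y"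
    by (simp add: x_def y_def algebra_simps)
  also have "\<dots> = y - t * (y - x)" by (simp add: algebra_simps)
  also have "\<dots> = k" using xy by (simp add: t_def)
  finally show ?thesis using that t interior_segment[OF K c p t(1)] by simp
qed

text \<open>If an interior point (x, x + 1) with x < 0 existed, minimality of w would confine K to first
  coordinates above -1, and K would meet all four sides of the parallelogram with vertices
  (-1,0), (0,0), (1,1), (0,1). Otherwise the supporting line at (0,1) may be chosen with slope at
  least 1.\<close>
lemma one_side_crossed:
  assumes K: "body K w" and free: "interior K \<inter> Z2 = {}" and w: "w > 2"
    and x: "\<And>p. p \<in> K \<Longrightarrow> a \<le> fst p \<and> fst p \<le> a + w" "a < 0"
    and y0: "(0, y0) \<in> interior K" "0 < y0" "y0 < 1"
    and y1: "(1, y1) \<in> interior K" "0 < y1" "y1 < 1"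
    and top: "(xt, 1) \<in> interior K" "0 < xt" "xt < 1"
    and g: "g \<ge> 0" "\<And>p. p \<in> K \<Longrightarrow> g * fst p \<le> snd p"
    and left: "g > 0 \<Longrightarrow> \<exists>x<0. (x, 0) \<in> interior K"
  shows "good_gt_2 K w"
proof -
  note Z = free_not_interior[OF free]
  have Z': "(0, 1) \<notin> interior K" "(1, 1) \<notin> interior K" using Z[of 0 1] Z[of 1 1] by auto
  note cv = bodyD(2)[OF K] and iK = subsetD[OF interior_subset]
  obtain \<alpha> where a: "\<And>q. q \<in> K \<Longrightarrow> snd q \<le> 1 + \<alpha> * (fst q - 0)"
    "\<And>q. q \<in> interior K \<Longrightarrow> snd q < 1 + \<alpha> * (fst q - 0)"
    using line_above[OF cv y0(1,3) Z'(1)] by blast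
  obtain \<beta>' where b': "\<And>q. q \<in> K \<Longrightarrow> snd q \<le> 1 + \<beta>' * (fst q - 1)"
    "\<And>q. q \<in> interior K \<Longrightarrow> snd q < 1 + \<beta>' * (fst q - 1)"
    using line_above[OF cv y1(1,3) Z'(2)] by blast
  define \<beta> where "\<beta> = - \<beta>'"
  have b: "snd q \<le> 1 + \<beta> * (1 - fst q)" if "q \<in> K" for q
    using b'(1)[OF that] by (simp add: \<beta>_def algebra_simps)
  have \<alpha>: "\<alpha> > 0" using a(2)[OF top(1)] top by (simp add: zero_less_mult_iff)
  have "0 < \<beta>' * (xt - 1)" using b'(2)[OF top(1)] by simp
  then have \<beta>: "\<beta> > 0" using top by (simp add: zero_less_mult_iff \<beta>_def)
  have g1: "g < 1" using g(2)[OF iK[OF y1(1)]] y1 by simp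
  have g0: "g > 0"
  proof (rule ccontr)
    assume "\<not> g > 0"
    then have "g = 0" using g by simp
    then have "w \<le> 2"
      using four_lines_width[OF K \<alpha> \<beta>, of 0 0] a(1) b g(2) by auto
    then show False using w by simp
  qed
  obtain x1 where x1: "x1 < 0" "(x1, 0) \<in> interior K" using left[OF g0] by blast
  show ?thesis
  proof (cases "\<exists>x<0. (x, x + 1) \<in> interior K")
    case True
    then obtain x2 where x2: "x2 < 0" "(x2, x2 + 1) \<in> interior K" by blast
    define P where "P = - a"
    have P: "P > 0" using x(2) by (simp add: P_def)
    have "x2 * 1 < x2 * \<alpha>" using a(2)[OF x2(2)] by (simp add: mult.commute)
    then have \<alpha>1: "\<alpha> < 1" using x2(1) by (simp add: mult_less_cancel_left_neg)
    have b1: "1 < a + w"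
    proof -
      obtain q where "q \<in> K" "fst q > 1"
      proof -
        obtain e where e: "e > 0" "cball (1, y1) e \<subseteq> K"
          using y1(1) by (metis interior_subset open_contains_cball open_interior subset_trans)
        have "(1 + e, y1) \<in> K" by (rule subsetD[OF e(2)]) (use e(1) in \<open>simp add: dist_Pair_Pair dist_real_def\<close>)
        then show ?thesis using that e(1) by auto
      qed
      then show ?thesis using x(1)[of q] by simp
    qed
    have "w \<le> (1 + \<alpha> * \<beta> / (\<alpha> + \<beta>)) - g * a"
    proof (rule wideD[OF bodyD(4)[OF K], of _ 0 1])
      fix p assume p: "p \<in> K"
      have "\<beta> * snd p + \<alpha> * snd p \<le> \<beta> * (1 + \<alpha> * fst p) + \<alpha> * (1 + \<beta> * (1 - fst p))"
        using a(1)[OF p] b[OF p] \<alpha> \<beta> by (intro add_mono mult_left_mono) auto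
      then have "snd p \<le> 1 + \<alpha> * \<beta> / (\<alpha> + \<beta>)" using \<alpha> \<beta> by (simp add: field_simps)
      moreover have "g * a \<le> g * fst p" using x(1)[OF p] g0 by (intro mult_left_mono) auto
      ultimately show "g * a \<le> of_int 0 * fst p + of_int 1 * snd p \<and> of_int 0 * fst p + of_int 1 * snd p \<le> 1 + \<alpha> * \<beta> / (\<alpha> + \<beta>)"
        using g(2)[OF p] by simp
    qed simp
    moreover have "\<alpha> * \<beta> / (\<alpha> + \<beta>) < \<alpha>" using \<alpha> \<beta> by (simp add: field_simps)
    ultimately have i1: "(1 - g) * P < \<alpha>" using b1 by (simp add: P_def algebra_simps)
    have "w \<le> (1 + (1 - \<alpha>) * P) - (- ((1 - g) * (a + w)))"
    proof (rule wideD[OF bodyD(4)[OF K], of _ "-1" 1])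
      fix p assume p: "p \<in> K"
      have "(1 - \<alpha>) * (- fst p) \<le> (1 - \<alpha>) * P" using x(1)[OF p] \<alpha>1 by (intro mult_left_mono) (auto simp: P_def)
      moreover have "(1 - g) * fst p \<le> (1 - g) * (a + w)" using x(1)[OF p] g1 by (intro mult_left_mono) auto
      ultimately show "- ((1 - g) * (a + w)) \<le> of_int (-1) * fst p + of_int 1 * snd p \<and> of_int (-1) * fst p + of_int 1 * snd p \<le> 1 + (1 - \<alpha>) * P"
        using g(2)[OF p] a(1)[OF p] by (simp add: algebra_simps)
    qed simp
    then have "\<alpha> * P + g * (a + w) \<le> 1" by (simp add: P_def algebra_simps)
    moreover have "g * (a + w) > g * 1" using g0 b1 by (intro mult_strict_left_mono)
    ultimately have i2: "\<alpha> * P < 1 - g" by simp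
    have P1: "P < 1"
    proof (rule ccontr)
      assume "\<not> P < 1"
      then have "(1 - g) * P \<ge> (1 - g) * 1" "\<alpha> * P \<ge> \<alpha> * 1" using g1 \<alpha> by (auto intro!: mult_left_mono)
      then show False using i1 i2 by simp
    qed
    have lims: "-1 < x1" "-1 < x2" using x(1)[OF iK[OF x1(2)]] x(1)[OF iK[OF x2(2)]] P1 by (auto simp: P_def)
    define S where "S = aff (of_int 1) (of_int (-1)) (of_int 0) (of_int 1) (of_int 1) (of_int 0)"
    have S: "umap S" unfolding S_def by (rule umapI) simp
    note iS = iaff_interior[OF umap_imp_iaff[OF S]]
    obtain t where t: "0 < t" "t < 1" "t *\<^sub>R (1, y1) + (1 - t) *\<^sub>R (0, y0) \<in> interior K"
      "-1 * fst (t *\<^sub>R (1, y1) + (1 - t) *\<^sub>R (0, y0)) + 1 * snd (t *\<^sub>R (1, y1) + (1 - t) *\<^sub>R (0, y0)) = 0"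
      using interior_crossing[OF cv y1(1) iK[OF y0(1)], of "-1" 1 0] y0 y1 by auto
    then have tt: "(t, t) \<in> interior K" by simp
    have "w \<le> 2"
    proof (rule four_sides_width[OF body_iaff[OF K umap_imp_iaff[OF S]] umap_free[OF S free]])
      have "S (x2, x2 + 1) = (0, x2 + 1)" "S (t, t) = (1, t)" "S (xt, 1) = (xt, 1)" "S (x1, 0) = (x1 + 1, 0)"
        by (auto simp: S_def aff_Pair)
      then show "(0, x2 + 1) \<in> interior (S ` K)" "(1, t) \<in> interior (S ` K)" "(xt, 1) \<in> interior (S ` K)" "(x1 + 1, 0) \<in> interior (S ` K)"
        unfolding iS using x2(2) tt top(1) x1(2) by (metis image_eqI)+
    qed (use x1 x2 lims t top in auto)
    then show ?thesis using w by simp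
  next
    case False
    have "\<exists>\<alpha>\<ge>1. \<forall>p\<in>K. snd p \<le> 1 + \<alpha> * fst p"
    proof (cases "\<exists>x>0. (x, x + 1) \<in> interior K")
      case True
      then obtain x2 where x2: "x2 > 0" "(x2, x2 + 1) \<in> interior K" by blast
      then have "\<alpha> > 1" using a(2)[OF x2(2)] by simp
      then show ?thesis using a(1) by (intro exI[of _ \<alpha>]) auto
    next
      case F2: False
      have "snd p \<le> 1 + 1 * fst p" if p: "p \<in> K" for p
      proof (rule ccontr)
        assume "\<not> snd p \<le> 1 + 1 * fst p"
        then obtain t where t: "t *\<^sub>R (0, y0) + (1 - t) *\<^sub>R p \<in> interior K"
          "-1 * fst (t *\<^sub>R (0, y0) + (1 - t) *\<^sub>R p) + 1 * snd (t *\<^sub>R (0, y0) + (1 - t) *\<^sub>R p) = 1"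
          using interior_crossing[OF cv y0(1) p, of "-1" 1 1] y0 by auto
        define z where "z = t *\<^sub>R (0, y0) + (1 - t) *\<^sub>R p"
        have z: "(fst z, fst z + 1) \<in> interior K"
        proof -
          have "snd z = fst z + 1" using t(2) unfolding z_def by linarith
          then show ?thesis using t(1) unfolding z_def[symmetric] by (metis prod.collapse)
        qed
        then show False using False F2 Z'(1) by (cases "fst z" "0::real" rule: linorder_cases) auto
      qed
      then show ?thesis by (intro exI[of _ 1]) auto
    qed
    then obtain \<alpha>2 where "\<alpha>2 \<ge> 1" "\<And>p. p \<in> K \<Longrightarrow> snd p \<le> 1 + \<alpha>2 * fst p" by blast
    then show ?thesis using three_lines_triangle[OF K w g0 g1 _ \<beta> g(2)] b by blast
  qed
qed

lemma upper_crossing_cases: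
  assumes K: "convex K" and free: "interior K \<inter> Z2 = {}"
    and y0: "(0, y0) \<in> interior K" "y0 < 1"
    and y1: "(1, y1) \<in> interior K" "y1 < 1"
  obtains (crossed) x where "0 < x" "x < 1" "(x, 1) \<in> interior K"
    | (left) \<kappa> where "\<kappa> \<ge> 0" "y1 < 1 - \<kappa>" "\<And>p. p \<in> K \<Longrightarrow> snd p \<le> 1 - \<kappa> * fst p" "\<kappa> > 0 \<Longrightarrow> \<exists>x<0. (x, 1) \<in> interior K"
    | (right) \<kappa> where "\<kappa> \<ge> 0" "y0 < 1 - \<kappa>" "\<And>p. p \<in> K \<Longrightarrow> snd p \<le> 1 - \<kappa> * (1 - fst p)" "\<kappa> > 0 \<Longrightarrow> \<exists>x>1. (x, 1) \<in> interior K"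
proof -
  note Z = free_not_interior[OF free]
  have Z': "(0, 1) \<notin> interior K" "(1, 1) \<notin> interior K" using Z[of 0 1] Z[of 1 1] by auto
  note iK = subsetD[OF interior_subset]
  consider "\<forall>p\<in>K. snd p \<le> 1" | x where "(x, 1) \<in> interior K"
  proof -
    assume *: "\<forall>p\<in>K. snd p \<le> 1 \<Longrightarrow> thesis" "\<And>x. (x, 1) \<in> interior K \<Longrightarrow> thesis"
    show thesis
    proof (cases "\<forall>p\<in>K. snd p \<le> 1")
      case False
      then obtain p where p: "p \<in> K" "snd p > 1" by force
      then obtain t where t: "t *\<^sub>R (0, y0) + (1 - t) *\<^sub>R p \<in> interior K"
          "0 * fst (t *\<^sub>R (0, y0) + (1 - t) *\<^sub>R p) + 1 * snd (t *\<^sub>R (0, y0) + (1 - t) *\<^sub>R p) = 1"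
        using interior_crossing[OF K y0(1) p(1), of 0 1 1] y0 by auto
      define z where "z = t *\<^sub>R (0, y0) + (1 - t) *\<^sub>R p"
      have "snd z = 1" using t(2) unfolding z_def by linarith
      then have "(fst z, 1) \<in> interior K" using t(1) unfolding z_def[symmetric] by (metis prod.collapse)
      then show ?thesis by (rule *(2))
    qed (use * in blast)
  qed
  then show ?thesis
  proof cases
    case 1
    then show ?thesis using left[of 0] y1 by auto
  next
    case (2 x)
    then have "x \<noteq> 0" "x \<noteq> 1" using Z' by auto
    then consider "x < 0" | "0 < x" "x < 1" | "x > 1" by linarith
    then show ?thesis
    proof cases
      case l: 1
      obtain \<alpha> where a: "\<And>q. q \<in> K \<Longrightarrow> snd q \<le> 1 + \<alpha> * (fst q - 0)"
        "\<And>q. q \<in> interior K \<Longrightarrow> snd q < 1 + \<alpha> * (fst q - 0)"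
        using line_above[OF K y0(1,2) Z'(1)] by blast
      have "- \<alpha> > 0" using a(2)[OF 2] l by (simp add: zero_less_mult_iff)
      moreover have "y1 < 1 - (- \<alpha>)" using a(2)[OF y1(1)] by simp
      ultimately show ?thesis using left[of "- \<alpha>"] a(1) l 2 by auto
    next
      case r: 3
      obtain \<beta> where b: "\<And>q. q \<in> K \<Longrightarrow> snd q \<le> 1 + \<beta> * (fst q - 1)"
        "\<And>q. q \<in> interior K \<Longrightarrow> snd q < 1 + \<beta> * (fst q - 1)"
        using line_above[OF K y1(1,2) Z'(2)] by blast
      have "\<beta> > 0" using b(2)[OF 2] r by (simp add: zero_less_mult_iff)
      moreover have "y0 < 1 - \<beta>" using b(2)[OF y0(1)] by simp
      moreover have "snd p \<le> 1 - \<beta> * (1 - fst p)" if "p \<in> K" for p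
        using b(1)[OF that] by (simp add: algebra_simps)
      ultimately show ?thesis using right[of \<beta>] r 2 by auto
    qed (use crossed 2 in blast)
  qed
qed

definition yflip :: "real \<times> real \<Rightarrow> real \<times> real" where
  "yflip = aff (of_int 1) (of_int 0) (of_int 0) (of_int (-1)) (of_int 0) (of_int 1)"

lemma umap_yflip: "umap yflip" unfolding yflip_def by (rule umapI) simp

lemma mem_yflip: "p \<in> yflip ` K \<longleftrightarrow> (fst p, 1 - snd p) \<in> K"
proof
  assume "(fst p, 1 - snd p) \<in> K"
  moreover have "p = yflip (fst p, 1 - snd p)" by (simp add: yflip_def prod_eq_iff)
  ultimately show "p \<in> yflip ` K" by blast
qed (auto simp: yflip_def)

lemmas interior_umap = iaff_interior[OF umap_imp_iaff]

lemma lower_crossing_cases: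
  assumes K: "convex K" and free: "interior K \<inter> Z2 = {}"
    and y0: "(0, y0) \<in> interior K" "y0 > 0"
    and y1: "(1, y1) \<in> interior K" "y1 > 0"
  obtains (crossed) x where "0 < x" "x < 1" "(x, 0) \<in> interior K"
    | (left) \<kappa> where "\<kappa> \<ge> 0" "\<kappa> < y1" "\<And>p. p \<in> K \<Longrightarrow> \<kappa> * fst p \<le> snd p" "\<kappa> > 0 \<Longrightarrow> \<exists>x<0. (x, 0) \<in> interior K"
    | (right) \<kappa> where "\<kappa> \<ge> 0" "\<kappa> < y0" "\<And>p. p \<in> K \<Longrightarrow> \<kappa> * (1 - fst p) \<le> snd p" "\<kappa> > 0 \<Longrightarrow> \<exists>x>1. (x, 0) \<in> interior K"
proof -
  let ?K = "yflip ` K"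
  have mem: "(x, y) \<in> ?K \<longleftrightarrow> (x, 1 - y) \<in> K" for x y by (simp add: mem_yflip)
  have imem: "(x, y) \<in> interior ?K \<longleftrightarrow> (x, 1 - y) \<in> interior K" for x y
    by (simp add: interior_umap[OF umap_yflip] mem_yflip)
  have fl: "(fst p, 1 - snd p) \<in> ?K" if "p \<in> K" for p using that by (simp add: mem)
  have "convex ?K" "interior ?K \<inter> Z2 = {}"
    using K free umap_yflip by (auto simp: iaff_convex umap_imp_iaff umap_free)
  note outer = crossed left right
  have "(0, 1 - y0) \<in> interior ?K" "1 - y0 < 1" "(1, 1 - y1) \<in> interior ?K" "1 - y1 < 1"
    using y0 y1 by (auto simp: imem)
  with \<open>convex ?K\<close> \<open>interior ?K \<inter> Z2 = {}\<close> show ?thesis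
  proof (cases rule: upper_crossing_cases)
    case (crossed x)
    then show ?thesis using outer(1)[of x] by (simp add: imem)
  next
    case (left \<kappa>)
    then show ?thesis using outer(2)[of \<kappa>] fl by (force simp: imem)
  next
    case (right \<kappa>)
    then show ?thesis using outer(3)[of \<kappa>] fl by (force simp: imem)
  qed
qed

lemma collinear_aff: assumes "collinear X" shows "collinear (aff a b c d e f ` X)"
proof -
  obtain u where u: "\<forall>x\<in>X. \<forall>y\<in>X. \<exists>t. x - y = t *\<^sub>R u" using assms unfolding collinear_def by blast
  have "\<exists>t. aff a b c d e f x - aff a b c d e f y = t *\<^sub>R aff a b c d 0 0 u" if xy: "x \<in> X" "y \<in> X" for x y
  proof -
    obtain t where "x - y = t *\<^sub>R u" using u xy by blast
    moreover have "aff a b c d e f x - aff a b c d e f y = aff a b c d 0 0 (x - y)"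
      by (simp add: prod_eq_iff algebra_simps)
    ultimately show ?thesis using linear_scale[OF linear_aff[of a b c d]] by metis
  qed
  then show ?thesis unfolding collinear_def by blast
qed

lemma pivot_triangle_umap:
  assumes "pivot_triangle K l" "umap S" shows "pivot_triangle (S ` K) l"
proof -
  obtain q0 q1 q2 where q: "\<not> collinear {q0, q1, q2}" "K = convex hull {q0, q1, q2}"
    "l *\<^sub>R q1 + (1 - l) *\<^sub>R q2 \<in> Z2" "l *\<^sub>R q2 + (1 - l) *\<^sub>R q0 \<in> Z2" "l *\<^sub>R q0 + (1 - l) *\<^sub>R q1 \<in> Z2"
    using assms(1) unfolding pivot_triangle_def by blast
  have comb: "l *\<^sub>R S x + (1 - l) *\<^sub>R S y \<in> Z2" if "l *\<^sub>R x + (1 - l) *\<^sub>R y \<in> Z2" for x y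
  proof -
    obtain a b c d e f where "S = aff a b c d e f" using assms(2) unfolding umap_def by blast
    then have "l *\<^sub>R S x + (1 - l) *\<^sub>R S y = S (l *\<^sub>R x + (1 - l) *\<^sub>R y)" by (simp add: prod_eq_iff algebra_simps)
    then show ?thesis using that umap_Z2[OF assms(2)] by blast
  qed
  obtain S' where S': "umap S'" "S' \<circ> S = id" using umap_inverse[OF assms(2)] by metis
  have "\<not> collinear (S ` {q0, q1, q2})"
  proof
    assume c: "collinear (S ` {q0, q1, q2})"
    obtain a b c d e f where "S' = aff a b c d e f" using S'(1) unfolding umap_def by blast
    then have "collinear (S' ` S ` {q0, q1, q2})" using collinear_aff[OF c] by simp
    then show False using S'(2) q(1) by (simp only: image_comp) simp
  qed
  moreover have "S ` K = convex hull {S q0, S q1, S q2}"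
    unfolding q(2) iaff_hull[OF umap_imp_iaff[OF assms(2)]] by simp
  ultimately show ?thesis unfolding pivot_triangle_def
    using comb[OF q(3)] comb[OF q(4)] comb[OF q(5)] by (intro exI[of _ "S q0"] exI[of _ "S q1"] exI[of _ "S q2"]) simp
qed

lemma good_gt_2_umap:
  assumes "good_gt_2 (S ` K) w" "umap S" "body K w" shows "good_gt_2 K w"
proof -
  obtain S' where S': "umap S'" "S' \<circ> S = id" using umap_inverse[OF assms(2)] by metis
  have "S' ` S ` K = K" using S'(2) by (simp add: image_comp)
  then show ?thesis
    using assms(1) body_measure[OF assms(3) umap_imp_iaff[OF assms(2)]] pivot_triangle_umap[OF _ S'(1), of "S ` K" "lam w"]
    unfolding good_gt_2_def by simp
qed

lemma top_crossed_good:
  assumes K: "body K w" and free: "interior K \<inter> Z2 = {}" and w: "w > 2"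
    and x: "\<And>p. p \<in> K \<Longrightarrow> a \<le> fst p \<and> fst p \<le> a + w" "a < 0" "1 < a + w"
    and y0: "(0, y0) \<in> interior K" "0 < y0" "y0 < 1"
    and y1: "(1, y1) \<in> interior K" "0 < y1" "y1 < 1"
    and top: "(xt, 1) \<in> interior K" "0 < xt" "xt < 1"
  shows "good_gt_2 K w"
  using bodyD(2)[OF K] free y0(1,2) y1(1,2)
proof (cases rule: lower_crossing_cases)
  case (crossed x)
  then have "w \<le> 2" using four_sides_width[OF K free y0(1) y1(1) top(1)] y0 y1 top by auto
  then show ?thesis using w by simp
next
  case (left \<kappa>)
  then show ?thesis by (intro one_side_crossed[OF K free w x(1,2) y0 y1 top]) auto
next
  case (right \<kappa>)
  let ?K = "xflip 1 ` K"
  have imem: "(x, y) \<in> interior ?K \<longleftrightarrow> (1 - x, y) \<in> interior K" for x y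
    by (simp add: interior_umap[OF umap_xflip] mem_xflip)
  have "good_gt_2 ?K w"
  proof (rule one_side_crossed[OF body_iaff[OF K umap_imp_iaff[OF umap_xflip]] umap_free[OF umap_xflip free] w,
        where a = "1 - (a + w)" and ?y0.0 = y1 and ?y1.0 = y0 and xt = "1 - xt" and g = \<kappa>])
    show "1 - (a + w) \<le> fst p \<and> fst p \<le> 1 - (a + w) + w" if "p \<in> ?K" for p
      using x(1)[of "(1 - fst p, snd p)"] that by (auto simp: mem_xflip)
    show "\<kappa> * fst p \<le> snd p" if "p \<in> ?K" for p
      using right(3)[of "(1 - fst p, snd p)"] that by (auto simp: mem_xflip)
    show "\<exists>x<0. (x, 0) \<in> interior ?K" if k: "\<kappa> > 0"
    proof -
      obtain x where "x > 1" "(x, 0) \<in> interior K" using right(4)[OF k] by blast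
      then show ?thesis by (intro exI[of _ "1 - x"]) (auto simp: imem)
    qed
  qed (use x y0 y1 top right in \<open>auto simp: imem\<close>)
  then show ?thesis by (rule good_gt_2_umap[OF _ umap_xflip K])
qed

lemma upper_bound_gt_2_normalized:
  assumes K: "body K w" and free: "interior K \<inter> Z2 = {}" and w: "w > 2"
    and x: "\<And>p. p \<in> K \<Longrightarrow> a \<le> fst p \<and> fst p \<le> a + w" "a < 0" "1 < a + w"
    and y0: "(0, y0) \<in> interior K" "0 < y0" "y0 < 1"
    and y1: "(1, y1) \<in> interior K" "0 < y1" "y1 < 1"
  shows "good_gt_2 K w"
proof -
  let ?K = "yflip ` K"
  have imem: "(x, y) \<in> interior ?K \<longleftrightarrow> (x, 1 - y) \<in> interior K" for x y
    by (simp add: interior_umap[OF umap_yflip] mem_yflip)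
  have bottom: ?thesis if b: "0 < xb" "xb < 1" "(xb, 0) \<in> interior K" for xb
  proof -
    have "good_gt_2 ?K w"
    proof (rule top_crossed_good[OF body_iaff[OF K umap_imp_iaff[OF umap_yflip]] umap_free[OF umap_yflip free] w _ x(2,3),
          where ?y0.0 = "1 - y0" and ?y1.0 = "1 - y1" and xt = xb])
      show "a \<le> fst p \<and> fst p \<le> a + w" if "p \<in> ?K" for p
        using x(1)[of "(fst p, 1 - snd p)"] that by (auto simp: mem_yflip)
    qed (use y0 y1 b in \<open>auto simp: imem\<close>)
    then show ?thesis by (rule good_gt_2_umap[OF _ umap_yflip K])
  qed
  define P Q where "P = - a" and "Q = a + w - 1"
  have PQ: "P > 0" "Q > 0" "w = 1 + P + Q" using x by (auto simp: P_def Q_def)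
  have xr: "fst p \<ge> - P" "1 - fst p \<ge> - Q" if "p \<in> K" for p using x(1)[OF that] by (auto simp: P_def Q_def)
  have lin: "k * u \<ge> - (k * v)" if "k \<ge> 0" "u \<ge> - v" for k u v :: real
    using mult_left_mono[OF that(2,1)] by simp
  have strip: "w \<le> 1 + A + B" if "\<And>p. p \<in> K \<Longrightarrow> snd p \<le> 1 + A" "\<And>p. p \<in> K \<Longrightarrow> - B \<le> snd p" for A B
  proof -
    have "w \<le> (1 + A) - (- B)"
      by (rule wideD[OF bodyD(4)[OF K], of _ 0 1]) (use that in auto)
    then show ?thesis by simp
  qed
  have small: "k * P < P" "k * Q < Q" if "k < 1" for k using that PQ by auto
  from bodyD(2)[OF K] free y0(1,3) y1(1,3) show ?thesis
  proof (cases rule: upper_crossing_cases)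
    case (crossed x)
    then show ?thesis using top_crossed_good[OF K free w x y0 y1] by auto
  next
    case u: (left k)
    have up: "snd p \<le> 1 + k * P" if "p \<in> K" for p using u(3)[OF that] lin[OF u(1) xr(1)[OF that]] by simp
    from bodyD(2)[OF K] free y0(1,2) y1(1,2) show ?thesis
    proof (cases rule: lower_crossing_cases)
      case (crossed x) then show ?thesis using bottom by auto
    next
      case l: (left h)
      have lo: "- (h * P) \<le> snd p" if "p \<in> K" for p
        using l(3)[OF that] lin[OF l(1) xr(1)[OF that]] by simp
      have "w \<le> 1 + k * P + h * P" by (rule strip[OF up lo])
      also have "\<dots> = 1 + (k + h) * P" by (simp add: algebra_simps)
      finally have "w \<le> 1 + (k + h) * P" .
      moreover have "(k + h) * P < P" by (rule small) (use u(2) l(2) in linarith)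
      ultimately have False using PQ by linarith
      then show ?thesis ..
    next
      case l: (right h)
      have lo: "- (h * Q) \<le> snd p" if "p \<in> K" for p
        using l(3)[OF that] lin[OF l(1) xr(2)[OF that]] by simp
      have "w \<le> 1 + k * P + h * Q" by (rule strip[OF up lo])
      moreover have "k < 1" "h < 1" using u(2) l(2) y0 y1 by linarith+
      ultimately have False using small[of k] small[of h] PQ by linarith
      then show ?thesis ..
    qed
  next
    case u: (right k)
    have up: "snd p \<le> 1 + k * Q" if "p \<in> K" for p using u(3)[OF that] lin[OF u(1) xr(2)[OF that]] by simp
    from bodyD(2)[OF K] free y0(1,2) y1(1,2) show ?thesis
    proof (cases rule: lower_crossing_cases)
      case (crossed x) then show ?thesis using bottom by auto
    next
      case l: (left h)
      have lo: "- (h * P) \<le> snd p" if "p \<in> K" for p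
        using l(3)[OF that] lin[OF l(1) xr(1)[OF that]] by simp
      have "w \<le> 1 + k * Q + h * P" by (rule strip[OF up lo])
      moreover have "k < 1" "h < 1" using u(2) l(2) y0 y1 by linarith+
      ultimately have False using small[of k] small[of h] PQ by linarith
      then show ?thesis ..
    next
      case l: (right h)
      have lo: "- (h * Q) \<le> snd p" if "p \<in> K" for p
        using l(3)[OF that] lin[OF l(1) xr(2)[OF that]] by simp
      have "w \<le> 1 + k * Q + h * Q" by (rule strip[OF up lo])
      also have "\<dots> = 1 + (k + h) * Q" by (simp add: algebra_simps)
      finally have "w \<le> 1 + (k + h) * Q" .
      moreover have "(k + h) * Q < Q" by (rule small) (use u(2) l(2) in linarith)
      ultimately have False using PQ by linarith
      then show ?thesis ..
    qed
  qed
qed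

lemma upper_bound_gt_2:
  assumes K: "body K w" and free: "interior K \<inter> Z2 = {}" and w: "w > 2"
    and x: "\<And>p. p \<in> K \<Longrightarrow> a \<le> fst p \<and> fst p \<le> a + w"
  shows "good_gt_2 K w"
proof -
  obtain L R where LR: "L \<in> K" "fst L = a" "R \<in> K" "fst R = a + w"
    using width_attained[OF K x] by metis
  define i where "i = \<lfloor>a\<rfloor> + 1"
  have i: "a < of_int i" "of_int i \<le> a + 1" unfolding i_def by linarith+
  note cv = bodyD(2)[OF K] and ne = bodyD(3)[OF K]
  obtain y where y: "(of_int i, y) \<in> interior K"
    by (rule interior_on_vertical[OF cv ne LR(1,3)]) (use LR i w in auto)
  obtain j where j: "of_int j < y" "y < of_int j + 1" using lines_at_integer[OF cv free y] by metis
  have i': "fst L < of_int (i + 1)" "of_int (i + 1) < fst R" using LR i w by auto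
  obtain y' where y': "(of_int (i + 1), y') \<in> interior K"
    using interior_on_vertical[OF cv ne LR(1,3) i'] by blast
  obtain j' where j': "of_int j' < y'" "y' < of_int j' + 1" using lines_at_integer[OF cv free y'] by metis
  define S where "S = normal i j (j' - j)"
  have S: "umap S" unfolding S_def by (rule umap_normal)
  note iS = interior_umap[OF S, unfolded S_def, folded S_def]
  have mem: "p \<in> S ` X \<longleftrightarrow> (fst p + of_int i, snd p + of_int j + of_int (j' - j) * fst p) \<in> X" for p X
    unfolding S_def by (rule mem_normal)
  have "good_gt_2 (S ` K) w"
  proof (rule upper_bound_gt_2_normalized[OF body_iaff[OF K umap_imp_iaff[OF S]] umap_free[OF S free] w,
        where a = "a - of_int i" and ?y0.0 = "y - of_int j" and ?y1.0 = "y' - of_int j'"])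
    show "a - of_int i \<le> fst p \<and> fst p \<le> a - of_int i + w" if "p \<in> S ` K" for p
      using that[unfolded mem, THEN x] by simp
    show "(0, y - of_int j) \<in> interior (S ` K)" unfolding interior_umap[OF S] mem using y by simp
    show "(1, y' - of_int j') \<in> interior (S ` K)" unfolding interior_umap[OF S] mem using y' by (simp add: add.commute)
  qed (use i j j' w in auto)
  then show ?thesis by (rule good_gt_2_umap[OF _ S K])
qed

subsection \<open>Unbounded sets and the lattice width\<close>

lemma vertical_recession:
  fixes K :: "(real \<times> real) set"
  assumes K: "closed K" "convex K" and strip: "\<And>p. p \<in> K \<Longrightarrow> c \<le> fst p \<and> fst p \<le> d"
    and unb: "\<And>B. \<exists>q\<in>K. \<sigma> * snd q > B" and \<sigma>: "\<sigma> = 1 \<or> \<sigma> = -1"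
    and p: "p \<in> K" and h: "h \<ge> 0"
  shows "p + (0, \<sigma> * h) \<in> K"
proof (cases "h = 0")
  case False
  then have h: "h > 0" using h by simp
  have cd: "c \<le> d" using strip[OF p] by simp
  have "\<exists>r\<in>K. dist r (p + (0, \<sigma> * h)) < e" if e: "e > 0" for e
  proof -
    define N where "N = h * (d - c + 1) / e + h"
    obtain q where q: "q \<in> K" "\<sigma> * snd q > \<sigma> * snd p + N" using unb by blast
    define m where "m = \<sigma> * (snd q - snd p)"
    have m: "m > N" using q by (simp add: m_def algebra_simps)
    have "h * (d - c) / e < h * (d - c + 1) / e"
      using h e by (intro divide_strict_right_mono mult_strict_left_mono) auto
    moreover have "h * (d - c + 1) / e \<ge> 0" using h e cd by auto
    ultimately have N: "N \<ge> h" "N > h * (d - c) / e" using h by (auto simp: N_def)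
    have mp: "m > 0" using m N h by simp
    define t where "t = h / m"
    have t: "0 \<le> t" "t \<le> 1" using mp m N h by (auto simp: t_def)
    define r where "r = (1 - t) *\<^sub>R p + t *\<^sub>R q"
    have "r \<in> K" unfolding r_def using K(2) p q(1) t by (simp add: convexD)
    moreover have "r - (p + (0, \<sigma> * h)) = (t * (fst q - fst p), 0)"
    proof -
      have "\<sigma> * m = snd q - snd p" using \<sigma> by (auto simp: m_def)
      then have "t * (snd q - snd p) = \<sigma> * h" using mp by (simp add: t_def flip: \<open>\<sigma> * m = _\<close>)
      then show ?thesis by (simp add: r_def prod_eq_iff algebra_simps)
    qed
    then have "dist r (p + (0, \<sigma> * h)) = t * \<bar>fst q - fst p\<bar>"
      using t by (simp add: dist_norm abs_mult)
    moreover have "t * \<bar>fst q - fst p\<bar> \<le> t * (d - c)"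
      using strip[OF p] strip[OF q(1)] t by (intro mult_left_mono) auto
    moreover have "t * (d - c) < e"
    proof -
      have "h * (d - c) / e < m" using m N by simp
      then show ?thesis using mp e by (simp add: t_def field_simps)
    qed
    ultimately show ?thesis by force
  qed
  then show ?thesis using K(1) closed_approachable by blast
qed (use p in \<open>simp flip: zero_prod_def\<close>)

lemma unbounded_in_vertical_strip:
  fixes K :: "(real \<times> real) set"
  assumes K: "closed K" "convex K" "interior K \<noteq> {}" and unb: "\<not> bounded K"
    and strip: "\<And>p. p \<in> K \<Longrightarrow> c \<le> fst p \<and> fst p \<le> d"
  shows "emeasure lborel K = \<infinity>"
    and "interior K \<inter> Z2 = {} \<Longrightarrow> \<exists>i::int. \<forall>p\<in>K. of_int i \<le> fst p \<and> fst p \<le> of_int i + 1"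
proof -
  have "\<exists>\<sigma>::real. (\<sigma> = 1 \<or> \<sigma> = -1) \<and> (\<forall>B. \<exists>q\<in>K. \<sigma> * snd q > B)"
  proof (rule ccontr)
    assume "\<not> ?thesis"
    then obtain A B where AB: "\<forall>q\<in>K. 1 * snd q \<le> A" "\<forall>q\<in>K. -1 * snd q \<le> B"
      by (metis not_less)
    have "K \<subseteq> {c..d} \<times> {-B..A}"
    proof
      fix q assume "q \<in> K"
      then show "q \<in> {c..d} \<times> {-B..A}" using AB strip[of q] by (cases q) auto
    qed
    moreover have "bounded ({c..d} \<times> {-B..A})" by (intro bounded_Times) auto
    ultimately show False using unb bounded_subset by blast
  qed
  then obtain \<sigma> :: real where \<sigma>: "\<sigma> = 1 \<or> \<sigma> = -1" "\<And>B. \<exists>q\<in>K. \<sigma> * snd q > B" by blast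
  have rec: "p + (0, \<sigma> * h) \<in> K" if "p \<in> K" "h \<ge> 0" for p h
    by (rule vertical_recession[OF K(1,2) strip \<sigma>(2,1) that])
  obtain z e where e: "e > 0" "cball z e \<subseteq> K"
    using K(3) by (metis ex_in_conv interior_subset open_contains_cball open_interior subset_trans)
  show "emeasure lborel K = \<infinity>"
  proof (rule ccontr)
    assume "emeasure lborel K \<noteq> \<infinity>"
    then obtain r where r: "r \<ge> 0" "emeasure lborel K = ennreal r" by (cases "emeasure lborel K" rule: ennreal_cases) auto
    define n where "n = r / e + 1"
    have n: "n > 0" using r e by (simp add: n_def add_nonneg_pos)
    define lo where "lo = (if \<sigma> = 1 then snd z else snd z - n)"
    define X where "X = {p. fst z \<le> fst p \<and> fst p \<le> fst z + e \<and> lo + 0 * fst p \<le> snd p \<and> snd p \<le> (lo + n) + 0 * fst p}"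
    have "measure lborel X = n * e"
      unfolding X_def by (subst measure_linear_region) (use n e in auto)
    moreover have cX: "compact X" unfolding X_def by (rule compact_region) (intro continuous_intros)+
    ultimately have mX: "emeasure lborel X = ennreal (n * e)"
      using compact_fmeasurable[OF cX] emeasure_eq_measure2 by metis
    have "X \<subseteq> K"
    proof
      fix p assume p: "p \<in> X"
      have "(fst p, snd z) \<in> K"
        by (rule subsetD[OF e(2)], cases z) (use p in \<open>auto simp: X_def dist_Pair_Pair dist_real_def\<close>)
      from rec[OF this, of "\<sigma> * (snd p - snd z)"]
      show "p \<in> K" using p \<sigma>(1) by (cases p) (auto simp: X_def lo_def)
    qed
    then have "emeasure lborel X \<le> emeasure lborel K" using K(1) by (intro emeasure_mono) (auto simp: borel_closed)
    then have "n * e \<le> r" using mX r n e by (simp add: ennreal_le_iff)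
    moreover have "n * e = r + e" using e by (simp add: n_def field_simps)
    ultimately show False using e by simp
  qed
  assume free: "interior K \<inter> Z2 = {}"
  have no: False if LR: "L \<in> K" "R \<in> K" "fst L < of_int i" "of_int i < fst R" for L R and i :: int
  proof -
    obtain y where y: "(of_int i, y) \<in> interior K" using interior_on_vertical[OF K(2,3) LR] .
    define h where "h = (if \<sigma> = 1 then of_int \<lceil>y\<rceil> - y else y - of_int \<lfloor>y\<rfloor>)"
    have h: "h \<ge> 0" unfolding h_def by (auto simp: ceiling_correct)
    have "(\<lambda>q. (0, \<sigma> * h) + q) ` interior K \<subseteq> interior K"
    proof (rule interior_maximal)
      show "(\<lambda>q. (0, \<sigma> * h) + q) ` interior K \<subseteq> K"
        using rec[OF _ h] interior_subset[of K] by (auto simp: add.commute)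
    qed (auto intro: open_translation)
    then have "(0, \<sigma> * h) + (of_int i, y) \<in> interior K" using y by blast
    moreover have "\<exists>k::int. y + \<sigma> * h = of_int k" using \<sigma>(1) by (auto simp: h_def)
    ultimately show False using free_not_interior[OF free, of i] by (auto simp: add.commute)
  qed
  define i where "i = \<lfloor>fst z\<rfloor>"
  have zK: "z \<in> K" "z + (e, 0) \<in> K" "z - (e, 0) \<in> K"
    by (rule subsetD[OF e(2)], use e(1) in \<open>simp add: dist_norm\<close>)+
  have "fst z \<noteq> of_int i" using no[OF zK(3,2), of i] e by auto
  then have i: "of_int i < fst z" "fst z < of_int (i + 1)" unfolding i_def by linarith+
  have "of_int i \<le> fst p \<and> fst p \<le> of_int i + 1" if p: "p \<in> K" for p
    using no[OF p zK(1) _ i(1)] no[OF zK(1) p i(2)] by force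
  then show "\<exists>i::int. \<forall>p\<in>K. of_int i \<le> fst p \<and> fst p \<le> of_int i + 1" by blast
qed

lemma closed_iaff: assumes "iaff S" "closed K" shows "closed (S ` K)"
proof -
  obtain a b c d e f where S: "S = aff a b c d e f" "a * d - b * c \<noteq> 0"
    using assms(1) int_det_real unfolding iaff_def by (metis abs_zero zero_neq_one)
  obtain a' b' c' d' e' f' where i: "S \<circ> aff a' b' c' d' e' f' = id" "aff a' b' c' d' e' f' \<circ> S = id"
    using aff_inverse[OF S(2)] unfolding S(1) by metis
  show ?thesis unfolding image_eq_vimage_if_inverse[OF i]
    using assms(2) by (simp add: closed_vimage continuous_on_aff)
qed

lemma bounded_umap: assumes "umap S" shows "bounded (S ` K) \<longleftrightarrow> bounded K"
proof -
  have im: "bounded (S ` K)" if S: "umap S" and K: "bounded K" for S K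
  proof -
    have "compact (S ` closure K)" using K S by (simp add: iaff_compact umap_imp_iaff)
    then show ?thesis by (meson bounded_subset closure_subset compact_imp_bounded image_mono)
  qed
  obtain S' where S': "umap S'" "S' \<circ> S = id" using umap_inverse[OF assms] by metis
  have "S' ` S ` K = K" using S'(2) by (simp add: image_comp)
  then show ?thesis using im[OF assms] im[OF S'(1)] by metis
qed

lemma primitive_umap:
  fixes m n :: int
  assumes "coprime m n"
  obtains S where "umap S" "\<And>p. fst (S p) = of_int m * fst p + of_int n * snd p"
proof -
  obtain x y where xy: "x * m + y * n = 1" using bezout_int[of m n] assms by auto
  show ?thesis
  proof (rule that)
    show "umap (aff (of_int m) (of_int n) (of_int (- y)) (of_int x) (of_int 0) (of_int 0))"
      by (rule umapI) (use xy in \<open>simp add: algebra_simps\<close>)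
  qed simp
qed

lemma width_fun_le_iff:
  assumes "K \<noteq> {}"
  shows "(\<And>p. p \<in> K \<Longrightarrow> c \<le> u \<bullet> p \<and> u \<bullet> p \<le> d) \<Longrightarrow> width_fun K u \<le> ereal (d - c)"
    and "width_fun K u < \<infinity> \<Longrightarrow> \<exists>c d. \<forall>p\<in>K. c \<le> u \<bullet> p \<and> u \<bullet> p \<le> d"
proof -
  assume *: "\<And>p. p \<in> K \<Longrightarrow> c \<le> u \<bullet> p \<and> u \<bullet> p \<le> d"
  have "(SUP x\<in>K. ereal (u \<bullet> x)) \<le> ereal d" "(INF x\<in>K. ereal (u \<bullet> x)) \<ge> ereal c"
    using * by (auto intro!: SUP_least INF_greatest)
  then have "width_fun K u \<le> ereal d - ereal c" unfolding width_fun_def by (intro ereal_minus_mono)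
  then show "width_fun K u \<le> ereal (d - c)" by simp
next
  assume f: "width_fun K u < \<infinity>"
  obtain p where p: "p \<in> K" using assms by blast
  define A B where "A = (SUP x\<in>K. ereal (u \<bullet> x))" and "B = (INF x\<in>K. ereal (u \<bullet> x))"
  have A: "ereal (u \<bullet> x) \<le> A" and B: "B \<le> ereal (u \<bullet> x)" if "x \<in> K" for x
    using that unfolding A_def B_def by (auto intro: SUP_upper INF_lower)
  have AB: "A - B < \<infinity>" using f by (simp add: width_fun_def A_def B_def)
  obtain d where d: "A = ereal d"
    using A[OF p] B[OF p] AB by (cases A; cases B) auto
  obtain c where c: "B = ereal c"
    using A[OF p] B[OF p] AB by (cases A; cases B) auto
  show "\<exists>c d. \<forall>p\<in>K. c \<le> u \<bullet> p \<and> u \<bullet> p \<le> d" using A B unfolding c d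
    by (intro exI[of _ c] exI[of _ d]) auto
qed

lemma width_fun_attained:
  assumes K: "compact K" "K \<noteq> {}"
  obtains p q where "p \<in> K" "q \<in> K" "\<And>r. r \<in> K \<Longrightarrow> u \<bullet> q \<le> u \<bullet> r \<and> u \<bullet> r \<le> u \<bullet> p"
    "width_fun K u = ereal (u \<bullet> p - u \<bullet> q)"
proof -
  have c: "continuous_on K (\<lambda>x. u \<bullet> x)" by (intro continuous_intros)
  obtain p where p: "p \<in> K" "\<And>r. r \<in> K \<Longrightarrow> u \<bullet> r \<le> u \<bullet> p" using continuous_attains_sup[OF K c] by blast
  obtain q where q: "q \<in> K" "\<And>r. r \<in> K \<Longrightarrow> u \<bullet> q \<le> u \<bullet> r" using continuous_attains_inf[OF K c] by blast
  have "(SUP x\<in>K. ereal (u \<bullet> x)) = ereal (u \<bullet> p)" using p by (intro SUP_eqI) auto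
  moreover have "(INF x\<in>K. ereal (u \<bullet> x)) = ereal (u \<bullet> q)" using q by (intro INF_eqI) auto
  ultimately show ?thesis using that p q by (simp add: width_fun_def)
qed

lemma finite_Z2_box: "finite {u \<in> Z2. \<bar>fst u\<bar> \<le> B \<and> \<bar>snd u\<bar> \<le> B}" (is "finite ?X")
proof -
  let ?N = "{- \<lceil>B\<rceil>..\<lceil>B\<rceil>}"
  have "?X \<subseteq> (\<lambda>(i, j). (of_int i, of_int j)) ` (?N \<times> ?N)"
  proof
    fix u assume u: "u \<in> ?X"
    then obtain i j :: int where ij: "u = (of_int i, of_int j)"
      unfolding Z2_def by (auto elim!: Ints_cases)
    have "i \<in> ?N" "j \<in> ?N" using u unfolding ij by auto linarith+
    then show "u \<in> (\<lambda>(i, j). (of_int i, of_int j)) ` (?N \<times> ?N)" unfolding ij by force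
  qed
  then show ?thesis by (rule finite_subset) auto
qed

lemma lattice_width_attained:
  assumes K: "compact K" "interior K \<noteq> {}"
  obtains u where "u \<in> Z2 - {0}" "lattice_width K = width_fun K u" "\<And>v. v \<in> Z2 - {0} \<Longrightarrow> width_fun K u \<le> width_fun K v"
proof -
  obtain z e where e: "e > 0" "cball z e \<subseteq> K"
    using K(2) by (metis ex_in_conv interior_subset open_contains_cball open_interior subset_trans)
  have zK: "z \<in> K" "z + (e, 0) \<in> K" "z - (e, 0) \<in> K" "z + (0, e) \<in> K" "z - (0, e) \<in> K"
    by (rule subsetD[OF e(2)], use e(1) in \<open>simp add: dist_norm\<close>)+
  have ne: "K \<noteq> {}" using zK by auto
  have big: "ereal (2 * e * \<bar>fst u\<bar>) \<le> width_fun K u \<and> ereal (2 * e * \<bar>snd u\<bar>) \<le> width_fun K u" for u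
  proof -
    obtain p q where pq: "\<And>r. r \<in> K \<Longrightarrow> u \<bullet> q \<le> u \<bullet> r \<and> u \<bullet> r \<le> u \<bullet> p" "width_fun K u = ereal (u \<bullet> p - u \<bullet> q)"
      using width_fun_attained[OF K(1) ne] by metis
    show ?thesis unfolding pq(2)
      using pq(1)[OF zK(2)] pq(1)[OF zK(3)] pq(1)[OF zK(4)] pq(1)[OF zK(5)]
      by (auto simp: inner_prod_def abs_if algebra_simps)
  qed
  obtain M where M: "width_fun K (1, 0) = ereal M" using width_fun_attained[OF K(1) ne] by metis
  define X where "X = {u \<in> Z2 - {0}. width_fun K u \<le> width_fun K (1, 0)}"
  have "X \<subseteq> {u \<in> Z2. \<bar>fst u\<bar> \<le> M / (2 * e) \<and> \<bar>snd u\<bar> \<le> M / (2 * e)}"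
  proof
    fix u assume u: "u \<in> X"
    then have "width_fun K u \<le> ereal M" by (auto simp: X_def M)
    then have "ereal (2 * e * \<bar>fst u\<bar>) \<le> ereal M" "ereal (2 * e * \<bar>snd u\<bar>) \<le> ereal M"
      using big[of u] order_trans by blast+
    then show "u \<in> {u \<in> Z2. \<bar>fst u\<bar> \<le> M / (2 * e) \<and> \<bar>snd u\<bar> \<le> M / (2 * e)}"
      using u e by (auto simp: X_def field_simps)
  qed
  then have fin: "finite X" using finite_Z2_box finite_subset by blast
  have inX: "(1, 0) \<in> X" by (auto simp: X_def Z2_def zero_prod_def)
  obtain u where u: "u \<in> X" "\<And>v. v \<in> X \<Longrightarrow> width_fun K u \<le> width_fun K v"
  proof -
    have "finite (width_fun K ` X)" "width_fun K ` X \<noteq> {}" using fin inX by auto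
    then obtain u where "u \<in> X" "width_fun K u = Min (width_fun K ` X)" using Min_in by (metis imageE)
    then show ?thesis using fin by (intro that) auto
  qed
  have min: "width_fun K u \<le> width_fun K v" if "v \<in> Z2 - {0}" for v
  proof (cases "v \<in> X")
    case False
    then have "width_fun K (1, 0) \<le> width_fun K v" using that by (auto simp: X_def)
    then show ?thesis using u(2)[OF inX] by order
  qed (use u in auto)
  show ?thesis
  proof (rule that)
    show "u \<in> Z2 - {0}" using u by (auto simp: X_def)
    then show "lattice_width K = width_fun K u"
      unfolding lattice_width_def using min by (intro INF_eqI) auto
  qed (rule min)
qed

lemma lattice_width_normal_form:
  assumes K: "compact K" "convex K" "interior K \<noteq> {}" and pos: "0 < lattice_width K"
  obtains w S a where "lattice_width K = ereal w" "body K w" "umap S"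
    "\<And>p. p \<in> S ` K \<Longrightarrow> a \<le> fst p \<and> fst p \<le> a + w"
proof -
  have ne: "K \<noteq> {}" using K by auto
  obtain u where u: "u \<in> Z2 - {0}" "lattice_width K = width_fun K u" "\<And>v. v \<in> Z2 - {0} \<Longrightarrow> width_fun K u \<le> width_fun K v"
    using lattice_width_attained[OF K(1,3)] by metis
  obtain p q where pq: "p \<in> K" "q \<in> K" "\<And>r. r \<in> K \<Longrightarrow> u \<bullet> q \<le> u \<bullet> r \<and> u \<bullet> r \<le> u \<bullet> p"
    "width_fun K u = ereal (u \<bullet> p - u \<bullet> q)"
    using width_fun_attained[OF K(1) ne] by metis
  define w where "w = u \<bullet> p - u \<bullet> q"
  have w: "lattice_width K = ereal w" "w > 0" using u(2) pq(4) pos by (auto simp: w_def)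
  have wide: "wide K w"
    unfolding wide_def
  proof (intro allI impI)
    fix m n :: int assume mn: "(m, n) \<noteq> (0, 0)"
    let ?v = "(of_int m, of_int n) :: real \<times> real"
    have v: "?v \<in> Z2 - {0}" using mn by (auto simp: Z2_def zero_prod_def)
    obtain p' q' where p': "p' \<in> K" "q' \<in> K" "width_fun K ?v = ereal (?v \<bullet> p' - ?v \<bullet> q')"
      using width_fun_attained[OF K(1) ne] by metis
    have "w \<le> ?v \<bullet> p' - ?v \<bullet> q'" using u(3)[OF v] p'(3) pq(4) by (simp add: w_def)
    then show "\<exists>p\<in>K. \<exists>q\<in>K. w \<le> of_int m * (fst p - fst q) + of_int n * (snd p - snd q)"
      using p'(1,2) by (intro bexI[of _ p'] bexI[of _ q']) (auto simp: inner_prod_def algebra_simps)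
  qed
  obtain m n :: int where mn: "u = (of_int m, of_int n)" using u(1) unfolding Z2_def by (auto elim!: Ints_cases)
  have mn0: "m \<noteq> 0 \<or> n \<noteq> 0" using u(1) by (auto simp: mn zero_prod_def)
  have "coprime m n"
  proof -
    define g where "g = gcd m n"
    have g: "g > 0" using mn0 by (auto simp: g_def)
    obtain m' n' where m': "m = g * m'" "n = g * n'" by (metis g_def gcd_dvd1 gcd_dvd2 dvdE)
    have "(m', n') \<noteq> (0, 0)" using mn0 m' by auto
    then obtain p' q' where p': "p' \<in> K" "q' \<in> K" "w \<le> of_int m' * (fst p' - fst q') + of_int n' * (snd p' - snd q')"
      using wide unfolding wide_def by blast
    have "of_int g * w \<le> of_int g * (of_int m' * (fst p' - fst q') + of_int n' * (snd p' - snd q'))"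
      using p'(3) g by (intro mult_left_mono) auto
    also have "\<dots> = u \<bullet> p' - u \<bullet> q'" by (simp add: mn m' inner_prod_def algebra_simps)
    also have "\<dots> \<le> 1 * w" using pq(3)[OF p'(1)] pq(3)[OF p'(2)] by (simp add: w_def)
    finally have "of_int g \<le> (1::real)" using w(2) by simp
    then have "g = 1" using g by simp
    then show ?thesis by (simp add: g_def coprime_iff_gcd_eq_1)
  qed
  then obtain S where S: "umap S" "\<And>p. fst (S p) = of_int m * fst p + of_int n * snd p"
    using primitive_umap by blast
  show ?thesis
  proof (rule that[OF w(1) _ S(1), of "u \<bullet> q"])
    show "body K w" using K wide by (simp add: body_def)
    fix r assume "r \<in> S ` K"
    then obtain r' where "r' \<in> K" "fst r = u \<bullet> r'" by (auto simp: S(2) mn inner_prod_def)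
    then show "u \<bullet> q \<le> fst r \<and> fst r \<le> u \<bullet> q + w" using pq(3)[of r'] by (simp add: w_def)
  qed
qed

lemma unbounded_lattice_free:
  assumes K: "closed K" "convex K" "interior K \<noteq> {}" "interior K \<inter> Z2 = {}" and unb: "\<not> bounded K"
    and fin: "lattice_width K < \<infinity>"
  shows "emeasure lborel K = \<infinity>" "\<exists>S. is_split S \<and> K \<subseteq> S" "lattice_width K \<le> 1"
proof -
  have ne: "K \<noteq> {}" using K by auto
  obtain u where u: "u \<in> Z2 - {0}" "width_fun K u < \<infinity>"
    using fin unfolding lattice_width_def INF_less_iff by blast
  obtain c d where cd: "\<And>p. p \<in> K \<Longrightarrow> c \<le> u \<bullet> p \<and> u \<bullet> p \<le> d" using width_fun_le_iff(2)[OF ne u(2)] by blast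
  obtain m n :: int where mn: "u = (of_int m, of_int n)" using u(1) unfolding Z2_def by (auto elim!: Ints_cases)
  have mn0: "m \<noteq> 0 \<or> n \<noteq> 0" using u(1) by (auto simp: mn zero_prod_def)
  define g where "g = gcd m n"
  have g: "g > 0" using mn0 by (auto simp: g_def)
  obtain m' n' where m': "m = g * m'" "n = g * n'" "coprime m' n'"
    using gcd_coprime_exists[of m n] g unfolding g_def by (metis mult.commute less_irrefl)
  obtain S where S: "umap S" "\<And>p. fst (S p) = of_int m' * fst p + of_int n' * snd p"
    using primitive_umap[OF m'(3)] by blast
  note iS = umap_imp_iaff[OF S(1)]
  have strip: "c / of_int g \<le> fst p \<and> fst p \<le> d / of_int g" if "p \<in> S ` K" for p
  proof -
    obtain p' where p': "p' \<in> K" "p = S p'" using \<open>p \<in> S ` K\<close> by blast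
    have "u \<bullet> p' = of_int g * fst p" by (simp add: p'(2) S(2) mn m' inner_prod_def algebra_simps)
    then show ?thesis using cd[OF p'(1)] g by (simp add: field_simps)
  qed
  have SK: "closed (S ` K)" "convex (S ` K)" "interior (S ` K) \<noteq> {}" "\<not> bounded (S ` K)" 
    using K unb S(1) by (simp_all add: closed_iaff iS iaff_convex iaff_interior[OF iS] bounded_umap)
  have free: "interior (S ` K) \<inter> Z2 = {}" by (rule umap_free[OF S(1) K(4)])
  note ub = unbounded_in_vertical_strip[OF SK(1-4) strip]
  show "emeasure lborel K = \<infinity>" using ub(1) iaff_emeasure[OF iS K(1)] by simp
  obtain i :: int where "\<forall>p\<in>S ` K. of_int i \<le> fst p \<and> fst p \<le> of_int i + 1" using ub(2) free by blast
  then have i: "of_int i \<le> of_int m' * fst p + of_int n' * snd p \<and> of_int m' * fst p + of_int n' * snd p \<le> of_int i + 1"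
    if "p \<in> K" for p unfolding S(2)[symmetric] using that by blast
  have "is_split {x. of_int i \<le> of_int m' * fst x + of_int n' * snd x \<and> of_int m' * fst x + of_int n' * snd x \<le> of_int i + 1}"
    unfolding is_split_def using m'(3) by blast
  then show "\<exists>S. is_split S \<and> K \<subseteq> S" using i by blast
  let ?v = "(of_int m', of_int n') :: real \<times> real"
  have v: "?v \<in> Z2 - {0}" using m' mn0 by (auto simp: Z2_def zero_prod_def)
  have "width_fun K ?v \<le> ereal ((of_int i + 1) - of_int i)"
    by (rule width_fun_le_iff(1)[OF ne]) (use i in \<open>auto simp: inner_prod_def\<close>)
  then have "width_fun K ?v \<le> 1" by (simp add: one_ereal_def)
  then show "lattice_width K \<le> 1" unfolding lattice_width_def using INF_lower[OF v, of "width_fun K"] by order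
qed

lemma collinear_if_cross_eq_0:
  assumes "cross p q r = 0" shows "collinear {p, q, r}"
proof -
  have c: "(fst q - fst p) * (snd r - snd p) = (fst r - fst p) * (snd q - snd p)"
    using assms by (simp add: cross_def)
  have pt: "r = u *\<^sub>R q + (1 - u) *\<^sub>R p"
    if "u * (fst q - fst p) = fst r - fst p" "u * (snd q - snd p) = snd r - snd p" for u
    using that by (simp add: prod_eq_iff algebra_simps)
  have "q = p \<or> (\<exists>u. r = u *\<^sub>R q + (1 - u) *\<^sub>R p)"
  proof (cases "fst q = fst p")
    case False
    then show ?thesis using c[symmetric]
      by (intro disjI2 exI[of _ "(fst r - fst p) / (fst q - fst p)"] pt) (simp_all add: nonzero_eq_divide_eq mult.commute)
  next
    case x: True
    show ?thesis
    proof (cases "snd q = snd p")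
      case False
      then show ?thesis using c x
        by (intro disjI2 exI[of _ "(snd r - snd p) / (snd q - snd p)"] pt) simp_all
    qed (use x in \<open>simp add: prod_eq_iff\<close>)
  qed
  then show ?thesis using collinear_3_expand[of q r p] by (auto simp: insert_commute)
qed

lemma cross_Z2_abs_ge_1:
  assumes "p \<in> Z2" "q \<in> Z2" "r \<in> Z2" "cross p q r \<noteq> 0"
  shows "1 \<le> \<bar>cross p q r\<bar>"
proof -
  obtain a b c d e f :: int where "p = (of_int a, of_int b)" "q = (of_int c, of_int d)" "r = (of_int e, of_int f)"
    using assms(1-3) unfolding Z2_def by (auto elim!: Ints_cases)
  then have k: "cross p q r = of_int ((c - a) * (f - b) - (e - a) * (d - b))" (is "_ = of_int ?k")
    by (simp add: cross_def)
  have "?k \<noteq> 0" using assms(4) unfolding k by (metis of_int_0)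
  then have "1 \<le> \<bar>?k\<bar>" by linarith
  then have "real_of_int 1 \<le> of_int \<bar>?k\<bar>" by (simp only: of_int_le_iff)
  then show ?thesis unfolding k by (simp only: of_int_abs of_int_1)
qed

lemma lam_equation:
  assumes w: "w > 2" "1 + 6 * w - 3 * w\<^sup>2 \<ge> 0"
  shows "1 - 3 * lam w + 3 * (lam w)\<^sup>2 = lam w / w" "lam w > 0"
proof -
  define s where "s = 1 + 6 * w - 3 * w\<^sup>2"
  define r where "r = sqrt s"
  have r: "r\<^sup>2 = s" using w by (simp add: r_def s_def)
  have l: "lam w = (3 * w + 1 - r) / (6 * w)" by (simp only: lam_def s_def r_def)
  have "(3 * w + 1 - r)\<^sup>2 - 2 * (3 * w + 1) * (3 * w + 1 - r) + 12 * w\<^sup>2 = r\<^sup>2 - s"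
    by (simp add: s_def power2_eq_square algebra_simps)
  moreover have r6: "3 * w + 1 - r = 6 * w * lam w" using w by (simp add: l)
  ultimately have "(6 * w * lam w)\<^sup>2 - 2 * (3 * w + 1) * (6 * w * lam w) + 12 * w\<^sup>2 = 0"
    using r by simp
  then have "12 * w * (3 * w * (lam w)\<^sup>2 - (3 * w + 1) * lam w + w) = 0"
    by (simp add: power2_eq_square algebra_simps)
  then have "3 * w * (lam w)\<^sup>2 - (3 * w + 1) * lam w + w = 0" using w by simp
  then show "1 - 3 * lam w + 3 * (lam w)\<^sup>2 = lam w / w" using w by (simp add: field_simps)
  have "s < (3 * w + 1)\<^sup>2" using w by (simp add: s_def power2_eq_square algebra_simps add_pos_pos)
  then have "r < 3 * w + 1" using w unfolding r_def by (intro real_less_lsqrt) auto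
  then show "lam w > 0" using w by (simp add: l)
qed

lemma pivot_triangle_measure:
  assumes w: "w > 2" "1 + 6 * w - 3 * w\<^sup>2 \<ge> 0" and p: "pivot_triangle K (lam w)"
  shows "tri_bound w \<le> measure lborel K"
proof -
  define l where "l = lam w"
  note le = lam_equation[OF w, folded l_def]
  obtain q0 q1 q2 where q: "\<not> collinear {q0, q1, q2}" "K = convex hull {q0, q1, q2}"
    "l *\<^sub>R q1 + (1 - l) *\<^sub>R q2 \<in> Z2" "l *\<^sub>R q2 + (1 - l) *\<^sub>R q0 \<in> Z2" "l *\<^sub>R q0 + (1 - l) *\<^sub>R q1 \<in> Z2"
    using p unfolding pivot_triangle_def l_def by blast
  have c0: "cross q0 q1 q2 \<noteq> 0" using collinear_if_cross_eq_0 q(1) by blast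
  have e: "cross (l *\<^sub>R q1 + (1 - l) *\<^sub>R q2) (l *\<^sub>R q2 + (1 - l) *\<^sub>R q0) (l *\<^sub>R q0 + (1 - l) *\<^sub>R q1)
      = l / w * cross q0 q1 q2"
    unfolding le(1)[symmetric] by (simp add: cross_def power2_eq_square algebra_simps)
  have lw: "l / w > 0" using le w by simp
  then have "l / w * cross q0 q1 q2 \<noteq> 0" using c0 by (simp only: mult_eq_0_iff) auto
  then have "1 \<le> \<bar>l / w * cross q0 q1 q2\<bar>"
    using cross_Z2_abs_ge_1[OF q(3-5)] unfolding e by blast
  then have "1 \<le> l / w * \<bar>cross q0 q1 q2\<bar>" using lw by (simp only: abs_mult abs_of_pos)
  then have "w / l \<le> \<bar>cross q0 q1 q2\<bar>" using le w by (simp add: field_simps)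
  moreover have "tri_bound w = w / l / 2" using tri_bound_lam w by (simp add: l_def)
  ultimately show ?thesis unfolding q(2) measure_triangle[OF c0] by simp
qed

lemma tri_eq_scaled:
  "(\<lambda>x. (w / 2) *\<^sub>R x) ` (convex hull {(1, 0), (0, 1), (-1, -1)}) = tri w"
  unfolding tri_def convex_hull_scaling[symmetric] by simp

lemma measure_tri: "w > 0 \<Longrightarrow> measure lborel (tri w) = 3/8 * w\<^sup>2"
proof -
  assume w: "w > 0"
  have c: "cross (w/2, 0) (0, w/2) (- w/2, - w/2) = 3/4 * w\<^sup>2"
    by (simp add: cross_def power2_eq_square)
  show ?thesis
    unfolding tri_def using measure_triangle[of "(w/2, 0)" "(0, w/2)" "(- w/2, - w/2)"] w unfolding c by simp
qed

lemma iaff_translation: "iaff ((+) t)"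
proof -
  have "(+) t = aff (of_int 1) (of_int 0) (of_int 0) (of_int 1) (fst t) (snd t)"
    by (auto simp: fun_eq_iff prod_eq_iff)
  then show ?thesis using iaffI[of 1 1 0 0 "fst t" "snd t"] by simp
qed

lemma compact_tri: "compact (tri w)"
  by (simp add: tri_def finite_imp_compact_convex_hull)

lemma equality_lower_bound_iff:
  assumes K: "closed K" and w: "w > 0" and eq: "measure lborel K = 3/8 * w\<^sup>2 \<Longrightarrow> \<exists>S. iaff S \<and> S ` K = tri w"
  shows "measure lborel K = 3/8 * w\<^sup>2 \<longleftrightarrow>
    (\<exists>T t. unimodular T \<and> T ` K = (\<lambda>x. t + x) ` ((\<lambda>x. (w / 2) *\<^sub>R x) ` (convex hull {(1, 0), (0, 1), (-1, -1)})))"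
proof
  assume "measure lborel K = 3/8 * w\<^sup>2"
  then obtain S where S: "iaff S" "S ` K = tri w" using eq by blast
  then obtain a b c d :: int and e f where abcd: "\<bar>a*d - b*c\<bar> = 1" "S = aff (of_int a) (of_int b) (of_int c) (of_int d) e f"
    unfolding iaff_def by blast
  define T where "T = aff (of_int a) (of_int b) (of_int c) (of_int d) (of_int 0) (of_int 0)"
  have T: "unimodular T" unfolding T_def by (rule umap_unimodular[OF umapI[OF abcd(1)]])
  have "T p = (- e, - f) + S p" for p by (simp add: T_def abcd(2) prod_eq_iff)
  then have "T ` K = (\<lambda>x. (- e, - f) + x) ` tri w" unfolding S(2)[symmetric] by (simp add: image_image)
  then show "\<exists>T t. unimodular T \<and> T ` K = (\<lambda>x. t + x) ` ((\<lambda>x. (w / 2) *\<^sub>R x) ` (convex hull {(1, 0), (0, 1), (-1, -1)}))"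
    unfolding tri_eq_scaled using T by blast
next
  assume "\<exists>T t. unimodular T \<and> T ` K = (\<lambda>x. t + x) ` ((\<lambda>x. (w / 2) *\<^sub>R x) ` (convex hull {(1, 0), (0, 1), (-1, -1)}))"
  then obtain T t where T: "unimodular T" "T ` K = (\<lambda>x. t + x) ` tri w" unfolding tri_eq_scaled by blast
  have "measure lborel K = measure lborel (T ` K)"
    using iaff_measure[OF umap_imp_iaff[OF unimodular_imp_umap[OF T(1)]] K] by simp
  also have "\<dots> = 3/8 * w\<^sup>2"
    unfolding T(2) using iaff_measure[OF iaff_translation compact_imp_closed[OF compact_tri]] measure_tri[OF w] by simp
  finally show "measure lborel K = 3/8 * w\<^sup>2" .
qed

lemma sqrt_condition:
  assumes "w \<le> 1 + 2 / sqrt 3" "w > 2"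
  shows "1 + 6 * w - 3 * w\<^sup>2 \<ge> 0"
proof -
  have "(w - 1)\<^sup>2 \<le> (2 / sqrt 3)\<^sup>2" using assms by (intro power_mono) auto
  also have "\<dots> = 4 / 3" by (simp add: power_divide)
  finally show ?thesis by (simp add: power2_eq_square algebra_simps)
qed

theorem theorem2:
  fixes K :: "(real \<times> real) set" and w :: real and A :: ennreal
  assumes "closed K" and "convex K" and "interior K \<noteq> {}" and "interior K \<inter> Z2 = {}"
  defines "w \<equiv> real_of_ereal (lattice_width K)"
      and "A \<equiv> area K"
  shows
    "(0 < lattice_width K \<and> lattice_width K \<le> 1 \<longrightarrow> A \<le> \<infinity>)
   \<and> (1 < lattice_width K \<and> lattice_width K \<le> 2 \<longrightarrow> A \<le> ennreal (w\<^sup>2 / (2 * (w - 1))))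
   \<and> (2 < lattice_width K \<and> lattice_width K \<le> ereal (1 + 2 / sqrt 3) \<longrightarrow>
        A \<le> ennreal (3 * w\<^sup>2 / (3 * w + 1 - sqrt (1 + 6 * w - 3 * w\<^sup>2))))
   \<and> (0 < lattice_width K \<and> lattice_width K \<le> ereal (1 + 2 / sqrt 3) \<longrightarrow>
        ennreal (3 / 8 * w\<^sup>2) \<le> A)
   \<and> (0 < lattice_width K \<and> lattice_width K \<le> 1 \<longrightarrow>
        (A = \<infinity> \<longleftrightarrow> \<not> bounded K \<and> (\<exists>S. is_split S \<and> K \<subseteq> S)))
   \<and> (1 < lattice_width K \<and> lattice_width K \<le> 2 \<longrightarrow>
        (A = ennreal (w\<^sup>2 / (2 * (w - 1))) \<longleftrightarrow>
          (\<exists>T t1 t2. unimodular T \<and>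
             (let I1 = (\<lambda>x. t1 + x) ` (convex hull {(0, 0), (w, 0)});
                  I2 = (\<lambda>x. t2 + x) ` (convex hull {(0, 0), (0, w / (w - 1))})
              in I1 \<inter> I2 \<noteq> {} \<and> T ` K = convex hull (I1 \<union> I2)))))
   \<and> (2 < lattice_width K \<and> lattice_width K \<le> ereal (1 + 2 / sqrt 3) \<longrightarrow>
        (A = ennreal (3 * w\<^sup>2 / (3 * w + 1 - sqrt (1 + 6 * w - 3 * w\<^sup>2))) \<longleftrightarrow>
          (let lam = (3 * w + 1 - sqrt (1 + 6 * w - 3 * w\<^sup>2)) / (6 * w)
           in \<exists>q0 q1 q2. \<not> collinear {q0, q1, q2} \<and> K = convex hull {q0, q1, q2}
               \<and> lam *\<^sub>R q1 + (1 - lam) *\<^sub>R q2 \<in> Z2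
               \<and> lam *\<^sub>R q2 + (1 - lam) *\<^sub>R q0 \<in> Z2
               \<and> lam *\<^sub>R q0 + (1 - lam) *\<^sub>R q1 \<in> Z2)))
   \<and> (0 < lattice_width K \<and> lattice_width K \<le> 2 \<longrightarrow>
        (A = ennreal (3 / 8 * w\<^sup>2) \<longleftrightarrow>
          (\<exists>T t. unimodular T \<and>
             T ` K = (\<lambda>x. t + x) ` ((\<lambda>x. (w / 2) *\<^sub>R x) ` (convex hull {(1, 0), (0, 1), (-1, -1)})))))"
proof (cases "bounded K \<and> 0 < lattice_width K")
  case True
  have K: "compact K" "convex K" "interior K \<noteq> {}" using assms True by (auto simp: compact_eq_bounded_closed)
  obtain v S a where v: "lattice_width K = ereal v" "body K v" "umap S"
    "\<And>p. p \<in> S ` K \<Longrightarrow> a \<le> fst p \<and> fst p \<le> a + v"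
    using lattice_width_normal_form[OF K] True by metis
  have w: "w = v" "lattice_width K = ereal w" "w > 0" using v True by (auto simp: w_def)
  have b: "body K w" using v(2) w by simp
  note iS = umap_imp_iaff[OF v(3)]
  note bS = body_iaff[OF b iS] and fS = umap_free[OF v(3) assms(4)]
  have range: "a \<le> fst p \<and> fst p \<le> a + w" if "p \<in> S ` K" for p using v(4)[OF that] w by simp
  have mS: "measure lborel (S ` K) = measure lborel K" by (rule body_measure[OF b iS])
  define m where "m = measure lborel K"
  have A: "A = ennreal m" unfolding A_def area_def m_def
    using emeasure_bounded_finite[of K] True by (simp add: emeasure_eq_ennreal_measure less_top)
  have m0: "m \<ge> 0" by (simp add: m_def)
  have eqA: "A = ennreal x \<longleftrightarrow> m = x" and leA: "A \<le> ennreal x \<longleftrightarrow> m \<le> x" and geA: "ennreal x \<le> A \<longleftrightarrow> x \<le> m"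
    if "x \<ge> 0" for x using that m0 by (auto simp: A ennreal_le_iff)
  note lb = lower_bound[OF bodyD(1-3)[OF bS] w(3) bodyD(4)[OF bS] range, unfolded mS]
  have low: "3/8 * w\<^sup>2 \<le> m" unfolding m_def by (rule lb(1))
  have lowE: "\<exists>S. iaff S \<and> S ` K = tri w" if "measure lborel K = 3/8 * w\<^sup>2"
  proof -
    have "\<exists>S'. iaff S' \<and> S' ` S ` K = tri w" by (rule lb(2)[OF _ that])
    then obtain S' where "iaff S'" "S' ` S ` K = tri w" by blast
    then show ?thesis using iS by (intro exI[of _ "S' \<circ> S"]) (auto simp: iaff_comp image_comp)
  qed
  have two: "m \<le> w\<^sup>2 / (2 * (w - 1)) \<and> (m = w\<^sup>2 / (2 * (w - 1)) \<longleftrightarrow> cross_shape K w)" if w2: "1 < w" "w \<le> 2"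
  proof -
    have u: "m \<le> w\<^sup>2 / (2 * (w - 1)) \<and> (m = w\<^sup>2 / (2 * (w - 1)) \<longrightarrow> cross_shape (S ` K) w)"
      by (rule upper_bound_le_2[OF bS fS w2 range, unfolded mS, folded m_def])
    moreover have "w\<^sup>2 / (2 * (w - 1)) \<le> m" if "cross_shape K w"
      unfolding m_def by (rule cross_shape_measure[OF K(1) w2(1) that])
    ultimately show ?thesis using cross_shape_umap[OF _ v(3), of K w] by (meson order_antisym)
  qed
  have three: "m \<le> tri_bound w \<and> (m = tri_bound w \<longleftrightarrow> pivot_triangle K (lam w))"
    if w2: "2 < w" "w \<le> 1 + 2 / sqrt 3"
  proof -
    have "good_gt_2 K w" by (rule good_gt_2_umap[OF upper_bound_gt_2[OF bS fS w2(1) range] v(3) b])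
    moreover have "tri_bound w \<le> m" if "pivot_triangle K (lam w)"
      unfolding m_def by (rule pivot_triangle_measure[OF w2(1) sqrt_condition[OF w2(2,1)] that])
    ultimately show ?thesis unfolding good_gt_2_def m_def by (meson order_antisym)
  qed
  have tb: "0 \<le> tri_bound w" if "2 < w" "w \<le> 1 + 2 / sqrt 3"
    using three[OF that] m0 by simp
  have lw: "1 < lattice_width K \<longleftrightarrow> 1 < w" "2 < lattice_width K \<longleftrightarrow> 2 < w"
    "lattice_width K \<le> 2 \<longleftrightarrow> w \<le> 2" "lattice_width K \<le> ereal x \<longleftrightarrow> w \<le> x" for x
    unfolding w(2) by (simp_all add: one_ereal_def numeral_eq_ereal)
  have "A \<noteq> \<infinity>" by (simp add: A)
  have sq: "0 \<le> w\<^sup>2 / (2 * (w - 1))" if "1 < w" using that by simp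
  have iff2: "A = ennreal (w\<^sup>2 / (2 * (w - 1))) \<longleftrightarrow> cross_shape K w" if "1 < w" "w \<le> 2"
    using two[OF that] eqA[OF sq[OF that(1)]] by simp
  have iff3: "A = ennreal (tri_bound w) \<longleftrightarrow> pivot_triangle K (lam w)" if "2 < w" "w \<le> 1 + 2 / sqrt 3"
    using three[OF that] eqA[OF tb[OF that]] by simp
  have "0 \<le> 3 / 8 * w\<^sup>2" by simp
  note iff4 = equality_lower_bound_iff[OF assms(1) w(3) lowE, folded m_def, folded eqA[OF this]]
  show ?thesis
    unfolding lw cross_shape_def[symmetric] lam_def[symmetric] pivot_triangle_def[symmetric] tri_bound_def[symmetric]
  proof (intro conjI)
    show "0 < lattice_width K \<and> lattice_width K \<le> 1 \<longrightarrow> A \<le> \<infinity>" by simp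
    show "1 < w \<and> w \<le> 2 \<longrightarrow> A \<le> ennreal (w\<^sup>2 / (2 * (w - 1)))" using two leA[OF sq] by blast
    show "2 < w \<and> w \<le> 1 + 2 / sqrt 3 \<longrightarrow> A \<le> ennreal (tri_bound w)" using three leA[OF tb] by blast
    show "0 < lattice_width K \<and> w \<le> 1 + 2 / sqrt 3 \<longrightarrow> ennreal (3 / 8 * w\<^sup>2) \<le> A" using low geA[of "3 / 8 * w\<^sup>2"] by simp
    show "0 < lattice_width K \<and> lattice_width K \<le> 1 \<longrightarrow> (A = \<infinity>) = (\<not> bounded K \<and> (\<exists>S. is_split S \<and> K \<subseteq> S))"
      using True \<open>A \<noteq> \<infinity>\<close> by blast
    show "1 < w \<and> w \<le> 2 \<longrightarrow> (A = ennreal (w\<^sup>2 / (2 * (w - 1)))) = cross_shape K w" using iff2 by blast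
    show "2 < w \<and> w \<le> 1 + 2 / sqrt 3 \<longrightarrow> (A = ennreal (tri_bound w)) = Let (lam w) (pivot_triangle K)"
      unfolding Let_def using iff3 by blast
    show "0 < lattice_width K \<and> w \<le> 2 \<longrightarrow> (A = ennreal (3 / 8 * w\<^sup>2)) = (\<exists>T t. unimodular T \<and>
       T ` K = (\<lambda>x. t + x) ` ((\<lambda>x. (w / 2) *\<^sub>R x) ` (convex hull {(1, 0), (0, 1), (-1, -1)})))"
      using iff4 by (intro impI)
  qed
next
  case False
  show ?thesis
  proof (cases "0 < lattice_width K \<and> lattice_width K < \<infinity>")
    case fin: True
    then have unb: "\<not> bounded K" using False by simp
    note u = unbounded_lattice_free[OF assms(1-4) unb conjunct2[OF fin]]
    have A: "A = \<infinity>" using u(1) by (simp add: A_def area_def)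
    have no: "\<not> (\<exists>T t. unimodular T \<and>
             T ` K = (\<lambda>x. t + x) ` ((\<lambda>x. (w / 2) *\<^sub>R x) ` (convex hull {(1, 0), (0, 1), (-1, -1)})))"
    proof
      assume "\<exists>T t. unimodular T \<and>
             T ` K = (\<lambda>x. t + x) ` ((\<lambda>x. (w / 2) *\<^sub>R x) ` (convex hull {(1, 0), (0, 1), (-1, -1)}))"
      then obtain T t where T: "unimodular T" "T ` K = (\<lambda>x. t + x) ` tri w" unfolding tri_eq_scaled by blast
      then have "bounded (T ` K)" using bounded_translation compact_imp_bounded[OF compact_tri] by metis
      then show False using unb bounded_umap[OF unimodular_imp_umap[OF T(1)]] by simp
    qed
    have "\<not> 1 < lattice_width K" using u(3) fin by (simp add: not_less)
    moreover have "\<not> 2 < lattice_width K" using u(3) by (cases "lattice_width K") (auto simp: one_ereal_def)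
    ultimately show ?thesis using A u(2) unb no fin by simp
  next
    case no: False
    have "\<not> (0 < lattice_width K \<and> lattice_width K \<le> 1)" "\<not> (1 < lattice_width K \<and> lattice_width K \<le> 2)"
      "\<not> (0 < lattice_width K \<and> lattice_width K \<le> 2)"
      "\<not> (2 < lattice_width K \<and> lattice_width K \<le> ereal (1 + 2 / sqrt 3))"
      "\<not> (0 < lattice_width K \<and> lattice_width K \<le> ereal (1 + 2 / sqrt 3))"
      by (cases "lattice_width K"; use no in auto)+
    then show ?thesis by blast
  qed
qed

end
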